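(* Let $G$ be a group and let $n\ge 1$. There is a natural exact sequence $$ \mathrm{Blim}\,\frac{F}{R'\gamma_n(F)}\hookrightarrow \frac{D_n(G)}{\gamma_n(G)}\to \mathrm{Lim}^1\,\frac{R\cap(1+\mathbf{r}\mathbf{f}+\mathbf{f}^n)}{R'(R\cap\gamma_n(F))}\twoheadrightarrow \mathrm{Lim}^1\,\frac{F\cap(1+\mathbf{r}\mathbf{f}+\mathbf{f}^n)}{R'\gamma_n(F)}, $$ in which the first map is injective, the last map is surjective, and the sequence is exact at the second and third terms. The last map is a map of pointed sets; the other maps are homomorphisms of groups.
   Context: For a group $H$: $\gamma_1(H)=H$, $\gamma_{n+1}(H)=[\gamma_n(H),H]$, $H'=\gamma_2(H)$. With $\mathbf{g}$ the augmentation ideal of $\mathbb{Z}[G]$, the $n$-th dimension subgroup is $D_n(G)=G\cap(1+\mathbf{g}^n)\supseteq\gamma_n(G)$. $\mathsf{Pres}(G)$ is the category of presentations of $G$: objects are free groups $F$ together with an epimorphism $F\twoheadrightarrow G$; morphisms are group homomorphisms over $G$. It is treated as a small category. For an object $F\twoheadrightarrow G$ put $R=\ker(F\to G)$, let $\mathbf{f}$ be the augmentation ideal of $\mathbb{Z}[F]$ and $\mathbf{r}=(R-1)\mathbb{Z}[F]$ the ideal generated by the elements $r-1$, $r\in R$. Expressions in $F,R$ such as $F/(R'\gamma_n(F))$ are regarded as functors $\mathsf{Pres}(G)\to\mathsf{Gr}$ to the category of groups. For a functor $\mathcal{F}:\mathsf{Pres}(G)\to\mathsf{Gr}$, $\mathrm{Lim}\,\mathcal{F}$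 and $\mathrm{Colim}\,\mathcal{F}$ are the limit and colimit in the category of groups over $\mathsf{Pres}(G)$. The boundary limit is $\mathrm{Blim}\,\mathcal{F}:=\mathrm{Im}(\mathrm{Lim}\,\mathcal{F}\to\mathrm{Colim}\,\mathcal{F})$, the image of the natural map (the composite $\mathrm{Lim}\,\mathcal F\to\mathcal F(c)\to\mathrm{Colim}\,\mathcal F$, for any object $c$). For a functor $\mathcal{F}:\mathcal{C}\to\mathsf{Gr}$ on a small category, write ${}^{\alpha}x=\mathcal{F}(\alpha)(x)$, and let $Z^1(\mathcal{C},\mathcal{F})$ be the set of $a\in\prod_{\alpha\in\mathrm{Mor}(\mathcal{C})}\mathcal{F}(\mathrm{cod}(\alpha))$ with $a(\alpha\beta)=a(\alpha)\cdot{}^{\alpha}a(\beta)$ for all composable $\alpha,\beta$, pointed by $a\equiv 1$. The group $\prod_{c}\mathcal{F}(c)$ acts by $(a^x)(\alpha)=x(\mathrm{cod}(\alpha))^{-1}\,a(\alpha)\,{}^{\alpha}x(\mathrm{dom}(\alpha))$, and $\mathrm{Lim}^1\mathcal{F}:=Z^1(\mathcal{C},\mathcal{F})/\prod_c\mathcal{F}(c)$, a pointed set. When $\mathcal{F}$ takes values in abelian groups this is an abelian group, the first right derived functor of $\mathrm{Lim}$. *)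

theory Defs
  imports "HOL-Algebra.Algebra"
begin

section \<open>Lower central series, integral group ring, dimension subgroups\<close>

definition commutator_subgroup :: "('a, 'b) monoid_scheme \<Rightarrow> 'a set \<Rightarrow> 'a set \<Rightarrow> 'a set" where
  "commutator_subgroup G H K =
     generate G (\<Union>h\<in>H. \<Union>k\<in>K. {h \<otimes>\<^bsub>G\<^esub> k \<otimes>\<^bsub>G\<^esub> inv\<^bsub>G\<^esub> h \<otimes>\<^bsub>G\<^esub> inv\<^bsub>G\<^esub> k})"

text \<open>The indexing starts at 1; the value at 0 is a dummy. The derived subgroup
  of a subgroup is \<^const>\<open>derived\<close> from the library.\<close>

fun lower_central :: "('a, 'b) monoid_scheme \<Rightarrow> nat \<Rightarrow> 'a set" where
  "lower_central G 0 = carrier G"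
| "lower_central G (Suc 0) = carrier G"
| "lower_central G (Suc (Suc n)) = commutator_subgroup G (lower_central G (Suc n)) (carrier G)"

text \<open>Elements of the integral group ring are the finitely supported integer functions
  that vanish off the carrier.\<close>

definition group_ring :: "('a, 'b) monoid_scheme \<Rightarrow> ('a \<Rightarrow> int) ring" where
  "group_ring G =
     \<lparr> carrier = {a. finite {x. a x \<noteq> 0} \<and> {x. a x \<noteq> 0} \<subseteq> carrier G},
       monoid.mult = (\<lambda>a b z. \<Sum>x | a x \<noteq> 0. \<Sum>y | b y \<noteq> 0. if x \<otimes>\<^bsub>G\<^esub> y = z then a x * b y else 0),
       monoid.one = (\<lambda>z. if z = \<one>\<^bsub>G\<^esub> then 1 else 0),
       ring.zero = (\<lambda>z. 0),
       ring.add = (\<lambda>a b z. a z + b z) \<rparr>"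

definition gr_single :: "'a \<Rightarrow> 'a \<Rightarrow> int" where
  "gr_single x = (\<lambda>z. if z = x then 1 else 0)"

definition aug_ideal :: "('a, 'b) monoid_scheme \<Rightarrow> ('a \<Rightarrow> int) set" where
  "aug_ideal G = {a \<in> carrier (group_ring G). (\<Sum>x | a x \<noteq> 0. a x) = 0}"

definition relative_ideal :: "('a, 'b) monoid_scheme \<Rightarrow> 'a set \<Rightarrow> ('a \<Rightarrow> int) set" where
  "relative_ideal G R =
     Idl\<^bsub>group_ring G\<^esub> ((\<lambda>r. gr_single r \<ominus>\<^bsub>group_ring G\<^esub> \<one>\<^bsub>group_ring G\<^esub>) ` R)"

primrec ideal_power :: "('a, 'b) ring_scheme \<Rightarrow> 'a set \<Rightarrow> nat \<Rightarrow> 'a set" where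
  "ideal_power S I 0 = carrier S"
| "ideal_power S I (Suc n) = ideal_prod S (ideal_power S I n) I"

text \<open>\<open>G \<inter> (1 + I)\<close>, with \<open>G\<close> viewed inside its group ring.\<close>

definition one_plus :: "('a, 'b) monoid_scheme \<Rightarrow> ('a \<Rightarrow> int) set \<Rightarrow> 'a set" where
  "one_plus G I =
     {g \<in> carrier G. gr_single g \<ominus>\<^bsub>group_ring G\<^esub> \<one>\<^bsub>group_ring G\<^esub> \<in> I}"

definition dimension_subgroup :: "('a, 'b) monoid_scheme \<Rightarrow> nat \<Rightarrow> 'a set" where
  "dimension_subgroup G n = one_plus G (ideal_power (group_ring G) (aug_ideal G) n)"

definition dim_quotient :: "'a monoid \<Rightarrow> nat \<Rightarrow> 'a set monoid" where
  "dim_quotient G n = (G\<lparr>carrier := dimension_subgroup G n\<rparr>) Mod (lower_central G n)"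


section \<open>Free groups\<close>

text \<open>A letter \<open>(True, x)\<close> stands for \<open>x\<close>, a letter \<open>(False, x)\<close> for its inverse.\<close>

definition eval_word :: "('a, 'b) monoid_scheme \<Rightarrow> (bool \<times> 'a) list \<Rightarrow> 'a" where
  "eval_word F w = foldr (\<lambda>(e, x) g. (if e then x else inv\<^bsub>F\<^esub> x) \<otimes>\<^bsub>F\<^esub> g) w \<one>\<^bsub>F\<^esub>"

definition reduced_word :: "(bool \<times> 'a) list \<Rightarrow> bool" where
  "reduced_word w \<longleftrightarrow> successively (\<lambda>(d, x) (e, y). \<not> (x = y \<and> d \<noteq> e)) w"

definition free_basis :: "('a, 'b) monoid_scheme \<Rightarrow> 'a set \<Rightarrow> bool" where
  "free_basis F B \<longleftrightarrow>
     B \<subseteq> carrier F \<and> generate F B = carrier F \<and>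
     (\<forall>w. reduced_word w \<and> snd ` set w \<subseteq> B \<and> w \<noteq> [] \<longrightarrow> eval_word F w \<noteq> \<one>\<^bsub>F\<^esub>)"

definition free_group :: "('a, 'b) monoid_scheme \<Rightarrow> bool" where
  "free_group F \<longleftrightarrow> group F \<and> (\<exists>B. free_basis F B)"


section \<open>Small categories and group-valued functors\<close>

text \<open>\<open>Comp C a b\<close> is the composite \<open>a \<circ> b\<close>, meaningful when
  \<open>Dom C a = Cod C b\<close>.\<close>

record ('o, 'm) small_cat =
  Ob :: "'o set"
  Mor :: "'m set"
  Dom :: "'m \<Rightarrow> 'o"
  Cod :: "'m \<Rightarrow> 'o"
  Ident :: "'o \<Rightarrow> 'm"
  Comp :: "'m \<Rightarrow> 'm \<Rightarrow> 'm"

record ('o, 'm, 'x) gr_functor =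
  fob :: "'o \<Rightarrow> 'x monoid"
  fmor :: "'m \<Rightarrow> 'x \<Rightarrow> 'x"

definition lim_group ::
  "('o, 'm) small_cat \<Rightarrow> ('o, 'm, 'x) gr_functor \<Rightarrow> ('o \<Rightarrow> 'x) monoid" where
  "lim_group C F =
     (product_group (Ob C) (fob F))
       \<lparr>carrier := {x \<in> carrier (product_group (Ob C) (fob F)).
                     \<forall>\<alpha>\<in>Mor C. fmor F \<alpha> (x (Dom C \<alpha>)) = x (Cod C \<alpha>)}\<rparr>"

text \<open>The colimit of groups: words in the disjoint union of the groups, modulo the
  congruence generated by the multiplication tables and the relations
  \<open>F(\<alpha>)(x) = x\<close>.\<close>

definition colim_words ::
  "('o, 'm) small_cat \<Rightarrow> ('o, 'm, 'x) gr_functor \<Rightarrow> ('o \<times> 'x) list set" where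
  "colim_words C F = lists (SIGMA c : Ob C. carrier (fob F c))"

inductive_set colim_rel ::
  "('o, 'm) small_cat \<Rightarrow> ('o, 'm, 'x) gr_functor \<Rightarrow> (('o \<times> 'x) list \<times> ('o \<times> 'x) list) set"
  for C :: "('o, 'm) small_cat" and F :: "('o, 'm, 'x) gr_functor" where
  refl: "w \<in> colim_words C F \<Longrightarrow> (w, w) \<in> colim_rel C F"
| sym: "(u, v) \<in> colim_rel C F \<Longrightarrow> (v, u) \<in> colim_rel C F"
| trans: "(u, v) \<in> colim_rel C F \<Longrightarrow> (v, w) \<in> colim_rel C F \<Longrightarrow> (u, w) \<in> colim_rel C F"
| append: "(u, u') \<in> colim_rel C F \<Longrightarrow> (v, v') \<in> colim_rel C F \<Longrightarrow>
    (u @ v, u' @ v') \<in> colim_rel C F"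
| one: "c \<in> Ob C \<Longrightarrow> ([(c, \<one>\<^bsub>fob F c\<^esub>)], []) \<in> colim_rel C F"
| mult: "c \<in> Ob C \<Longrightarrow> x \<in> carrier (fob F c) \<Longrightarrow> y \<in> carrier (fob F c) \<Longrightarrow>
    ([(c, x), (c, y)], [(c, x \<otimes>\<^bsub>fob F c\<^esub> y)]) \<in> colim_rel C F"
| mor: "\<alpha> \<in> Mor C \<Longrightarrow> x \<in> carrier (fob F (Dom C \<alpha>)) \<Longrightarrow>
    ([(Cod C \<alpha>, fmor F \<alpha> x)], [(Dom C \<alpha>, x)]) \<in> colim_rel C F"

definition colim_group ::
  "('o, 'm) small_cat \<Rightarrow> ('o, 'm, 'x) gr_functor \<Rightarrow> ('o \<times> 'x) list set monoid" where
  "colim_group C F =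
     \<lparr> carrier = colim_words C F // colim_rel C F,
       monoid.mult = (\<lambda>U V. \<Union>u\<in>U. \<Union>v\<in>V. colim_rel C F `` {u @ v}),
       monoid.one = colim_rel C F `` {[]} \<rparr>"

definition colim_in ::
  "('o, 'm) small_cat \<Rightarrow> ('o, 'm, 'x) gr_functor \<Rightarrow> 'o \<Rightarrow> 'x \<Rightarrow> ('o \<times> 'x) list set" where
  "colim_in C F c x = colim_rel C F `` {[(c, x)]}"

text \<open>The homomorphism from the colimit to \<open>H\<close> induced by a cocone
  \<open>\<phi> c : F c \<rightarrow> H\<close>; the set whose element is picked is a singleton whenever \<open>\<phi>\<close> is a cocone
  of group homomorphisms.\<close>

definition colim_desc ::
  "('y, 'z) monoid_scheme \<Rightarrow> ('o \<Rightarrow> 'x \<Rightarrow> 'y) \<Rightarrow> ('o \<times> 'x) list set \<Rightarrow> 'y" where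
  "colim_desc H \<phi> W =
     the_elem ((\<lambda>w. foldr (\<lambda>(c, x) h. \<phi> c x \<otimes>\<^bsub>H\<^esub> h) w \<one>\<^bsub>H\<^esub>) ` W)"

text \<open>The natural map from the limit to the colimit goes through the value at an arbitrary
  object; over a nonempty connected category the choice does not matter.\<close>

definition lim_to_colim ::
  "('o, 'm) small_cat \<Rightarrow> ('o, 'm, 'x) gr_functor \<Rightarrow> ('o \<Rightarrow> 'x) \<Rightarrow> ('o \<times> 'x) list set" where
  "lim_to_colim C F x = (let c = (SOME c. c \<in> Ob C) in colim_in C F c (x c))"

definition blim_group ::
  "('o, 'm) small_cat \<Rightarrow> ('o, 'm, 'x) gr_functor \<Rightarrow> ('o \<times> 'x) list set monoid" where
  "blim_group C F =
     (colim_group C F)\<lparr>carrier := lim_to_colim C F ` carrier (lim_group C F)\<rparr>"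


section \<open>The first derived limit\<close>

definition cochain_group ::
  "('o, 'm) small_cat \<Rightarrow> ('o, 'm, 'x) gr_functor \<Rightarrow> ('m \<Rightarrow> 'x) monoid" where
  "cochain_group C F = product_group (Mor C) (\<lambda>\<alpha>. fob F (Cod C \<alpha>))"

definition cocycles ::
  "('o, 'm) small_cat \<Rightarrow> ('o, 'm, 'x) gr_functor \<Rightarrow> ('m \<Rightarrow> 'x) set" where
  "cocycles C F =
     {a \<in> carrier (cochain_group C F).
        \<forall>\<alpha>\<in>Mor C. \<forall>\<beta>\<in>Mor C. Dom C \<alpha> = Cod C \<beta> \<longrightarrow>
          a (Comp C \<alpha> \<beta>) = a \<alpha> \<otimes>\<^bsub>fob F (Cod C \<alpha>)\<^esub> fmor F \<alpha> (a \<beta>)}"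

definition twist ::
  "('o, 'm) small_cat \<Rightarrow> ('o, 'm, 'x) gr_functor \<Rightarrow> ('m \<Rightarrow> 'x) \<Rightarrow> ('o \<Rightarrow> 'x) \<Rightarrow> 'm \<Rightarrow> 'x" where
  "twist C F a x =
     (\<lambda>\<alpha>\<in>Mor C. inv\<^bsub>fob F (Cod C \<alpha>)\<^esub> (x (Cod C \<alpha>)) \<otimes>\<^bsub>fob F (Cod C \<alpha>)\<^esub> a \<alpha>
                  \<otimes>\<^bsub>fob F (Cod C \<alpha>)\<^esub> fmor F \<alpha> (x (Dom C \<alpha>)))"

definition twist_orbit ::
  "('o, 'm) small_cat \<Rightarrow> ('o, 'm, 'x) gr_functor \<Rightarrow> ('m \<Rightarrow> 'x) \<Rightarrow> ('m \<Rightarrow> 'x) set" where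
  "twist_orbit C F a = twist C F a ` carrier (product_group (Ob C) (fob F))"

definition lim1 ::
  "('o, 'm) small_cat \<Rightarrow> ('o, 'm, 'x) gr_functor \<Rightarrow> ('m \<Rightarrow> 'x) set set" where
  "lim1 C F = twist_orbit C F ` cocycles C F"

definition lim1_point ::
  "('o, 'm) small_cat \<Rightarrow> ('o, 'm, 'x) gr_functor \<Rightarrow> ('m \<Rightarrow> 'x) set" where
  "lim1_point C F = twist_orbit C F \<one>\<^bsub>cochain_group C F\<^esub>"

text \<open>For abelian coefficients the orbits are the cosets of the group of coboundaries, and they
  are multiplied as such. For nonabelian coefficients only the underlying
  pointed set is meaningful.\<close>

definition lim1_group ::
  "('o, 'm) small_cat \<Rightarrow> ('o, 'm, 'x) gr_functor \<Rightarrow> ('m \<Rightarrow> 'x) set monoid" where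
  "lim1_group C F =
     \<lparr> carrier = lim1 C F, monoid.mult = set_mult (cochain_group C F), monoid.one = lim1_point C F \<rparr>"

text \<open>The map induced by a natural transformation \<open>\<tau> : E \<rightarrow> F\<close>; the union is over
  copies of a single orbit.\<close>

definition lim1_map ::
  "('o, 'm) small_cat \<Rightarrow> ('o, 'm, 'x) gr_functor \<Rightarrow> ('o \<Rightarrow> 'w \<Rightarrow> 'x) \<Rightarrow>
   ('m \<Rightarrow> 'w) set \<Rightarrow> ('m \<Rightarrow> 'x) set" where
  "lim1_map C F \<tau> A = (\<Union>a\<in>A. twist_orbit C F (\<lambda>\<alpha>\<in>Mor C. \<tau> (Cod C \<alpha>) (a \<alpha>)))"

text \<open>The connecting map of a short exact sequence of functors from \<open>E\<close> via \<open>\<tau>\<close> to \<open>F\<close> and via \<open>p\<close>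
  to a constant functor \<open>H\<close>. An element \<open>h\<close> of \<open>H\<close> is lifted to a family \<open>x\<close>, and
  \<open>h\<close> goes to the class of the cocycle \<open>inv (x (cod \<alpha>)) \<cdot> F(\<alpha>)(x (dom \<alpha>))\<close>, read in \<open>E\<close>. The set
  of cocycles obtained from all the lifts of \<open>h\<close> is exactly one orbit.\<close>

definition lim1_connecting ::
  "('o, 'm) small_cat \<Rightarrow> ('o, 'm, 'w) gr_functor \<Rightarrow> ('o, 'm, 'x) gr_functor \<Rightarrow>
   ('o \<Rightarrow> 'w \<Rightarrow> 'x) \<Rightarrow> ('o \<Rightarrow> 'x \<Rightarrow> 'h) \<Rightarrow> 'h \<Rightarrow> ('m \<Rightarrow> 'w) set" where
  "lim1_connecting C E F \<tau> p h =
     {a \<in> cocycles C E. \<exists>x \<in> carrier (product_group (Ob C) (fob F)).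
        (\<forall>c\<in>Ob C. p c (x c) = h) \<and>
        (\<forall>\<alpha>\<in>Mor C. \<tau> (Cod C \<alpha>) (a \<alpha>) =
           inv\<^bsub>fob F (Cod C \<alpha>)\<^esub> (x (Cod C \<alpha>)) \<otimes>\<^bsub>fob F (Cod C \<alpha>)\<^esub> fmor F \<alpha> (x (Dom C \<alpha>)))}"


section \<open>The category of presentations\<close>

text \<open>Smallness: all free groups have their underlying set inside a fixed type \<open>'f\<close>, which plays
  the role of the universe. Maps are extensional, so that equality of morphisms is
  equality on the carrier.\<close>

record ('f, 'a) presentation =
  fgrp :: "'f monoid"
  proj :: "'f \<Rightarrow> 'a"

record ('f, 'a) pres_mor =
  pdom :: "('f, 'a) presentation"
  pcod :: "('f, 'a) presentation"
  pmap :: "'f \<Rightarrow> 'f"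

definition presentations :: "'a monoid \<Rightarrow> ('f, 'a) presentation set" where
  "presentations G =
     {c. free_group (fgrp c) \<and> proj c \<in> epi (fgrp c) G \<and> proj c \<in> extensional (carrier (fgrp c))}"

definition pres_mors :: "'a monoid \<Rightarrow> ('f, 'a) pres_mor set" where
  "pres_mors G =
     {\<alpha>. pdom \<alpha> \<in> presentations G \<and> pcod \<alpha> \<in> presentations G \<and>
         pmap \<alpha> \<in> hom (fgrp (pdom \<alpha>)) (fgrp (pcod \<alpha>)) \<and>
         pmap \<alpha> \<in> extensional (carrier (fgrp (pdom \<alpha>))) \<and>
         (\<forall>x\<in>carrier (fgrp (pdom \<alpha>)). proj (pcod \<alpha>) (pmap \<alpha> x) = proj (pdom \<alpha>) x)}"

definition Pres ::
  "'f itself \<Rightarrow> 'a monoid \<Rightarrow> (('f, 'a) presentation, ('f, 'a) pres_mor) small_cat" where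
  "Pres _ G =
     \<lparr> Ob = presentations G, Mor = pres_mors G, Dom = pdom, Cod = pcod,
       Ident = (\<lambda>c. \<lparr>pdom = c, pcod = c, pmap = (\<lambda>x\<in>carrier (fgrp c). x)\<rparr>),
       Comp = (\<lambda>\<alpha> \<beta>. \<lparr>pdom = pdom \<beta>, pcod = pcod \<alpha>,
                       pmap = compose (carrier (fgrp (pdom \<beta>))) (pmap \<alpha>) (pmap \<beta>)\<rparr>) \<rparr>"


section \<open>Functors on presentations\<close>

definition rel_sub :: "'a monoid \<Rightarrow> ('f, 'a) presentation \<Rightarrow> 'f set" where
  "rel_sub G c = kernel (fgrp c) G (proj c)"

text \<open>\<open>F \<inter> (1 + rf + f\<^sup>n)\<close>\<close>

definition rf_sub :: "'a monoid \<Rightarrow> nat \<Rightarrow> ('f, 'a) presentation \<Rightarrow> 'f set" where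
  "rf_sub G n c =
     (let F = fgrp c; S = group_ring F; \<ff> = aug_ideal F; \<rr> = relative_ideal F (rel_sub G c)
      in one_plus F (ideal_prod S \<rr> \<ff> <+>\<^bsub>S\<^esub> ideal_power S \<ff> n))"

text \<open>\<open>R' \<gamma>\<^sub>n(F)\<close> and \<open>R' (R \<inter> \<gamma>\<^sub>n(F))\<close>\<close>

definition rel_gamma :: "'a monoid \<Rightarrow> nat \<Rightarrow> ('f, 'a) presentation \<Rightarrow> 'f set" where
  "rel_gamma G n c =
     derived (fgrp c) (rel_sub G c) <#>\<^bsub>fgrp c\<^esub> lower_central (fgrp c) n"

definition rel_gamma_cap :: "'a monoid \<Rightarrow> nat \<Rightarrow> ('f, 'a) presentation \<Rightarrow> 'f set" where
  "rel_gamma_cap G n c =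
     derived (fgrp c) (rel_sub G c) <#>\<^bsub>fgrp c\<^esub> (rel_sub G c \<inter> lower_central (fgrp c) n)"

text \<open>The functor \<open>c \<mapsto> U c / N c\<close>, with values in groups of cosets. A morphism sends the
  coset \<open>N x\<close> to \<open>N' \<alpha>(x)\<close>, which as a set is the product of \<open>N'\<close> and the image of \<open>N x\<close>.\<close>

definition subquotient_functor ::
  "(('f, 'a) presentation \<Rightarrow> 'f set) \<Rightarrow> (('f, 'a) presentation \<Rightarrow> 'f set) \<Rightarrow>
   (('f, 'a) presentation, ('f, 'a) pres_mor, 'f set) gr_functor" where
  "subquotient_functor U N =
     \<lparr> fob = (\<lambda>c. ((fgrp c)\<lparr>carrier := U c\<rparr>) Mod (N c)),
       fmor = (\<lambda>\<alpha> S. N (pcod \<alpha>) <#>\<^bsub>fgrp (pcod \<alpha>)\<^esub> (pmap \<alpha> ` S)) \<rparr>"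

definition F_mod ::
  "'a monoid \<Rightarrow> nat \<Rightarrow> (('f, 'a) presentation, ('f, 'a) pres_mor, 'f set) gr_functor" where
  "F_mod G n = subquotient_functor (\<lambda>c. carrier (fgrp c)) (rel_gamma G n)"

definition Rrf_mod ::
  "'a monoid \<Rightarrow> nat \<Rightarrow> (('f, 'a) presentation, ('f, 'a) pres_mor, 'f set) gr_functor" where
  "Rrf_mod G n = subquotient_functor (\<lambda>c. rel_sub G c \<inter> rf_sub G n c) (rel_gamma_cap G n)"

definition Frf_mod ::
  "'a monoid \<Rightarrow> nat \<Rightarrow> (('f, 'a) presentation, ('f, 'a) pres_mor, 'f set) gr_functor" where
  "Frf_mod G n = subquotient_functor (rf_sub G n) (rel_gamma G n)"


section \<open>The natural maps\<close>

text \<open>The map \<open>U c / N c \<rightarrow> G / \<gamma>\<^sub>n(G)\<close> induced by the projection of the presentation.\<close>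

definition proj_quot :: "'a monoid \<Rightarrow> nat \<Rightarrow> ('f, 'a) presentation \<Rightarrow> 'f set \<Rightarrow> 'a set" where
  "proj_quot G n c S = lower_central G n <#>\<^bsub>G\<^esub> (proj c ` S)"

text \<open>The restriction to the boundary limit of the map
  \<open>Colim F/(R' \<gamma>\<^sub>n(F)) \<rightarrow> G/\<gamma>\<^sub>n(G)\<close>.\<close>

definition blim_to_dim ::
  "'a monoid \<Rightarrow> nat \<Rightarrow> (('f, 'a) presentation \<times> 'f set) list set \<Rightarrow> 'a set" where
  "blim_to_dim G n = colim_desc (G Mod lower_central G n) (proj_quot G n)"

text \<open>The inclusion of \<open>R\<close> in \<open>F\<close> induces the transformation from \<^const>\<open>Rrf_mod\<close> to
  \<^const>\<open>Frf_mod\<close>; a coset is enlarged to a coset of the bigger subgroup.\<close>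

definition incl_quot :: "'a monoid \<Rightarrow> nat \<Rightarrow> ('f, 'a) presentation \<Rightarrow> 'f set \<Rightarrow> 'f set" where
  "incl_quot G n c S = rel_gamma G n c <#>\<^bsub>fgrp c\<^esub> S"

definition dim_to_lim1 ::
  "'f itself \<Rightarrow> 'a monoid \<Rightarrow> nat \<Rightarrow> 'a set \<Rightarrow> (('f, 'a) pres_mor \<Rightarrow> 'f set) set" where
  "dim_to_lim1 T G n =
     lim1_connecting (Pres T G) (Rrf_mod G n) (Frf_mod G n) (incl_quot G n) (proj_quot G n)"

definition lim1_to_lim1 ::
  "'f itself \<Rightarrow> 'a monoid \<Rightarrow> nat \<Rightarrow>
   (('f, 'a) pres_mor \<Rightarrow> 'f set) set \<Rightarrow> (('f, 'a) pres_mor \<Rightarrow> 'f set) set" where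
  "lim1_to_lim1 T G n = lim1_map (Pres T G) (Frf_mod G n) (incl_quot G n)"

end

theory Submission
  imports Defs
begin

text \<open>
  Write \<open>f\<close>, \<open>r\<close> for the ideals of the statement, \<open>S = F \<inter> (1 + rf + f\<^sup>n)\<close> and \<open>N = R' \<gamma>\<^sub>n(F)\<close>. Since \<open>r\<close>
  consists of the elements \<open>r - 1\<close> modulo \<open>rf\<close>, every element of \<open>D\<^sub>n(G)\<close> lifts to \<open>S\<close>, and
  \<open>(R \<inter> S)/R'(R \<inter> \<gamma>\<^sub>n(F)) \<rightarrow> S/N \<rightarrow> D\<^sub>n(G)/\<gamma>\<^sub>n(G)\<close> is a short exact sequence of functors. It is central:
  \<open>r\<close> kills the module \<open>R/R'\<close> and \<open>f\<^sup>n\<close> maps it to the image of \<open>R \<inter> \<gamma>\<^sub>n(F)\<close>. The category of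
  presentations is connected and simply connected, because a suitable presentation \<open>u\<close> is a
  coproduct of two copies of itself. So the long exact sequence of \<open>Lim\<close> and \<open>Lim\<^sup>1\<close> has
  \<open>Lim(S/N) \<rightarrow> D\<^sub>n(G)/\<gamma>\<^sub>n(G) \<rightarrow> Lim\<^sup>1 \<rightarrow> Lim\<^sup>1 \<rightarrow> 1\<close>, and its first map has the image \<open>Blim(F/N)\<close>: the
  colimit of \<open>F/N\<close> is \<open>G/\<gamma>\<^sub>n(G)\<close>, and a Fox derivative on \<open>u\<close> shows that an element of \<open>F/N\<close> whose images
  under the two embeddings of \<open>u\<close> agree lies in \<open>S/N\<close>.
\<close>

section \<open>The integral group ring\<close>

text \<open>The functor S/N is handled as a functor to groups, not to abelian groups, so the long
  exact sequence is proved by hand with cocycles. Each special property then has one task there: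
  centrality of the kernel makes the connecting map multiplicative, connectedness gives exactness at
  the third term, and simple connectedness, in the form that every cocycle with values in the
  constant group D_n(G)/gamma_n(G) is a coboundary, gives surjectivity of the last map. The sequence
  starts with a boundary limit because Lim(S/N) also contains the limit of the kernel, which dies in
  D_n(G)/gamma_n(G). The image in the colimit of F/N forgets exactly this part. The bridge between
  the two is that Lim(F/N) and Lim(S/N) have the same elements. Here the Fox derivative is chosen to
  be x - 1 on the first embedded copy of u and 0 on the second, so that x - 1 can be read off from
  an element of N.\<close>

lemma sum_swap3:
  "(\<Sum>w\<in>C. \<Sum>x\<in>A. \<Sum>y\<in>B. g w x y) = (\<Sum>x\<in>A. \<Sum>y\<in>B. \<Sum>w\<in>C. g w x y)"
  by (subst sum.swap, rule sum.cong[OF HOL.refl], rule sum.swap)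

context group
begin

abbreviation ZG where "ZG \<equiv> group_ring G"

lemma gr_carrier: "a \<in> carrier ZG \<longleftrightarrow> finite {x. a x \<noteq> 0} \<and> {x. a x \<noteq> 0} \<subseteq> carrier G"
  by (simp add: group_ring_def)

lemma gr_zero: "\<zero>\<^bsub>ZG\<^esub> = (\<lambda>z. 0)"
  by (simp add: group_ring_def)

lemma gr_one: "\<one>\<^bsub>ZG\<^esub> = gr_single \<one>"
  by (simp add: group_ring_def gr_single_def)

lemma gr_add: "a \<oplus>\<^bsub>ZG\<^esub> b = (\<lambda>z. a z + b z)"
  by (simp add: group_ring_def)

text \<open>The supports of sums and products are only bounded by those of their parts. The defining
  double sum may therefore run over any finite sets containing the supports, so that distributivity
  and associativity compare sums over common index sets.\<close>

lemma gr_mult: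
  assumes "finite A" "{x. a x \<noteq> 0} \<subseteq> A" "finite B" "{x. b x \<noteq> 0} \<subseteq> B"
  shows "(a \<otimes>\<^bsub>ZG\<^esub> b) z = (\<Sum>x\<in>A. \<Sum>y\<in>B. if x \<otimes> y = z then a x * b y else 0)"
proof -
  have "(\<Sum>x | a x \<noteq> 0. \<Sum>y | b y \<noteq> 0. if x \<otimes> y = z then a x * b y else 0) =
      (\<Sum>x | a x \<noteq> 0. \<Sum>y\<in>B. if x \<otimes> y = z then a x * b y else 0)"
    by (rule sum.cong[OF HOL.refl], rule sum.mono_neutral_left) (use assms in auto)
  also have "\<dots> = (\<Sum>x\<in>A. \<Sum>y\<in>B. if x \<otimes> y = z then a x * b y else 0)"
    by (rule sum.mono_neutral_left) (use assms in \<open>auto intro!: sum.neutral\<close>)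
  finally show ?thesis by (simp add: group_ring_def)
qed

lemma gr_mult_supp:
  assumes "a \<in> carrier ZG" "b \<in> carrier ZG"
  shows "{z. (a \<otimes>\<^bsub>ZG\<^esub> b) z \<noteq> 0} \<subseteq> (\<lambda>(x, y). x \<otimes> y) ` ({x. a x \<noteq> 0} \<times> {x. b x \<noteq> 0})"
proof
  fix z assume "z \<in> {z. (a \<otimes>\<^bsub>ZG\<^esub> b) z \<noteq> 0}"
  then have "(\<Sum>x | a x \<noteq> 0. \<Sum>y | b y \<noteq> 0. if x \<otimes> y = z then a x * b y else 0) \<noteq> 0"
    by (simp add: group_ring_def)
  then obtain x where x: "a x \<noteq> 0" "(\<Sum>y | b y \<noteq> 0. if x \<otimes> y = z then a x * b y else 0) \<noteq> 0"
    by (rule sum.not_neutral_contains_not_neutral) simp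
  from x(2) obtain y where y: "b y \<noteq> 0" "(if x \<otimes> y = z then a x * b y else 0) \<noteq> 0"
    by (rule sum.not_neutral_contains_not_neutral) simp
  from y(2) have "x \<otimes> y = z" by presburger
  moreover have "(x, y) \<in> {x. a x \<noteq> 0} \<times> {x. b x \<noteq> 0}" using x(1) y(1) by simp
  ultimately have "x \<otimes> y = z" "(x, y) \<in> {x. a x \<noteq> 0} \<times> {x. b x \<noteq> 0}" .
  then show "z \<in> (\<lambda>(x, y). x \<otimes> y) ` ({x. a x \<noteq> 0} \<times> {x. b x \<noteq> 0})"
    by (metis (no_types, lifting) case_prod_conv image_eqI)
qed

lemma gr_mult_closed:
  assumes "a \<in> carrier ZG" "b \<in> carrier ZG"
  shows "a \<otimes>\<^bsub>ZG\<^esub> b \<in> carrier ZG"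
proof -
  have "(\<lambda>(x, y). x \<otimes> y) ` ({x. a x \<noteq> 0} \<times> {x. b x \<noteq> 0}) \<subseteq> carrier G"
    using assms unfolding gr_carrier by auto
  then show ?thesis
    using gr_mult_supp[OF assms] assms unfolding gr_carrier
    by (meson finite_SigmaI finite_imageI finite_subset order_trans)
qed

lemma gr_single_carrier [simp]: "x \<in> carrier G \<Longrightarrow> gr_single x \<in> carrier ZG"
  by (auto simp: gr_carrier gr_single_def)

lemma gr_single_mult:
  assumes "x \<in> carrier G" "y \<in> carrier G"
  shows "gr_single (x \<otimes> y) = gr_single x \<otimes>\<^bsub>ZG\<^esub> gr_single y"
proof
  fix z show "gr_single (x \<otimes> y) z = (gr_single x \<otimes>\<^bsub>ZG\<^esub> gr_single y) z"
    by (subst gr_mult[of "{x}" _ "{y}"]) (auto simp: gr_single_def)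
qed

lemma gr_l_distr:
  assumes "a \<in> carrier ZG" "b \<in> carrier ZG" "c \<in> carrier ZG"
  shows "(a \<oplus>\<^bsub>ZG\<^esub> b) \<otimes>\<^bsub>ZG\<^esub> c = a \<otimes>\<^bsub>ZG\<^esub> c \<oplus>\<^bsub>ZG\<^esub> b \<otimes>\<^bsub>ZG\<^esub> c"
proof
  fix z
  let ?A = "{x. a x \<noteq> 0} \<union> {x. b x \<noteq> 0}" and ?C = "{x. c x \<noteq> 0}"
  have f: "finite ?A" "finite ?C" using assms by (auto simp: gr_carrier)
  have m: "(p \<otimes>\<^bsub>ZG\<^esub> c) z = (\<Sum>x\<in>?A. \<Sum>y\<in>?C. if x \<otimes> y = z then p x * c y else 0)"
    if "{x. p x \<noteq> 0} \<subseteq> ?A" for p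
    by (rule gr_mult[OF f(1) that f(2) subset_refl])
  have "((a \<oplus>\<^bsub>ZG\<^esub> b) \<otimes>\<^bsub>ZG\<^esub> c) z = (\<Sum>x\<in>?A. \<Sum>y\<in>?C. if x \<otimes> y = z then (a x + b x) * c y else 0)"
    by (subst m) (unfold gr_add, auto)
  also have "\<dots> = (a \<otimes>\<^bsub>ZG\<^esub> c) z + (b \<otimes>\<^bsub>ZG\<^esub> c) z"
    unfolding m[of a, OF Un_upper1] m[of b, OF Un_upper2] sum.distrib[symmetric]
    by (intro sum.cong HOL.refl) (simp add: distrib_right)
  finally show "((a \<oplus>\<^bsub>ZG\<^esub> b) \<otimes>\<^bsub>ZG\<^esub> c) z = (a \<otimes>\<^bsub>ZG\<^esub> c \<oplus>\<^bsub>ZG\<^esub> b \<otimes>\<^bsub>ZG\<^esub> c) z"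
    by (simp only: gr_add[of "a \<otimes>\<^bsub>ZG\<^esub> c"])
qed

lemma gr_r_distr:
  assumes "a \<in> carrier ZG" "b \<in> carrier ZG" "c \<in> carrier ZG"
  shows "c \<otimes>\<^bsub>ZG\<^esub> (a \<oplus>\<^bsub>ZG\<^esub> b) = c \<otimes>\<^bsub>ZG\<^esub> a \<oplus>\<^bsub>ZG\<^esub> c \<otimes>\<^bsub>ZG\<^esub> b"
proof
  fix z
  let ?A = "{x. a x \<noteq> 0} \<union> {x. b x \<noteq> 0}" and ?C = "{x. c x \<noteq> 0}"
  have f: "finite ?A" "finite ?C" using assms by (auto simp: gr_carrier)
  have m: "(c \<otimes>\<^bsub>ZG\<^esub> p) z = (\<Sum>x\<in>?C. \<Sum>y\<in>?A. if x \<otimes> y = z then c x * p y else 0)"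
    if "{x. p x \<noteq> 0} \<subseteq> ?A" for p
    by (rule gr_mult[OF f(2) subset_refl f(1) that])
  have "(c \<otimes>\<^bsub>ZG\<^esub> (a \<oplus>\<^bsub>ZG\<^esub> b)) z = (\<Sum>x\<in>?C. \<Sum>y\<in>?A. if x \<otimes> y = z then c x * (a y + b y) else 0)"
    by (subst m) (unfold gr_add, auto)
  also have "\<dots> = (c \<otimes>\<^bsub>ZG\<^esub> a) z + (c \<otimes>\<^bsub>ZG\<^esub> b) z"
    unfolding m[of a, OF Un_upper1] m[of b, OF Un_upper2] sum.distrib[symmetric]
    by (intro sum.cong HOL.refl) (simp add: distrib_left)
  finally show "(c \<otimes>\<^bsub>ZG\<^esub> (a \<oplus>\<^bsub>ZG\<^esub> b)) z = (c \<otimes>\<^bsub>ZG\<^esub> a \<oplus>\<^bsub>ZG\<^esub> c \<otimes>\<^bsub>ZG\<^esub> b) z"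
    by (simp only: gr_add[of "c \<otimes>\<^bsub>ZG\<^esub> a"])
qed

text \<open>Both sides unfold to one triple sum over the three supports. The fourth sum runs over
  the intermediate products \<open>?AB\<close> or \<open>?BC\<close>; for fixed factors only one of
  them is hit, so \<open>sum.delta'\<close> collapses it.\<close>

lemma gr_assoc:
  assumes "a \<in> carrier ZG" "b \<in> carrier ZG" "c \<in> carrier ZG"
  shows "a \<otimes>\<^bsub>ZG\<^esub> b \<otimes>\<^bsub>ZG\<^esub> c = a \<otimes>\<^bsub>ZG\<^esub> (b \<otimes>\<^bsub>ZG\<^esub> c)"
proof
  fix z
  let ?A = "{x. a x \<noteq> 0}" and ?B = "{x. b x \<noteq> 0}" and ?C = "{x. c x \<noteq> 0}"
  have f: "finite ?A" "finite ?B" "finite ?C" using assms by (auto simp: gr_carrier)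
  have s: "?A \<subseteq> carrier G" "?B \<subseteq> carrier G" "?C \<subseteq> carrier G" using assms by (auto simp: gr_carrier)
  let ?AB = "(\<lambda>(x, y). x \<otimes> y) ` (?A \<times> ?B)" and ?BC = "(\<lambda>(x, y). x \<otimes> y) ` (?B \<times> ?C)"
  have "(a \<otimes>\<^bsub>ZG\<^esub> b \<otimes>\<^bsub>ZG\<^esub> c) z = (\<Sum>w\<in>?AB. \<Sum>u\<in>?C. if w \<otimes> u = z then (a \<otimes>\<^bsub>ZG\<^esub> b) w * c u else 0)"
    by (rule gr_mult) (use f gr_mult_supp[OF assms(1,2)] in auto)
  also have "\<dots> = (\<Sum>u\<in>?C. \<Sum>w\<in>?AB. \<Sum>x\<in>?A. \<Sum>y\<in>?B.
      if x \<otimes> y = w \<and> w \<otimes> u = z then a x * b y * c u else 0)"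
    apply (subst sum.swap)
    by (intro sum.cong HOL.refl) (auto simp: gr_mult[OF f(1) _ f(2)] sum_distrib_right intro!: sum.cong)
  also have "\<dots> = (\<Sum>u\<in>?C. \<Sum>x\<in>?A. \<Sum>y\<in>?B. \<Sum>w\<in>?AB. 
      if x \<otimes> y = w then if w \<otimes> u = z then a x * b y * c u else 0 else 0)"
    by (rule sum.cong[OF HOL.refl], subst sum_swap3, intro sum.cong HOL.refl, auto)
  also have "\<dots> = (\<Sum>u\<in>?C. \<Sum>x\<in>?A. \<Sum>y\<in>?B. if x \<otimes> y \<otimes> u = z then a x * b y * c u else 0)"
    by (intro sum.cong HOL.refl) (subst sum.delta', use f in auto)
  also have "\<dots> = (\<Sum>u\<in>?C. \<Sum>x\<in>?A. \<Sum>y\<in>?B. if x \<otimes> (y \<otimes> u) = z then a x * b y * c u else 0)"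
    by (intro sum.cong HOL.refl) (use s in \<open>auto simp: m_assoc subset_iff\<close>)
  finally have 1: "(a \<otimes>\<^bsub>ZG\<^esub> b \<otimes>\<^bsub>ZG\<^esub> c) z = \<dots>" .
  have "(a \<otimes>\<^bsub>ZG\<^esub> (b \<otimes>\<^bsub>ZG\<^esub> c)) z = (\<Sum>x\<in>?A. \<Sum>w\<in>?BC. if x \<otimes> w = z then a x * (b \<otimes>\<^bsub>ZG\<^esub> c) w else 0)"
    by (rule gr_mult) (use f gr_mult_supp[OF assms(2,3)] in auto)
  also have "\<dots> = (\<Sum>x\<in>?A. \<Sum>w\<in>?BC. \<Sum>y\<in>?B. \<Sum>u\<in>?C. 
      if y \<otimes> u = w \<and> x \<otimes> w = z then a x * b y * c u else 0)"
    by (intro sum.cong HOL.refl) (auto simp: gr_mult[OF f(2) _ f(3)] sum_distrib_left mult.assoc intro!: sum.cong)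
  also have "\<dots> = (\<Sum>x\<in>?A. \<Sum>y\<in>?B. \<Sum>u\<in>?C. \<Sum>w\<in>?BC. 
      if y \<otimes> u = w then if x \<otimes> w = z then a x * b y * c u else 0 else 0)"
    by (rule sum.cong[OF HOL.refl], subst sum_swap3, intro sum.cong HOL.refl, auto)
  also have "\<dots> = (\<Sum>x\<in>?A. \<Sum>y\<in>?B. \<Sum>u\<in>?C. if x \<otimes> (y \<otimes> u) = z then a x * b y * c u else 0)"
    by (intro sum.cong HOL.refl) (subst sum.delta', use f in auto)
  also have "\<dots> = (\<Sum>u\<in>?C. \<Sum>x\<in>?A. \<Sum>y\<in>?B. if x \<otimes> (y \<otimes> u) = z then a x * b y * c u else 0)"
    by (rule sum_swap3[symmetric])
  finally show "(a \<otimes>\<^bsub>ZG\<^esub> b \<otimes>\<^bsub>ZG\<^esub> c) z = (a \<otimes>\<^bsub>ZG\<^esub> (b \<otimes>\<^bsub>ZG\<^esub> c)) z"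
    using 1 by simp
qed

lemma gr_l_one: "a \<in> carrier ZG \<Longrightarrow> \<one>\<^bsub>ZG\<^esub> \<otimes>\<^bsub>ZG\<^esub> a = a"
proof
  fix z assume a: "a \<in> carrier ZG"
  have "(\<one>\<^bsub>ZG\<^esub> \<otimes>\<^bsub>ZG\<^esub> a) z = (\<Sum>x\<in>{\<one>}. \<Sum>y | a y \<noteq> 0. if x \<otimes> y = z then \<one>\<^bsub>ZG\<^esub> x * a y else 0)"
    by (rule gr_mult) (use a in \<open>auto simp: gr_carrier gr_one gr_single_def\<close>)
  also have "\<dots> = (\<Sum>y | a y \<noteq> 0. if y = z then a y else 0)"
    using a by (auto simp: gr_one gr_single_def gr_carrier subset_iff intro!: sum.cong)
  also have "\<dots> = a z" using a by (auto simp: gr_carrier)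
  finally show "(\<one>\<^bsub>ZG\<^esub> \<otimes>\<^bsub>ZG\<^esub> a) z = a z" .
qed

lemma gr_r_one: "a \<in> carrier ZG \<Longrightarrow> a \<otimes>\<^bsub>ZG\<^esub> \<one>\<^bsub>ZG\<^esub> = a"
proof
  fix z assume a: "a \<in> carrier ZG"
  have "(a \<otimes>\<^bsub>ZG\<^esub> \<one>\<^bsub>ZG\<^esub>) z = (\<Sum>x | a x \<noteq> 0. \<Sum>y\<in>{\<one>}. if x \<otimes> y = z then a x * \<one>\<^bsub>ZG\<^esub> y else 0)"
    by (rule gr_mult) (use a in \<open>auto simp: gr_carrier gr_one gr_single_def\<close>)
  also have "\<dots> = (\<Sum>y | a y \<noteq> 0. if y = z then a y else 0)"
    using a by (auto simp: gr_one gr_single_def gr_carrier subset_iff intro!: sum.cong)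
  also have "\<dots> = a z" using a by (auto simp: gr_carrier)
  finally show "(a \<otimes>\<^bsub>ZG\<^esub> \<one>\<^bsub>ZG\<^esub>) z = a z" .
qed

lemma gr_add_closed: "a \<in> carrier ZG \<Longrightarrow> b \<in> carrier ZG \<Longrightarrow> a \<oplus>\<^bsub>ZG\<^esub> b \<in> carrier ZG"
proof -
  assume "a \<in> carrier ZG" "b \<in> carrier ZG"
  moreover have "{x. a x + b x \<noteq> 0} \<subseteq> {x. a x \<noteq> 0} \<union> {x. b x \<noteq> 0}" by auto
  ultimately show ?thesis
    unfolding gr_carrier gr_add by (meson finite_UnI finite_subset order_trans Un_least)
qed

lemma ring_group_ring: "ring ZG"
proof (rule ringI)
  show "abelian_group ZG"
  proof (rule abelian_groupI)
    fix a assume a: "a \<in> carrier ZG"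
    show "\<exists>b\<in>carrier ZG. b \<oplus>\<^bsub>ZG\<^esub> a = \<zero>\<^bsub>ZG\<^esub>"
      by (rule bexI[of _ "\<lambda>z. - a z"]) (use a in \<open>auto simp: gr_add gr_zero gr_carrier\<close>)
  qed (rule gr_add_closed, (auto simp: gr_add gr_zero gr_carrier)[3], (auto simp: gr_add gr_zero)[3])
  show "monoid ZG"
    by (rule monoidI) (use gr_l_one gr_r_one in \<open>auto simp: gr_mult_closed gr_assoc gr_one\<close>)
qed (auto simp: gr_l_distr gr_r_distr)

end

text \<open>A copy of \<open>group\<close> that carries the ring structure of the group ring.
  Declared on \<open>group\<close> itself, the sublocale would attach a group ring to every group in
  sight.\<close>

locale integral_group_ring = group

sublocale integral_group_ring \<subseteq> ZG: ring "group_ring G"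
  by (rule ring_group_ring)

context integral_group_ring begin

lemma gr_uminus: "a \<in> carrier ZG \<Longrightarrow> \<ominus>\<^bsub>ZG\<^esub> a = (\<lambda>z. - a z)"
  by (rule ZG.minus_equality) (auto simp: gr_add gr_zero gr_carrier)

lemma gr_minus: "b \<in> carrier ZG \<Longrightarrow> a \<ominus>\<^bsub>ZG\<^esub> b = (\<lambda>z. a z - b z)"
  by (simp add: a_minus_def gr_uminus gr_add)

text \<open>Induction on the sum of the absolute values of the coefficients: a nonzero coefficient
  at x is moved one step towards zero by subtracting or adding \<open>gr_single x\<close>. The rule
  reduces additive statements to group elements.\<close>

lemma group_ring_induct [consumes 1, case_names zero single add uminus]:
  assumes "a \<in> carrier ZG" "P \<zero>\<^bsub>ZG\<^esub>" "\<And>x. x \<in> carrier G \<Longrightarrow> P (gr_single x)"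
    and add: "\<And>a b. a \<in> carrier ZG \<Longrightarrow> b \<in> carrier ZG \<Longrightarrow> P a \<Longrightarrow> P b \<Longrightarrow> P (a \<oplus>\<^bsub>ZG\<^esub> b)"
    and neg: "\<And>a. a \<in> carrier ZG \<Longrightarrow> P a \<Longrightarrow> P (\<ominus>\<^bsub>ZG\<^esub> a)"
  shows "P a"
  using assms(1)
proof (induction "\<Sum>x | a x \<noteq> 0. nat \<bar>a x\<bar>" arbitrary: a rule: less_induct)
  case less
  note fin = less.prems[unfolded gr_carrier]
  show ?case
  proof (cases "a = \<zero>\<^bsub>ZG\<^esub>")
    case True then show ?thesis using assms by simp
  next
    case False
    then obtain x where x: "a x \<noteq> 0" by (auto simp: gr_zero)
    then have xG: "x \<in> carrier G" using fin by auto
    \<comment> \<open>Changing \<open>a\<close> only at x, to a value closer to zero, lowers the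
      norm.\<close>
    have key: "P b" if b: "b \<in> carrier ZG" "\<And>y. y \<noteq> x \<Longrightarrow> b y = a y" "\<bar>b x\<bar> < \<bar>a x\<bar>" for b
    proof (rule less.hyps[OF _ b(1)])
      have "(\<Sum>y | b y \<noteq> 0. nat \<bar>b y\<bar>) = (\<Sum>y | a y \<noteq> 0. nat \<bar>b y\<bar>)"
        by (rule sum.mono_neutral_left) (use fin b(2) x in force)+
      also have "\<dots> < (\<Sum>y | a y \<noteq> 0. nat \<bar>a y\<bar>)"
      proof (rule sum_strict_mono_ex1)
        show "\<forall>y\<in>{y. a y \<noteq> 0}. nat \<bar>b y\<bar> \<le> nat \<bar>a y\<bar>"
        proof
          fix y show "nat \<bar>b y\<bar> \<le> nat \<bar>a y\<bar>" using b(2)[of y] b(3) by (cases "y = x") auto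
        qed
        show "\<exists>y\<in>{y. a y \<noteq> 0}. nat \<bar>b y\<bar> < nat \<bar>a y\<bar>"
          by (rule bexI[of _ x]) (use x b(3) in auto)
      qed (use fin in simp)
      finally show "(\<Sum>y | b y \<noteq> 0. nat \<bar>b y\<bar>) < (\<Sum>y | a y \<noteq> 0. nat \<bar>a y\<bar>)" .
    qed
    show ?thesis
    proof (cases "a x > 0")
      case True
      have m: "a \<ominus>\<^bsub>ZG\<^esub> gr_single x = (\<lambda>z. a z - gr_single x z)"
        by (simp add: gr_minus xG)
      have "a \<ominus>\<^bsub>ZG\<^esub> gr_single x \<in> carrier ZG" using less.prems xG by simp
      then have "P (a \<ominus>\<^bsub>ZG\<^esub> gr_single x)"
        by (rule key) (use True in \<open>simp_all add: m, simp_all add: gr_single_def\<close>)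
      then have "P ((a \<ominus>\<^bsub>ZG\<^esub> gr_single x) \<oplus>\<^bsub>ZG\<^esub> gr_single x)"
        by - (rule add[OF _ _ _ assms(3)], use less.prems xG in auto)
      also have "(a \<ominus>\<^bsub>ZG\<^esub> gr_single x) \<oplus>\<^bsub>ZG\<^esub> gr_single x = a"
        using xG by (auto simp: gr_minus gr_add)
      finally show ?thesis .
    next
      case False
      have "P (a \<oplus>\<^bsub>ZG\<^esub> gr_single x)"
        by (rule key) (use False less.prems xG x in \<open>simp_all, simp_all add: gr_add gr_single_def\<close>)
      then have "P ((a \<oplus>\<^bsub>ZG\<^esub> gr_single x) \<oplus>\<^bsub>ZG\<^esub> (\<ominus>\<^bsub>ZG\<^esub> gr_single x))"
        by - (rule add[OF _ _ _ neg[OF _ assms(3)]], use less.prems xG in auto)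
      also have "(a \<oplus>\<^bsub>ZG\<^esub> gr_single x) \<oplus>\<^bsub>ZG\<^esub> (\<ominus>\<^bsub>ZG\<^esub> gr_single x) = a"
        using xG by (auto simp: gr_uminus gr_add)
      finally show ?thesis .
    qed
  qed
qed

end

section \<open>Additive extension of maps, the augmentation, and ideals of the group ring\<close>

context integral_group_ring
begin

text \<open>The group ring is the free abelian group on G, so a map from G to an abelian group M
  extends to it. M is written multiplicatively, which turns coefficients into exponents. The map
  \<open>gmap\<close>, its section \<open>gsec\<close> and the module action \<open>act\<close> are
  all instances.\<close>

definition gr_ext :: "('c, 'd) monoid_scheme \<Rightarrow> ('a \<Rightarrow> 'c) \<Rightarrow> ('a \<Rightarrow> int) \<Rightarrow> 'c" where
  "gr_ext M \<phi> a = finprod M (\<lambda>x. \<phi> x [^]\<^bsub>M\<^esub> a x) {x. a x \<noteq> 0}"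

lemma gr_ext_superset:
  assumes M: "comm_group M" and "\<phi> \<in> carrier G \<rightarrow> carrier M"
    and "finite A" "{x. a x \<noteq> 0} \<subseteq> A" "A \<subseteq> carrier G"
  shows "gr_ext M \<phi> a = finprod M (\<lambda>x. \<phi> x [^]\<^bsub>M\<^esub> a x) A"
proof -
  interpret M: comm_group M by fact
  show ?thesis unfolding gr_ext_def
    by (rule M.finprod_mono_neutral_cong_left) (use assms in auto)
qed

lemma gr_ext_closed:
  assumes M: "comm_group M" and "\<phi> \<in> carrier G \<rightarrow> carrier M" "a \<in> carrier ZG"
  shows "gr_ext M \<phi> a \<in> carrier M"
proof -
  interpret M: comm_group M by fact
  show ?thesis unfolding gr_ext_def
    by (rule M.finprod_closed) (use assms in \<open>auto simp: gr_carrier\<close>)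
qed

lemma gr_ext_add:
  assumes M: "comm_group M" and phi: "\<phi> \<in> carrier G \<rightarrow> carrier M" 
    and "a \<in> carrier ZG" "b \<in> carrier ZG"
  shows "gr_ext M \<phi> (a \<oplus>\<^bsub>ZG\<^esub> b) = gr_ext M \<phi> a \<otimes>\<^bsub>M\<^esub> gr_ext M \<phi> b"
proof -
  interpret M: comm_group M by fact
  define A where "A = {x. a x \<noteq> 0} \<union> {x. b x \<noteq> 0}"
  have A: "finite A" "A \<subseteq> carrier G" using assms by (auto simp: gr_carrier A_def)
  then have pc: "\<phi> x \<in> carrier M" if "x \<in> A" for x using phi that by blast
  have e: "gr_ext M \<phi> c = finprod M (\<lambda>x. \<phi> x [^]\<^bsub>M\<^esub> c x) A" if "{x. c x \<noteq> 0} \<subseteq> A" for c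
    by (rule gr_ext_superset[OF M phi A(1) that A(2)])
  have "gr_ext M \<phi> (a \<oplus>\<^bsub>ZG\<^esub> b) = finprod M (\<lambda>x. \<phi> x [^]\<^bsub>M\<^esub> (a x + b x)) A"
    by (subst e) (auto simp: gr_add A_def)
  also have "\<dots> = finprod M (\<lambda>x. \<phi> x [^]\<^bsub>M\<^esub> a x \<otimes>\<^bsub>M\<^esub> \<phi> x [^]\<^bsub>M\<^esub> b x) A"
    by (rule M.finprod_cong') (use pc in \<open>auto simp: M.int_pow_mult\<close>)
  also have "\<dots> = finprod M (\<lambda>x. \<phi> x [^]\<^bsub>M\<^esub> a x) A \<otimes>\<^bsub>M\<^esub> finprod M (\<lambda>x. \<phi> x [^]\<^bsub>M\<^esub> b x) A"
    by (rule M.finprod_multf) (use pc in auto)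
  also have "\<dots> = gr_ext M \<phi> a \<otimes>\<^bsub>M\<^esub> gr_ext M \<phi> b"
    using e[of a] e[of b] by (simp add: A_def)
  finally show ?thesis .
qed

lemma gr_ext_hom:
  assumes "comm_group M" and "\<phi> \<in> carrier G \<rightarrow> carrier M"
  shows "group_hom (add_monoid ZG) M (gr_ext M \<phi>)"
  by (intro group_hom.intro group_hom_axioms.intro homI ZG.a_group comm_group.axioms(2)[OF assms(1)])
     (use gr_ext_add[OF assms] gr_ext_closed[OF assms] in auto)

lemma gr_ext_single:
  assumes M: "comm_group M" and phi: "\<phi> \<in> carrier G \<rightarrow> carrier M" "x \<in> carrier G"
  shows "gr_ext M \<phi> (gr_single x) = \<phi> x"
proof -
  interpret M: comm_group M by fact
  have "gr_ext M \<phi> (gr_single x) = finprod M (\<lambda>y. \<phi> y [^]\<^bsub>M\<^esub> gr_single x y) {x}"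
    by (rule gr_ext_superset[OF M phi(1)]) (use phi in \<open>auto simp: gr_single_def\<close>)
  also have "\<dots> = \<phi> x" using phi by (auto simp: gr_single_def Pi_iff)
  finally show ?thesis .
qed

abbreviation augm :: "('a \<Rightarrow> int) \<Rightarrow> int" where "augm a \<equiv> \<Sum>x | a x \<noteq> 0. a x"

lemma augm_superset: "finite A \<Longrightarrow> {x. a x \<noteq> 0} \<subseteq> A \<Longrightarrow> augm a = (\<Sum>x\<in>A. a x)"
  by (rule sum.mono_neutral_left) auto

lemma augm_add:
  assumes "a \<in> carrier ZG" "b \<in> carrier ZG"
  shows "augm (a \<oplus>\<^bsub>ZG\<^esub> b) = augm a + augm b"
proof -
  let ?A = "{x. a x \<noteq> 0} \<union> {x. b x \<noteq> 0}"
  have A: "finite ?A" using assms by (auto simp: gr_carrier)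
  have "augm (a \<oplus>\<^bsub>ZG\<^esub> b) = (\<Sum>x\<in>?A. (a \<oplus>\<^bsub>ZG\<^esub> b) x)"
    by (rule augm_superset[OF A]) (auto simp: gr_add)
  then show ?thesis
    unfolding augm_superset[of ?A a, OF A Un_upper1] augm_superset[of ?A b, OF A Un_upper2]
    by (simp add: gr_add sum.distrib)
qed

lemma augm_uminus: "a \<in> carrier ZG \<Longrightarrow> augm (\<ominus>\<^bsub>ZG\<^esub> a) = - augm a"
  by (simp add: gr_uminus sum_negf)

lemma augm_zero: "augm \<zero>\<^bsub>ZG\<^esub> = 0"
  by (simp add: gr_zero)

lemma augm_single: "augm (gr_single x) = 1"
proof -
  have "augm (gr_single x) = (\<Sum>y\<in>{x}. gr_single x y)"
    by (rule augm_superset) (auto simp: gr_single_def)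
  then show ?thesis by (simp add: gr_single_def)
qed

lemma augm_mult:
  assumes "a \<in> carrier ZG" "b \<in> carrier ZG"
  shows "augm (a \<otimes>\<^bsub>ZG\<^esub> b) = augm a * augm b"
proof -
  have 1: "augm (gr_single x \<otimes>\<^bsub>ZG\<^esub> b) = augm b" if "x \<in> carrier G" for x
    using assms(2)
  proof (induction b rule: group_ring_induct)
    case zero
    then show ?case using that by simp
  next
    case (single y)
    then show ?case using that by (simp add: gr_single_mult[symmetric] augm_single)
  next
    case (add a b)
    then show ?case using that by (simp add: ZG.r_distr augm_add)
  next
    case (uminus a)
    then show ?case using that by (simp add: ZG.r_minus augm_uminus)
  qed
  show ?thesis using assms(1)
  proof (induction a rule: group_ring_induct)
    case zero
    then show ?case using assms by (simp add: augm_zero)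
  next
    case (single y)
    then show ?case using assms by (simp add: 1 augm_single)
  next
    case (add c d)
    then show ?case using assms by (simp add: ZG.l_distr augm_add distrib_right)
  next
    case (uminus a)
    then show ?case using assms by (simp add: ZG.l_minus augm_uminus)
  qed
qed

lemma aug_ideal_iff: "a \<in> aug_ideal G \<longleftrightarrow> a \<in> carrier ZG \<and> augm a = 0"
  by (simp add: aug_ideal_def)

lemma ideal_aug_ideal: "ideal (aug_ideal G) ZG"
proof (rule idealI)
  show "subgroup (aug_ideal G) (add_monoid ZG)"
  proof (rule ZG.add.subgroupI)
    show "aug_ideal G \<noteq> {}"
      using aug_ideal_iff[of "\<zero>\<^bsub>ZG\<^esub>"] augm_zero by auto
  qed (auto simp: aug_ideal_iff augm_add augm_uminus simp flip: a_inv_def)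
qed (auto simp: aug_ideal_iff augm_mult ring_group_ring)

abbreviation gd :: "'a \<Rightarrow> 'a \<Rightarrow> int" where
  "gd x \<equiv> gr_single x \<ominus>\<^bsub>ZG\<^esub> \<one>\<^bsub>ZG\<^esub>"

lemma gd_aug: "x \<in> carrier G \<Longrightarrow> gd x \<in> aug_ideal G"
  by (simp add: aug_ideal_iff a_minus_def augm_add augm_uminus augm_single) (simp add: gr_one augm_single)

text \<open>The elements x - 1 generate the augmentation ideal additively. A single group element is
  not in the ideal, so the induction treats every a and shows that a minus its augmentation lies in
  K; \<open>s k\<close> is k times the unit. On the ideal the correction is zero.\<close>

lemma aug_ideal_subset:
  assumes K: "subgroup K (add_monoid ZG)" and gd: "\<And>x. x \<in> carrier G \<Longrightarrow> gd x \<in> K"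
  shows "aug_ideal G \<subseteq> K"
proof
  define s :: "int \<Rightarrow> 'a \<Rightarrow> int" where "s k = (\<lambda>z. if z = \<one> then k else 0)" for k
  have s: "s k \<in> carrier ZG" for k by (auto simp: s_def gr_carrier)
  have *: "a \<ominus>\<^bsub>ZG\<^esub> s (augm a) \<in> K" if "a \<in> carrier ZG" for a
    using that
  proof (induction a rule: group_ring_induct)
    case zero
    have "\<zero>\<^bsub>ZG\<^esub> \<ominus>\<^bsub>ZG\<^esub> s (augm \<zero>\<^bsub>ZG\<^esub>) = \<zero>\<^bsub>ZG\<^esub>"
      by (simp only: gr_minus[OF s] augm_zero) (simp add: gr_zero s_def)
    then show ?case using subgroup.one_closed[OF K] by simp
  next
    case (single x)
    have "s 1 = \<one>\<^bsub>ZG\<^esub>" by (simp add: s_def gr_one gr_single_def)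
    then show ?case using gd[OF single] by (simp add: augm_single)
  next
    case (add a b)
    have "(a \<oplus>\<^bsub>ZG\<^esub> b) \<ominus>\<^bsub>ZG\<^esub> s (augm (a \<oplus>\<^bsub>ZG\<^esub> b)) =
        (a \<ominus>\<^bsub>ZG\<^esub> s (augm a)) \<oplus>\<^bsub>ZG\<^esub> (b \<ominus>\<^bsub>ZG\<^esub> s (augm b))"
      by (simp only: gr_minus[OF s] augm_add add) (auto simp: gr_add s_def)
    then show ?case using subgroup.m_closed[OF K add(3,4)] by simp
  next
    case (uminus a)
    have "(\<ominus>\<^bsub>ZG\<^esub> a) \<ominus>\<^bsub>ZG\<^esub> s (augm (\<ominus>\<^bsub>ZG\<^esub> a)) = \<ominus>\<^bsub>ZG\<^esub> (a \<ominus>\<^bsub>ZG\<^esub> s (augm a))"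
      by (subst (2) gr_uminus, use uminus s in simp)
         (simp only: gr_minus[OF s] augm_uminus uminus, auto simp: gr_uminus uminus s_def)
    then show ?case using subgroup.m_inv_closed[OF K uminus(2)] by (simp add: a_inv_def)
  qed
  fix a assume a: "a \<in> aug_ideal G"
  then have "a \<ominus>\<^bsub>ZG\<^esub> s 0 \<in> K" using *[of a] by (simp add: aug_ideal_iff)
  moreover have "a \<ominus>\<^bsub>ZG\<^esub> s 0 = a" by (simp add: gr_minus[OF s]) (simp add: s_def)
  ultimately show "a \<in> K" by simp
qed

lemma gd_mult:
  assumes "x \<in> carrier G" "y \<in> carrier G"
  shows "gd (x \<otimes> y) = gd x \<otimes>\<^bsub>ZG\<^esub> gr_single y \<oplus>\<^bsub>ZG\<^esub> gd y"
    and "gd (x \<otimes> y) = gd x \<oplus>\<^bsub>ZG\<^esub> gr_single x \<otimes>\<^bsub>ZG\<^esub> gd y"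
  using assms by (simp_all add: gr_single_mult, (use assms in \<open>simp add: ZG.ring_simprules\<close>)+)

lemma gr_single_inv_mult:
  "x \<in> carrier G \<Longrightarrow> gr_single x \<otimes>\<^bsub>ZG\<^esub> gr_single (inv x) = \<one>\<^bsub>ZG\<^esub>"
  "x \<in> carrier G \<Longrightarrow> gr_single (inv x) \<otimes>\<^bsub>ZG\<^esub> gr_single x = \<one>\<^bsub>ZG\<^esub>"
  by (simp_all add: gr_single_mult[symmetric] gr_one)

lemma gd_inv:
  assumes "x \<in> carrier G"
  shows "gd (inv x) = \<ominus>\<^bsub>ZG\<^esub> (gd x \<otimes>\<^bsub>ZG\<^esub> gr_single (inv x))"
  using assms by (simp add: a_minus_def ZG.l_distr ZG.l_minus gr_single_inv_mult ZG.minus_add ZG.a_comm)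

text \<open>The bracket of h - 1 and k - 1 equals h k - k h. Multiplying on the right by the inverse
  of k h turns the first term into the commutator and the second into 1. Membership of commutators
  in ideals is always derived from this formula.\<close>

lemma gr_single_commutator:
  assumes "h \<in> carrier G" "k \<in> carrier G"
  shows "gd (h \<otimes> k \<otimes> inv h \<otimes> inv k) =
    (gd h \<otimes>\<^bsub>ZG\<^esub> gd k \<ominus>\<^bsub>ZG\<^esub> gd k \<otimes>\<^bsub>ZG\<^esub> gd h) \<otimes>\<^bsub>ZG\<^esub> gr_single (inv h \<otimes> inv k)"
proof -
  have "gd h \<otimes>\<^bsub>ZG\<^esub> gd k \<ominus>\<^bsub>ZG\<^esub> gd k \<otimes>\<^bsub>ZG\<^esub> gd h =
      gr_single (h \<otimes> k) \<ominus>\<^bsub>ZG\<^esub> gr_single (k \<otimes> h)"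
    using assms
    by (simp add: gr_single_mult a_minus_def ZG.l_distr ZG.r_distr ZG.l_minus ZG.r_minus ZG.minus_add)
       (use assms in \<open>simp add: gr_add gr_uminus fun_eq_iff\<close>)
  moreover have "(gr_single (h \<otimes> k) \<ominus>\<^bsub>ZG\<^esub> gr_single (k \<otimes> h)) \<otimes>\<^bsub>ZG\<^esub> gr_single (inv h \<otimes> inv k) =
      gr_single ((h \<otimes> k) \<otimes> (inv h \<otimes> inv k)) \<ominus>\<^bsub>ZG\<^esub> gr_single ((k \<otimes> h) \<otimes> (inv h \<otimes> inv k))"
    using assms by (simp add: gr_single_mult[of "_ \<otimes> _"] a_minus_def ZG.l_distr ZG.l_minus)
  moreover have "(h \<otimes> k) \<otimes> (inv h \<otimes> inv k) = h \<otimes> k \<otimes> inv h \<otimes> inv k"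
    "(k \<otimes> h) \<otimes> (inv h \<otimes> inv k) = \<one>"
    using assms by (simp add: m_assoc) (use assms in \<open>simp add: inv_mult_group[symmetric]\<close>)
  ultimately show ?thesis by (simp add: gr_one)
qed

lemma one_plus_iff: "x \<in> one_plus G I \<longleftrightarrow> x \<in> carrier G \<and> gd x \<in> I"
  by (simp add: one_plus_def)

lemma normal_one_plus:
  assumes "ideal I ZG"
  shows "one_plus G I \<lhd> G"
proof -
  interpret I: ideal I ZG by fact
  show ?thesis
  proof (rule normal_invI)
    show "subgroup (one_plus G I) G"
    proof (rule subgroupI)
      have "\<one> \<in> one_plus G I"
        using I.zero_closed by (simp add: one_plus_iff gr_one[symmetric] ZG.minus_eq ZG.r_neg)
      then show "one_plus G I \<noteq> {}" by blast
      fix x assume x: "x \<in> one_plus G I"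
      then show "inv x \<in> one_plus G I"
        by (auto simp: one_plus_iff gd_inv intro!: I.I_r_closed I.a_inv_closed)
      fix y assume y: "y \<in> one_plus G I"
      show "x \<otimes> y \<in> one_plus G I"
        using x y by (auto simp: one_plus_iff gd_mult(1) intro!: I.I_r_closed I.a_closed)
    qed (auto simp: one_plus_iff)
    fix x h assume x: "x \<in> carrier G" and h: "h \<in> one_plus G I"
    have "gd (x \<otimes> h \<otimes> inv x) = gr_single x \<otimes>\<^bsub>ZG\<^esub> gd h \<otimes>\<^bsub>ZG\<^esub> gr_single (inv x)"
    proof -
      have "gr_single x \<otimes>\<^bsub>ZG\<^esub> gd h = gr_single (x \<otimes> h) \<ominus>\<^bsub>ZG\<^esub> gr_single x"
        using x h by (simp add: one_plus_iff gr_single_mult a_minus_def ZG.r_distr ZG.r_minus)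
      moreover have "(gr_single (x \<otimes> h) \<ominus>\<^bsub>ZG\<^esub> gr_single x) \<otimes>\<^bsub>ZG\<^esub> gr_single (inv x) =
        gr_single (x \<otimes> h \<otimes> inv x) \<ominus>\<^bsub>ZG\<^esub> \<one>\<^bsub>ZG\<^esub>"
        using x h by (simp add: one_plus_iff gr_single_mult[of "_ \<otimes> _"] a_minus_def ZG.l_distr ZG.l_minus
            gr_single_inv_mult)
      ultimately show ?thesis by simp
    qed
    then show "x \<otimes> h \<otimes> inv x \<in> one_plus G I"
      using x h I.I_r_closed[OF I.I_l_closed] by (simp add: one_plus_iff)
  qed
qed

lemma ideal_power_ideal:
  assumes "ideal I ZG"
  shows "ideal (ideal_power ZG I n) ZG"
  by (induction n) (auto simp: ZG.oneideal intro!: ZG.ideal_prod_is_ideal assms)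

text \<open>\<open>ideal_power\<close> adds the new factor on the right, while the bracket of a
  commutator has a term with the new factor on the left.\<close>

lemma ideal_power_commute:
  assumes "ideal I ZG"
  shows "ideal_prod ZG I (ideal_power ZG I n) = ideal_power ZG I (Suc n)"
proof (induction n)
  case 0
  have "ideal_prod ZG (carrier ZG) I = I"
  proof
    show "ideal_prod ZG (carrier ZG) I \<subseteq> I"
      using ZG.ideal_prod_inter[OF ZG.oneideal assms] by blast
    show "I \<subseteq> ideal_prod ZG (carrier ZG) I"
    proof
      fix x assume "x \<in> I"
      then show "x \<in> ideal_prod ZG (carrier ZG) I"
        using ideal_prod.prod[of "\<one>\<^bsub>ZG\<^esub>" "carrier ZG" x I ZG] ideal.Icarr[OF assms] by simp
    qed
  qed
  then show ?case using ZG.ideal_prod_one[OF assms] by simp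
next
  case (Suc n)
  have "ideal_prod ZG I (ideal_power ZG I (Suc n)) = ideal_prod ZG (ideal_prod ZG I (ideal_power ZG I n)) I"
    using ZG.ideal_prod_assoc[OF assms ideal_power_ideal[OF assms] assms] by simp
  then show ?case unfolding Suc by simp
qed

lemma ideal_power_one: "ideal I ZG \<Longrightarrow> ideal_power ZG I (Suc 0) = I"
  using ideal_power_commute[of I 0] ZG.ideal_prod_one by simp

end

section \<open>Commutator subgroups and the lower central series\<close>

context group begin

lemma conj_mult:
  assumes "g \<in> carrier G" "a \<in> carrier G" "b \<in> carrier G"
  shows "g \<otimes> (a \<otimes> b) \<otimes> inv g = (g \<otimes> a \<otimes> inv g) \<otimes> (g \<otimes> b \<otimes> inv g)"
  using assms by (simp add: inv_solve_left m_assoc)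

lemma conj_inv:
  assumes "g \<in> carrier G" "a \<in> carrier G"
  shows "g \<otimes> inv a \<otimes> inv g = inv (g \<otimes> a \<otimes> inv g)"
  using assms by (simp add: inv_mult_group m_assoc)

text \<open>Conjugating a commutator gives the commutator of the conjugates, so for normal H the
  generating set is already stable under conjugation.\<close>

lemma normal_commutator_subgroup:
  assumes "H \<lhd> G"
  shows "commutator_subgroup G H (carrier G) \<lhd> G"
  unfolding commutator_subgroup_def
proof (rule normal_generateI)
  interpret H: normal H G by fact
  show "(\<Union>h\<in>H. \<Union>k\<in>carrier G. {h \<otimes> k \<otimes> inv h \<otimes> inv k}) \<subseteq> carrier G"
    using H.subset by auto
  fix c g assume c: "c \<in> (\<Union>h\<in>H. \<Union>k\<in>carrier G. {h \<otimes> k \<otimes> inv h \<otimes> inv k})" and g: "g \<in> carrier G"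
  then obtain h k where hk: "h \<in> H" "h \<in> carrier G" "k \<in> carrier G" "c = h \<otimes> k \<otimes> inv h \<otimes> inv k"
    using H.subset by auto
  have eq: "g \<otimes> c \<otimes> inv g = (g \<otimes> h \<otimes> inv g) \<otimes> (g \<otimes> k \<otimes> inv g) \<otimes> inv (g \<otimes> h \<otimes> inv g) \<otimes> inv (g \<otimes> k \<otimes> inv g)"
    using hk g by (simp only: conj_mult[OF g] conj_inv[OF g] m_closed inv_closed)
  have "g \<otimes> k \<otimes> inv g \<in> carrier G" using hk g by simp
  then show "g \<otimes> c \<otimes> inv g \<in> (\<Union>h\<in>H. \<Union>k\<in>carrier G. {h \<otimes> k \<otimes> inv h \<otimes> inv k})"
    unfolding eq by (rule UN_I[OF H.inv_op_closed2[OF g hk(1)] UN_I]) (rule singletonI)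
qed

lemma normal_lower_central: "lower_central G n \<lhd> G"
proof (induction n)
  case 0
  then show ?case by (simp add: normal_self)
next
  case (Suc n)
  then show ?case by (cases n) (simp_all add: normal_self normal_commutator_subgroup)
qed

lemma lower_central_commutator:
  assumes "h \<in> lower_central G (Suc n)" "k \<in> carrier G"
  shows "h \<otimes> k \<otimes> inv h \<otimes> inv k \<in> lower_central G (Suc (Suc n))"
  using assms by (auto simp: commutator_subgroup_def intro!: generate.incl)

lemma commutator_subgroup_minimal:
  assumes "subgroup K G" "\<And>h k. h \<in> H \<Longrightarrow> k \<in> carrier G \<Longrightarrow> h \<otimes> k \<otimes> inv h \<otimes> inv k \<in> K"
  shows "commutator_subgroup G H (carrier G) \<subseteq> K"
  unfolding commutator_subgroup_def using assms by (intro generate_subgroup_incl) auto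

end

context integral_group_ring begin

abbreviation augp where "augp n \<equiv> ideal_power ZG (aug_ideal G) n"

text \<open>If h - 1 lies in the n-th power of the augmentation ideal, both terms of the bracket in
  \<open>gr_single_commutator\<close> lie in the next power, and the unit factor on the right does
  no harm in an ideal.\<close>

lemma lower_central_one_plus:
  "lower_central G (Suc n) \<subseteq> one_plus G (augp (Suc n))"
proof (induction n)
  case 0
  then show ?case using gd_aug by (simp add: ideal_power_one[OF ideal_aug_ideal, simplified] one_plus_iff subset_iff)
next
  case (Suc n)
  interpret I: ideal "augp (Suc (Suc n))" ZG by (rule ideal_power_ideal[OF ideal_aug_ideal])
  show ?case unfolding lower_central.simps
  proof (rule commutator_subgroup_minimal)
    show "subgroup (one_plus G (augp (Suc (Suc n)))) G"
      by (rule normal_imp_subgroup[OF normal_one_plus[OF I.ideal_axioms]])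
    fix h k assume hk: "h \<in> lower_central G (Suc n)" "k \<in> carrier G"
    then have h: "h \<in> carrier G" "gd h \<in> augp (Suc n)" using Suc by (auto simp: one_plus_iff)
    have k: "gd k \<in> aug_ideal G" using gd_aug hk by simp
    have "gd h \<otimes>\<^bsub>ZG\<^esub> gd k \<in> augp (Suc (Suc n))"
      unfolding ideal_power.simps(2)[of _ _ "Suc n"] by (rule ideal_prod.prod[OF h(2) k])
    moreover have "gd k \<otimes>\<^bsub>ZG\<^esub> gd h \<in> augp (Suc (Suc n))"
      unfolding ideal_power_commute[OF ideal_aug_ideal, symmetric, of "Suc n"] by (rule ideal_prod.prod[OF k h(2)])
    ultimately have "gd h \<otimes>\<^bsub>ZG\<^esub> gd k \<ominus>\<^bsub>ZG\<^esub> gd k \<otimes>\<^bsub>ZG\<^esub> gd h \<in> augp (Suc (Suc n))"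
      by (subst ZG.minus_eq) (rule I.a_closed[OF _ I.a_inv_closed])
    then have "gd (h \<otimes> k \<otimes> inv h \<otimes> inv k) \<in> augp (Suc (Suc n))"
      unfolding gr_single_commutator[OF h(1) hk(2)] using h hk by (intro I.I_r_closed) auto
    then show "h \<otimes> k \<otimes> inv h \<otimes> inv k \<in> one_plus G (augp (Suc (Suc n)))"
      using h hk by (simp add: one_plus_iff)
  qed
qed

end

context integral_group_ring
begin

lemma relative_ideal_ideal: "R \<subseteq> carrier G \<Longrightarrow> ideal (relative_ideal G R) ZG"
  unfolding relative_ideal_def by (rule ZG.genideal_ideal) auto

lemma gd_relative_ideal: "R \<subseteq> carrier G \<Longrightarrow> r \<in> R \<Longrightarrow> gd r \<in> relative_ideal G R"
  unfolding relative_ideal_def by (rule subsetD[OF ZG.genideal_self]) auto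

lemma relative_ideal_minimal:
  "ideal I ZG \<Longrightarrow> (\<And>r. r \<in> R \<Longrightarrow> gd r \<in> I) \<Longrightarrow> relative_ideal G R \<subseteq> I"
  unfolding relative_ideal_def by (rule ZG.genideal_minimal) auto

lemma gd_mult_gd:
  assumes "x \<in> carrier G" "y \<in> carrier G"
  shows "gd (x \<otimes> y) = gd x \<oplus>\<^bsub>ZG\<^esub> gd y \<oplus>\<^bsub>ZG\<^esub> gd x \<otimes>\<^bsub>ZG\<^esub> gd y"
  using assms
  by (simp add: gr_single_mult a_minus_def ZG.l_distr ZG.r_distr ZG.l_minus ZG.r_minus ZG.minus_add)
     (use assms in \<open>simp add: gr_add gr_uminus fun_eq_iff\<close>)

lemma gd_one: "gd \<one> = \<zero>\<^bsub>ZG\<^esub>"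
  by (simp add: gr_one[symmetric] ZG.minus_eq ZG.r_neg)

end

section \<open>Ring maps induced by group homomorphisms\<close>

locale group_ring_hom = group_hom G H h + G: integral_group_ring G + H: integral_group_ring H
  for G (structure) and H (structure) and h
begin

definition gmap where
  "gmap = G.gr_ext (add_monoid H.ZG) (\<lambda>x. gr_single (h x))"

lemma gmap_hom: "group_hom (add_monoid G.ZG) (add_monoid H.ZG) gmap"
  unfolding gmap_def by (rule G.gr_ext_hom[OF H.ZG.a_comm_group]) auto

sublocale gmap: group_hom "add_monoid G.ZG" "add_monoid H.ZG" gmap
  by (rule gmap_hom)

lemma gmap_closed [simp]: "a \<in> carrier G.ZG \<Longrightarrow> gmap a \<in> carrier H.ZG"
  using gmap.hom_closed by simp

lemma gmap_single [simp]: "x \<in> carrier G \<Longrightarrow> gmap (gr_single x) = gr_single (h x)"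
  unfolding gmap_def by (subst G.gr_ext_single[OF H.ZG.a_comm_group]) auto

lemma gmap_add [simp]:
  "a \<in> carrier G.ZG \<Longrightarrow> b \<in> carrier G.ZG \<Longrightarrow>
    gmap (a \<oplus>\<^bsub>G.ZG\<^esub> b) = gmap a \<oplus>\<^bsub>H.ZG\<^esub> gmap b"
  using gmap.hom_mult by simp

lemma gmap_zero [simp]: "gmap \<zero>\<^bsub>G.ZG\<^esub> = \<zero>\<^bsub>H.ZG\<^esub>"
  using gmap.hom_one by simp

lemma gmap_one [simp]: "gmap \<one>\<^bsub>G.ZG\<^esub> = \<one>\<^bsub>H.ZG\<^esub>"
  by (simp add: G.gr_one H.gr_one)

lemma gmap_uminus [simp]:
  "a \<in> carrier G.ZG \<Longrightarrow> gmap (\<ominus>\<^bsub>G.ZG\<^esub> a) = \<ominus>\<^bsub>H.ZG\<^esub> gmap a"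
  using gmap.hom_inv[of a] by (simp add: a_inv_def)

lemma gmap_minus [simp]:
  "a \<in> carrier G.ZG \<Longrightarrow> b \<in> carrier G.ZG \<Longrightarrow>
    gmap (a \<ominus>\<^bsub>G.ZG\<^esub> b) = gmap a \<ominus>\<^bsub>H.ZG\<^esub> gmap b"
  by (simp add: a_minus_def)

lemma gmap_mult [simp]:
  assumes a: "a \<in> carrier G.ZG" and b: "b \<in> carrier G.ZG"
  shows "gmap (a \<otimes>\<^bsub>G.ZG\<^esub> b) = gmap a \<otimes>\<^bsub>H.ZG\<^esub> gmap b"
proof -
  have 1: "gmap (gr_single x \<otimes>\<^bsub>G.ZG\<^esub> b) = gr_single (h x) \<otimes>\<^bsub>H.ZG\<^esub> gmap b"
    if "x \<in> carrier G" for x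
    using b
  proof (induction b rule: G.group_ring_induct)
    case (single y)
    then show ?case using that by (simp add: G.gr_single_mult[symmetric] H.gr_single_mult[symmetric])
  qed (use that in \<open>simp_all add: G.ZG.r_distr H.ZG.r_distr G.ZG.r_minus H.ZG.r_minus\<close>)
  show ?thesis
    using a
  proof (induction a rule: G.group_ring_induct)
  qed (use 1 b in \<open>simp_all add: G.ZG.l_distr H.ZG.l_distr G.ZG.l_minus H.ZG.l_minus\<close>)
qed

lemma augm_gmap: "a \<in> carrier G.ZG \<Longrightarrow> H.augm (gmap a) = G.augm a"
  by (induction a rule: G.group_ring_induct)
     (simp_all add: G.augm_add H.augm_add G.augm_uminus H.augm_uminus G.augm_zero H.augm_zero
       G.augm_single H.augm_single)

lemma gmap_aug: "a \<in> aug_ideal G \<Longrightarrow> gmap a \<in> aug_ideal H"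
  by (simp add: G.aug_ideal_iff H.aug_ideal_iff augm_gmap)

lemma gmap_ideal_prod:
  assumes "I \<subseteq> carrier G.ZG" "J \<subseteq> carrier G.ZG"
    and "\<And>a. a \<in> I \<Longrightarrow> gmap a \<in> I'" "\<And>a. a \<in> J \<Longrightarrow> gmap a \<in> J'"
    and "a \<in> ideal_prod G.ZG I J"
  shows "gmap a \<in> ideal_prod H.ZG I' J'"
proof -
  have "a \<in> carrier G.ZG \<and> gmap a \<in> ideal_prod H.ZG I' J'"
    using assms(5)
  proof (induction a rule: ideal_prod.induct)
    case (prod i j)
    then have "i \<in> carrier G.ZG" "j \<in> carrier G.ZG" using assms by auto
    then show ?case using prod assms by (auto intro: ideal_prod.prod)
  next
    case (sum a b)
    then show ?case by (auto intro: ideal_prod.sum)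
  qed
  then show ?thesis by simp
qed

lemma gmap_ideal_power:
  "a \<in> G.augp n \<Longrightarrow> gmap a \<in> H.augp n"
proof (induction n arbitrary: a)
  case (Suc n)
  then show ?case
    using gmap_ideal_prod[of "G.augp n" "aug_ideal G"]
      ideal.Icarr[OF G.ideal_power_ideal[OF G.ideal_aug_ideal]] ideal.Icarr[OF G.ideal_aug_ideal]
    by (simp add: gmap_aug subset_iff)
qed simp

lemma ideal_gmap_vimage:
  assumes "ideal I H.ZG"
  shows "ideal {a \<in> carrier G.ZG. gmap a \<in> I} G.ZG"
proof -
  interpret I: ideal I H.ZG by fact
  show ?thesis
  proof (rule idealI[OF G.ring_group_ring])
    show "subgroup {a \<in> carrier G.ZG. gmap a \<in> I} (add_monoid G.ZG)"
    proof (rule G.ZG.add.subgroupI)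
      have "\<zero>\<^bsub>G.ZG\<^esub> \<in> {a \<in> carrier G.ZG. gmap a \<in> I}" by simp
      then show "{a \<in> carrier G.ZG. gmap a \<in> I} \<noteq> {}" by blast
    qed (auto simp flip: a_inv_def)
  qed (auto simp: I.I_l_closed I.I_r_closed)
qed

lemma gmap_gd: "x \<in> carrier G \<Longrightarrow> gmap (G.gd x) = H.gd (h x)"
  by simp

text \<open>The relative ideal is a hull without a normal form for its elements. So the target ideal
  is pulled back along \<open>gmap\<close>, and minimality is applied to the generators.\<close>

lemma gmap_relative:
  assumes "ideal I H.ZG" "R \<subseteq> carrier G" "\<And>r. r \<in> R \<Longrightarrow> H.gd (h r) \<in> I" "a \<in> relative_ideal G R"
  shows "gmap a \<in> I"
proof -
  have "relative_ideal G R \<subseteq> {a \<in> carrier G.ZG. gmap a \<in> I}"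
  proof (rule G.relative_ideal_minimal[OF ideal_gmap_vimage[OF assms(1)]])
    fix r assume "r \<in> R"
    with assms(2,3) show "G.gd r \<in> {a \<in> carrier G.ZG. gmap a \<in> I}" by auto
  qed
  then show ?thesis using assms(4) by auto
qed

text \<open>The preimage of a term of the series of H is a subgroup of G containing the required
  commutators, so minimality of the commutator subgroup applies.\<close>

lemma gmap_lower_central: "x \<in> lower_central G n \<Longrightarrow> h x \<in> lower_central H n"
proof -
  have "lower_central G n \<subseteq> {x \<in> carrier G. h x \<in> lower_central H n}" for n
  proof (induction n)
    case (Suc n)
    show ?case
    proof (cases n)
      case m: (Suc m)
      interpret N: normal "lower_central H (Suc n)" H by (rule H.normal_lower_central)
      show ?thesis
        unfolding m lower_central.simps
      proof (rule G.commutator_subgroup_minimal)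
        show "subgroup {x \<in> carrier G. h x \<in> commutator_subgroup H (lower_central H (Suc m)) (carrier H)} G"
          using N.one_closed N.m_closed N.m_inv_closed unfolding m lower_central.simps
          by (intro G.subgroupI) (auto intro!: exI[of _ "\<one>\<^bsub>G\<^esub>"])
        fix x k assume x: "x \<in> lower_central G (Suc m)" "k \<in> carrier G"
        then have "x \<in> carrier G" "h x \<in> lower_central H (Suc m)" using Suc m by auto
        then show "x \<otimes>\<^bsub>G\<^esub> k \<otimes>\<^bsub>G\<^esub> inv\<^bsub>G\<^esub> x \<otimes>\<^bsub>G\<^esub> inv\<^bsub>G\<^esub> k \<in>
            {x \<in> carrier G. h x \<in> commutator_subgroup H (lower_central H (Suc m)) (carrier H)}"
          using H.lower_central_commutator[of "h x" m "h k"] x by simp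
      qed
    qed auto
  qed auto
  then show "x \<in> lower_central G n \<Longrightarrow> h x \<in> lower_central H n" by auto
qed

end

section \<open>Surjections: lifting elements of dimension subgroups\<close>

locale group_ring_epi = group_ring_hom +
  assumes surj: "h ` carrier G = carrier H"
begin

text \<open>An additive section of \<open>gmap\<close>, built from a set-theoretic section of
  \<open>h\<close>. In general it does not respect products.\<close>

definition gsec where
  "gsec = H.gr_ext (add_monoid G.ZG) (\<lambda>y. gr_single (inv_into (carrier G) h y))"

lemma section_closed [simp]: "y \<in> carrier H \<Longrightarrow> inv_into (carrier G) h y \<in> carrier G"
  and section_eq [simp]: "y \<in> carrier H \<Longrightarrow> h (inv_into (carrier G) h y) = y"
  using surj by (auto intro: inv_into_into f_inv_into_f)

sublocale gsec: group_hom "add_monoid H.ZG" "add_monoid G.ZG" gsec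
  unfolding gsec_def by (rule H.gr_ext_hom[OF G.ZG.a_comm_group]) auto

lemma gsec_closed [simp]: "a \<in> carrier H.ZG \<Longrightarrow> gsec a \<in> carrier G.ZG"
  using gsec.hom_closed by simp

lemma gsec_single [simp]: "y \<in> carrier H \<Longrightarrow> gsec (gr_single y) = gr_single (inv_into (carrier G) h y)"
  unfolding gsec_def by (subst H.gr_ext_single[OF G.ZG.a_comm_group]) auto

lemma gsec_add [simp]:
  "a \<in> carrier H.ZG \<Longrightarrow> b \<in> carrier H.ZG \<Longrightarrow>
    gsec (a \<oplus>\<^bsub>H.ZG\<^esub> b) = gsec a \<oplus>\<^bsub>G.ZG\<^esub> gsec b"
  using gsec.hom_mult by simp

lemma gsec_zero [simp]: "gsec \<zero>\<^bsub>H.ZG\<^esub> = \<zero>\<^bsub>G.ZG\<^esub>"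
  using gsec.hom_one by simp

lemma gsec_uminus [simp]:
  "a \<in> carrier H.ZG \<Longrightarrow> gsec (\<ominus>\<^bsub>H.ZG\<^esub> a) = \<ominus>\<^bsub>G.ZG\<^esub> gsec a"
  using gsec.hom_inv[of a] by (simp add: a_inv_def)

lemma gmap_gsec: "b \<in> carrier H.ZG \<Longrightarrow> gmap (gsec b) = b"
  by (induction b rule: H.group_ring_induct) simp_all

lemma gmap_aug_surj:
  assumes "b \<in> aug_ideal H" shows "\<exists>a\<in>aug_ideal G. gmap a = b"
  using assms gmap_gsec[of b] augm_gmap[of "gsec b"] gsec_closed[of b]
  by (intro bexI[of _ "gsec b"]) (auto simp: G.aug_ideal_iff H.aug_ideal_iff)

text \<open>\<open>gsec\<close> preserves the augmentation and so lifts the augmentation ideal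
  itself. It does not lift its powers, as it is not multiplicative; these are lifted factor by
  factor.\<close>

lemma gmap_ideal_power_surj:
  "b \<in> H.augp n \<Longrightarrow>
    \<exists>a\<in>G.augp n. gmap a = b"
proof (induction n arbitrary: b)
  case 0
  then show ?case using gmap_gsec gsec_closed by fastforce
next
  case (Suc n)
  note c = ideal.Icarr[OF G.ideal_power_ideal[OF G.ideal_aug_ideal]]
    and c' = ideal.Icarr[OF G.ideal_aug_ideal]
  from Suc.prems have "b \<in> ideal_prod H.ZG (H.augp n) (aug_ideal H)"
    by simp
  then show ?case
  proof (induction b rule: ideal_prod.induct)
    case (prod i j)
    obtain a where "a \<in> G.augp n" "gmap a = i" using Suc.IH[OF prod(1)] by blast
    moreover obtain a' where "a' \<in> aug_ideal G" "gmap a' = j" using gmap_aug_surj[OF prod(2)] by blast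
    ultimately show ?case
      using c c' by (intro bexI[of _ "a \<otimes>\<^bsub>G.ZG\<^esub> a'"]) (auto intro: ideal_prod.prod)
  next
    case (sum b b')
    then obtain a a' where a: "a \<in> G.augp (Suc n)" "gmap a = b"
      "a' \<in> G.augp (Suc n)" "gmap a' = b'" by blast
    then show ?case
      using c[of a "Suc n"] c[of a' "Suc n"]
      by (intro bexI[of _ "a \<oplus>\<^bsub>G.ZG\<^esub> a'"]) (auto intro: ideal_prod.sum)
  qed
qed

lemma kernel_subset: "kernel G H h \<subseteq> carrier G"
  by (auto simp: kernel_def)

lemma gmap_relative_zero:
  assumes "a \<in> relative_ideal G (kernel G H h)" shows "gmap a = \<zero>\<^bsub>H.ZG\<^esub>"
proof -
  have "H.gd (h r) = \<zero>\<^bsub>H.ZG\<^esub>" if "r \<in> kernel G H h" for r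
    using that by (simp add: kernel_def H.gd_one)
  then show ?thesis using gmap_relative[OF H.ZG.zeroideal kernel_subset _ assms] by auto
qed

text \<open>For a presentation the locale is used with the free group F in the place of
  \<open>G\<close> and the presented group in the place of \<open>H\<close>. This is the ideal rf of
  the statement.\<close>

abbreviation "rf \<equiv> ideal_prod G.ZG (relative_ideal G (kernel G H h)) (aug_ideal G)"

lemma ideal_rf: "ideal rf G.ZG"
  by (intro G.ZG.ideal_prod_is_ideal G.relative_ideal_ideal G.ideal_aug_ideal kernel_subset)

text \<open>For \<open>s = gsec (gmap x)\<close> and \<open>r = x s\<^sup>-\<^sup>1\<close> one has \<open>x = s + (r - 1) + (r - 1)(s - 1)\<close>. Modulo \<open>rf\<close> the map
  \<open>r \<mapsto> r - 1\<close> is additive.\<close>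

lemma gsec_gmap_mod:
  assumes "a \<in> carrier G.ZG"
  shows "\<exists>r\<in>kernel G H h. \<exists>j\<in>rf.
    a = gsec (gmap a) \<oplus>\<^bsub>G.ZG\<^esub> (G.gd r \<oplus>\<^bsub>G.ZG\<^esub> j)"
proof -
  let ?K = "kernel G H h"
  define J where "J = ideal_prod G.ZG (relative_ideal G ?K) (aug_ideal G)"
  interpret J: ideal J G.ZG unfolding J_def by (rule ideal_rf)
  have ker: "y \<in> ?K" if "y \<in> carrier G" "h y = \<one>\<^bsub>H\<^esub>" for y using that by (simp add: kernel_def)
  interpret K: subgroup ?K G by (rule subgroup_kernel)
  have prodJ: "G.gd r \<otimes>\<^bsub>G.ZG\<^esub> G.gd x \<in> J" if "r \<in> ?K" "x \<in> carrier G" for r x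
    unfolding J_def by (rule ideal_prod.prod) (use that G.gd_relative_ideal[OF K.subset] G.gd_aug in auto)
  have "\<exists>r\<in>?K. \<exists>j\<in>J. a = gsec (gmap a) \<oplus>\<^bsub>G.ZG\<^esub> (G.gd r \<oplus>\<^bsub>G.ZG\<^esub> j)"
    using assms
  proof (induction a rule: G.group_ring_induct)
    case zero
    show ?case by (intro bexI[of _ \<one>] bexI[of _ "\<zero>\<^bsub>G.ZG\<^esub>"]) (simp_all add: G.gd_one del: G.gr_single_carrier)
  next
    case (single x)
    define s where "s = inv_into (carrier G) h (h x)"
    define r where "r = x \<otimes> inv s"
    have s: "s \<in> carrier G" "h s = h x" "gsec (gmap (gr_single x)) = gr_single s" using single by (simp_all add: s_def)
    have r: "r \<in> carrier G" "r \<in> ?K" "r \<otimes> s = x" using s single by (simp_all add: r_def ker G.m_assoc)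
    have "gr_single x = gr_single s \<oplus>\<^bsub>G.ZG\<^esub> (G.gd r \<oplus>\<^bsub>G.ZG\<^esub> G.gd r \<otimes>\<^bsub>G.ZG\<^esub> G.gd s)"
    proof
      fix y
      show "gr_single x y = (gr_single s \<oplus>\<^bsub>G.ZG\<^esub> (G.gd r \<oplus>\<^bsub>G.ZG\<^esub> G.gd r \<otimes>\<^bsub>G.ZG\<^esub> G.gd s)) y"
        using fun_cong[OF G.gd_mult_gd[OF r(1) s(1), unfolded r(3)], of y]
        unfolding G.gr_add G.gr_minus[OF G.ZG.one_closed] by linarith
    qed
    then show ?case unfolding s(3) using r(2) prodJ[OF r(2) s(1)] by blast
  next
    case (add a b)
    obtain r j where r: "r \<in> ?K" "j \<in> J" "a = gsec (gmap a) \<oplus>\<^bsub>G.ZG\<^esub> (G.gd r \<oplus>\<^bsub>G.ZG\<^esub> j)"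
      using add(3) by blast
    obtain s k where s: "s \<in> ?K" "k \<in> J" "b = gsec (gmap b) \<oplus>\<^bsub>G.ZG\<^esub> (G.gd s \<oplus>\<^bsub>G.ZG\<^esub> k)"
      using add(4) by blast
    \<comment> \<open>\<open>r s - 1\<close> exceeds \<open>(r - 1) + (s - 1)\<close> by
      \<open>(r - 1)(s - 1)\<close>, an element of rf, which is taken away again here.\<close>
    let ?l = "j \<oplus>\<^bsub>G.ZG\<^esub> k \<ominus>\<^bsub>G.ZG\<^esub> G.gd r \<otimes>\<^bsub>G.ZG\<^esub> G.gd s"
    have l: "?l \<in> J" using r s prodJ K.subset by (simp add: G.ZG.minus_eq subset_iff)
    have e: "gsec (gmap (a \<oplus>\<^bsub>G.ZG\<^esub> b)) = gsec (gmap a) \<oplus>\<^bsub>G.ZG\<^esub> gsec (gmap b)"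
      using add by simp
    have p: "G.gd r \<otimes>\<^bsub>G.ZG\<^esub> G.gd s \<in> carrier G.ZG" using r s K.subset by (simp add: subset_iff)
    have "a \<oplus>\<^bsub>G.ZG\<^esub> b = gsec (gmap (a \<oplus>\<^bsub>G.ZG\<^esub> b)) \<oplus>\<^bsub>G.ZG\<^esub> (G.gd (r \<otimes> s) \<oplus>\<^bsub>G.ZG\<^esub> ?l)"
    proof
      fix x
      have "a x = gsec (gmap a) x + (G.gd r x + j x)" "b x = gsec (gmap b) x + (G.gd s x + k x)"
        using fun_cong[OF r(3), of x] fun_cong[OF s(3), of x] by (simp_all only: G.gr_add)
      then show "(a \<oplus>\<^bsub>G.ZG\<^esub> b) x = (gsec (gmap (a \<oplus>\<^bsub>G.ZG\<^esub> b)) \<oplus>\<^bsub>G.ZG\<^esub> (G.gd (r \<otimes> s) \<oplus>\<^bsub>G.ZG\<^esub> ?l)) x"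
        unfolding e unfolding G.gd_mult_gd[OF K.mem_carrier[OF r(1)] K.mem_carrier[OF s(1)]] G.gr_minus[OF p] G.gr_add
        by linarith
    qed
    then show ?case using l K.m_closed[OF r(1) s(1)] by blast
  next
    case (uminus a)
    obtain r j where r: "r \<in> ?K" "j \<in> J" "a = gsec (gmap a) \<oplus>\<^bsub>G.ZG\<^esub> (G.gd r \<oplus>\<^bsub>G.ZG\<^esub> j)"
      using uminus(2) by blast
    \<comment> \<open>Expanding \<open>r r\<^sup>-\<^sup>1 - 1 = 0\<close> gives \<open>-(r - 1) =
      (r\<^sup>-\<^sup>1 - 1) + (r - 1)(r\<^sup>-\<^sup>1 - 1)\<close>, and the product lies in
      rf.\<close>
    let ?l = "G.gd r \<otimes>\<^bsub>G.ZG\<^esub> G.gd (inv r) \<ominus>\<^bsub>G.ZG\<^esub> j"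
    have rc: "r \<in> carrier G" using r by simp
    have l: "?l \<in> J" using r prodJ rc by (simp add: G.ZG.minus_eq)
    have z: "G.gd r \<oplus>\<^bsub>G.ZG\<^esub> G.gd (inv r) \<oplus>\<^bsub>G.ZG\<^esub> G.gd r \<otimes>\<^bsub>G.ZG\<^esub> G.gd (inv r) = \<zero>\<^bsub>G.ZG\<^esub>"
      using G.gd_mult_gd[OF rc G.inv_closed[OF rc]] rc by (simp add: G.gd_one del: G.gr_single_carrier)
    have c: "gsec (gmap a) \<in> carrier G.ZG" using uminus by simp
    have e: "gsec (gmap (\<ominus>\<^bsub>G.ZG\<^esub> a)) = (\<lambda>x. - gsec (gmap a) x)" using uminus(1) by (simp add: G.gr_uminus[OF c])
    have "\<ominus>\<^bsub>G.ZG\<^esub> a = gsec (gmap (\<ominus>\<^bsub>G.ZG\<^esub> a)) \<oplus>\<^bsub>G.ZG\<^esub> (G.gd (inv r) \<oplus>\<^bsub>G.ZG\<^esub> ?l)"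
    proof
      fix x
      have "a x = gsec (gmap a) x + (G.gd r x + j x)"
        "G.gd r x + G.gd (inv r) x + (G.gd r \<otimes>\<^bsub>G.ZG\<^esub> G.gd (inv r)) x = 0"
        using fun_cong[OF r(3), of x] fun_cong[OF z, of x] by (simp_all only: G.gr_add G.gr_zero)
      then show "(\<ominus>\<^bsub>G.ZG\<^esub> a) x = (gsec (gmap (\<ominus>\<^bsub>G.ZG\<^esub> a)) \<oplus>\<^bsub>G.ZG\<^esub> (G.gd (inv r) \<oplus>\<^bsub>G.ZG\<^esub> ?l)) x"
        unfolding e unfolding G.gr_minus[OF J.Icarr[OF r(2)]] G.gr_uminus[OF uminus(1)] G.gr_add by linarith
    qed
    then show ?case using l K.m_inv_closed[OF r(1)] by blast
  qed
  then show ?thesis unfolding J_def .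
qed

abbreviation rf_ideal where
  "rf_ideal n \<equiv> rf
     <+>\<^bsub>G.ZG\<^esub> G.augp n"

lemma ideal_rf_ideal: "ideal (rf_ideal n) G.ZG"
  by (intro G.ZG.add_ideals ideal_rf G.ideal_power_ideal G.ideal_aug_ideal)

lemma rf_ideal_intro:
  "a \<in> rf \<Longrightarrow> a \<in> rf_ideal n"
  "a \<in> G.augp n \<Longrightarrow> a \<in> rf_ideal n"
proof -
  let ?I = "rf"
    and ?J = "G.augp n"
  interpret I: ideal ?I G.ZG by (rule ideal_rf)
  interpret J: ideal ?J G.ZG by (rule G.ideal_power_ideal[OF G.ideal_aug_ideal])
  have *: "x \<oplus>\<^bsub>G.ZG\<^esub> y \<in> rf_ideal n" if "x \<in> ?I" "y \<in> ?J" for x y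
    unfolding set_add_def' by (rule UN_I[OF that(1)], rule UN_I[OF that(2)], rule singletonI)
  show "a \<in> rf_ideal n" if "a \<in> ?I" using *[OF that J.zero_closed] I.Icarr[OF that] by simp
  show "a \<in> rf_ideal n" if "a \<in> ?J" using *[OF I.zero_closed that] J.Icarr[OF that] by simp
qed

text \<open>The ring map kills rf and carries the n-th power of one augmentation ideal into that of
  the other. This is why S maps into the dimension subgroup.\<close>

lemma one_plus_rf_dimension:
  assumes "x \<in> one_plus G (rf_ideal n)"
  shows "h x \<in> dimension_subgroup H n"
proof -
  have x: "x \<in> carrier G" "G.gd x \<in> rf_ideal n" using assms by (simp_all add: G.one_plus_iff)
  then obtain a b where ab: "a \<in> rf"
    "b \<in> G.augp n" "G.gd x = a \<oplus>\<^bsub>G.ZG\<^esub> b"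
    by (auto simp: set_add_def')
  have c: "a \<in> carrier G.ZG" "b \<in> carrier G.ZG"
    using ab ideal.Icarr[OF ideal_rf] ideal.Icarr[OF G.ideal_power_ideal[OF G.ideal_aug_ideal]] by auto
  have "a \<in> relative_ideal G (kernel G H h)"
    using ab(1) G.ZG.ideal_prod_inter[OF G.relative_ideal_ideal[OF kernel_subset] G.ideal_aug_ideal] by auto
  then have "gmap a = \<zero>\<^bsub>H.ZG\<^esub>" by (rule gmap_relative_zero)
  then have "H.gd (h x) = gmap b"
    using c x(1) by (simp add: gmap_gd[symmetric] ab(3) del: gmap_minus)
  then show ?thesis
    using gmap_ideal_power[OF ab(2)] x by (simp add: dimension_subgroup_def H.one_plus_iff)
qed

text \<open>Let z lift y, and let b in f^n lift y - 1. Then z - 1 - b is killed by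
  \<open>gmap\<close>, so by \<open>gsec_gmap_mod\<close> it is r - 1 modulo rf with r in the
  kernel. Hence z - r lies in rf + f^n, and multiplying by the inverse of r shows that z times this
  inverse is the required lift.\<close>

lemma dimension_lift:
  assumes y: "y \<in> dimension_subgroup H n"
  shows "\<exists>x \<in> one_plus G (rf_ideal n). h x = y"
proof -
  interpret J: ideal "rf_ideal n" G.ZG by (rule ideal_rf_ideal)
  have yH: "y \<in> carrier H" "H.gd y \<in> H.augp n"
    using y by (simp_all add: dimension_subgroup_def H.one_plus_iff)
  obtain b where b: "b \<in> G.augp n" "gmap b = H.gd y"
    using gmap_ideal_power_surj[OF yH(2)] by blast
  have bc: "b \<in> carrier G.ZG"
    using b ideal.Icarr[OF G.ideal_power_ideal[OF G.ideal_aug_ideal]] by blast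
  obtain z where z: "z \<in> carrier G" "h z = y" using section_closed[OF yH(1)] section_eq[OF yH(1)] by blast
  let ?a = "G.gd z \<ominus>\<^bsub>G.ZG\<^esub> b"
  have ac: "?a \<in> carrier G.ZG" using bc z by simp
  have "gmap ?a = \<zero>\<^bsub>H.ZG\<^esub>"
    using b bc z yH by (simp add: H.ZG.minus_eq H.ZG.r_neg)
  then obtain r j where r: "r \<in> kernel G H h" "j \<in> rf"
    "?a = G.gd r \<oplus>\<^bsub>G.ZG\<^esub> j"
    using gsec_gmap_mod[OF ac] ideal.Icarr[OF ideal_rf] kernel_subset by fastforce
  have rc: "r \<in> carrier G" "h r = \<one>\<^bsub>H\<^esub>" using r by (simp_all add: kernel_def)
  have jc: "j \<in> carrier G.ZG" using ideal.Icarr[OF ideal_rf r(2)] .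
  have "j \<oplus>\<^bsub>G.ZG\<^esub> b \<in> rf_ideal n"
    using rf_ideal_intro(1)[OF r(2)] rf_ideal_intro(2)[OF b(1)] by simp
  also have "j \<oplus>\<^bsub>G.ZG\<^esub> b = gr_single z \<ominus>\<^bsub>G.ZG\<^esub> gr_single r"
  proof
    fix x
    have "gr_single z x - \<one>\<^bsub>G.ZG\<^esub> x - b x = gr_single r x - \<one>\<^bsub>G.ZG\<^esub> x + j x"
      using fun_cong[OF r(3), of x] z rc bc by (simp only: G.gr_minus[OF bc] G.gr_minus[OF G.ZG.one_closed] G.gr_add)
    then show "(j \<oplus>\<^bsub>G.ZG\<^esub> b) x = (gr_single z \<ominus>\<^bsub>G.ZG\<^esub> gr_single r) x"
      using G.gr_minus[OF G.gr_single_carrier[OF rc(1)]] by (simp only: G.gr_add)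
  qed
  finally have "(gr_single z \<ominus>\<^bsub>G.ZG\<^esub> gr_single r) \<otimes>\<^bsub>G.ZG\<^esub> gr_single (inv r) \<in> rf_ideal n"
    using rc by (simp add: J.I_r_closed)
  also have "(gr_single z \<ominus>\<^bsub>G.ZG\<^esub> gr_single r) \<otimes>\<^bsub>G.ZG\<^esub> gr_single (inv r) = G.gd (z \<otimes> inv r)"
    using z rc by (simp add: G.ZG.minus_eq G.ZG.l_distr G.ZG.l_minus G.gr_single_mult[symmetric] G.gr_one)
  finally show ?thesis
    using z rc yH by (intro bexI[of _ "z \<otimes> inv r"]) (simp_all add: G.one_plus_iff)
qed

end

section \<open>Free groups\<close>

lemma eval_word_Nil [simp]: "eval_word F [] = \<one>\<^bsub>F\<^esub>"
  by (simp add: eval_word_def)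

lemma eval_word_Cons [simp]:
  "eval_word F ((e, x) # w) = (if e then x else inv\<^bsub>F\<^esub> x) \<otimes>\<^bsub>F\<^esub> eval_word F w"
  by (simp add: eval_word_def)

definition inv_word :: "(bool \<times> 'a) list \<Rightarrow> (bool \<times> 'a) list" where
  "inv_word w = rev (map (\<lambda>(e, x). (\<not> e, x)) w)"

lemma snd_inv_word [simp]: "snd ` set (inv_word w) = snd ` set w"
  by (force simp: inv_word_def)

definition map_word :: "('a \<Rightarrow> 'b) \<Rightarrow> (bool \<times> 'a) list \<Rightarrow> (bool \<times> 'b) list" where
  "map_word f w = map (\<lambda>(e, x). (e, f x)) w"

lemma map_word_append [simp]: "map_word f (u @ v) = map_word f u @ map_word f v"
  by (simp add: map_word_def)

lemma map_word_Nil [simp]: "map_word f [] = []"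
  by (simp add: map_word_def)

lemma map_word_Cons [simp]: "map_word f ((e, x) # w) = (e, f x) # map_word f w"
  by (simp add: map_word_def)

lemma snd_map_word [simp]: "snd ` set (map_word f w) = f ` snd ` set w"
  by (force simp: map_word_def)

lemma map_inv_word: "map_word f (inv_word w) = inv_word (map_word f w)"
  by (simp add: map_word_def inv_word_def rev_map case_prod_unfold)

lemma map_word_inv_into:
  "snd ` set w \<subseteq> range f \<Longrightarrow> map_word f (map_word (inv_into UNIV f) w) = w"
  by (induction w) (auto simp: f_inv_into_f)

context group
begin

lemma eval_word_closed [simp]: "snd ` set w \<subseteq> carrier G \<Longrightarrow> eval_word G w \<in> carrier G"
  by (induction w) auto

lemma eval_word_append:
  "snd ` set u \<subseteq> carrier G \<Longrightarrow> snd ` set v \<subseteq> carrier G \<Longrightarrow>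
    eval_word G (u @ v) = eval_word G u \<otimes> eval_word G v"
  by (induction u) (auto simp: m_assoc)

lemma eval_inv_word: "snd ` set w \<subseteq> carrier G \<Longrightarrow> eval_word G (inv_word w) = inv (eval_word G w)"
proof (induction w)
  case (Cons a w)
  obtain e x where a: "a = (e, x)" by force
  have "snd ` set (inv_word w) \<subseteq> carrier G" using Cons by simp
  then have "eval_word G (inv_word w @ [(\<not> e, x)]) = inv (eval_word G w) \<otimes> eval_word G [(\<not> e, x)]"
    using Cons a by (subst eval_word_append) auto
  then show ?case using Cons.prems a by (simp add: inv_word_def inv_mult_group)
qed (simp add: inv_word_def)

lemma generate_eval_word:
  assumes "B \<subseteq> carrier G" "x \<in> generate G B"
  shows "\<exists>w. snd ` set w \<subseteq> B \<and> eval_word G w = x"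
  using assms(2)
proof (induction x rule: generate.induct)
  case one
  show ?case by (rule exI[of _ "[]"]) simp
next
  case (incl h)
  with assms show ?case by (intro exI[of _ "[(True, h)]"]) auto
next
  case (inv h)
  with assms show ?case by (intro exI[of _ "[(False, h)]"]) auto
next
  case (eng h1 h2)
  then obtain u v where "snd ` set u \<subseteq> B" "eval_word G u = h1" "snd ` set v \<subseteq> B" "eval_word G v = h2" by auto
  with assms(1) show ?case
    by (intro exI[of _ "u @ v"]) (auto simp: eval_word_append subset_trans[of _ B])
qed

lemma generate_hom_eqI:
  assumes "B \<subseteq> carrier G" "group_hom G H f" "group_hom G H g" "\<And>b. b \<in> B \<Longrightarrow> f b = g b" "x \<in> generate G B"
  shows "f x = g x"
proof -
  interpret f: group_hom G H f by fact
  interpret g: group_hom G H g by fact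
  have c: "x \<in> generate G B \<Longrightarrow> x \<in> carrier G" for x using generate_in_carrier[OF assms(1)] .
  show ?thesis using assms(5)
    by (induction x rule: generate.induct) (use assms(1,4) c in \<open>auto simp: subset_iff\<close>)
qed

end

lemma not_successively_split:
  "\<not> successively P w \<Longrightarrow> \<exists>u a b v. w = u @ a # b # v \<and> \<not> P a b"
proof (induction w)
  case (Cons x w)
  show ?case
  proof (cases "successively P w")
    case True
    then obtain y v where "w = y # v" "\<not> P x y" using Cons.prems by (cases w) auto
    then show ?thesis by (intro exI[of _ "[]"]) auto
  next
    case False
    then obtain u a b v where "w = u @ a # b # v" "\<not> P a b" using Cons.IH by blast
    then show ?thesis by (intro exI[of _ "x # u"]) auto
  qed
qed simp

text \<open>Deleting a cancelling pair of letters changes neither evaluation.\<close>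

lemma free_basis_eval_word_one:
  assumes "group F" "group H" "free_basis F B" "f \<in> B \<rightarrow> carrier H"
    and "snd ` set w \<subseteq> B" "eval_word F w = \<one>\<^bsub>F\<^esub>"
  shows "eval_word H (map_word f w) = \<one>\<^bsub>H\<^esub>"
  using assms(5,6)
proof (induction "length w" arbitrary: w rule: less_induct)
  case less
  interpret F: group F by fact
  interpret H: group H by fact
  have BF: "B \<subseteq> carrier F" using assms(3) by (simp add: free_basis_def)
  show ?case
  proof (cases "w = []")
    case False
    then have "\<not> reduced_word w" using assms(3) less.prems by (auto simp: free_basis_def)
    then obtain u a b v where w: "w = u @ a # b # v" "\<not> (\<lambda>(d, x) (e, y). \<not> (x = y \<and> d \<noteq> e)) a b"
      unfolding reduced_word_def using not_successively_split by blast
    then obtain d x where a: "a = (d, x)" "b = (\<not> d, x)" by (cases a, cases b) auto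
    have s: "snd ` set u \<subseteq> B" "x \<in> B" "snd ` set v \<subseteq> B" using less.prems(1) w a by auto
    then have sF: "snd ` set u \<subseteq> carrier F" "x \<in> carrier F" "snd ` set v \<subseteq> carrier F" using BF by blast+
    have sH: "snd ` set (map_word f u) \<subseteq> carrier H" "f x \<in> carrier H" "snd ` set (map_word f v) \<subseteq> carrier H"
      using s assms(4) by (auto simp: Pi_iff)
    have cF: "eval_word F (a # b # v) = eval_word F v"
      using sF a by (simp add: F.m_assoc[symmetric])
    have cH: "eval_word H ((d, f x) # (\<not> d, f x) # map_word f v) = eval_word H (map_word f v)"
      using sH by (simp add: H.m_assoc[symmetric] del: snd_map_word)
    have "eval_word F w = eval_word F (u @ v)"
      using sF a w(1) cF by (simp add: F.eval_word_append del: eval_word_Cons)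
    then have "eval_word H (map_word f (u @ v)) = \<one>\<^bsub>H\<^esub>"
      using less.prems(2) s w by (intro less.hyps) auto
    then show ?thesis
      using sH w(1) a cH by (simp add: H.eval_word_append del: eval_word_Cons snd_map_word)
  qed simp
qed

text \<open>An element is evaluated through an arbitrary word for it. Two words v, w with the same
  value give the word v followed by the inverse of w, which has value 1;
  \<open>free_basis_eval_word_one\<close> shows that its image has value 1 too, so the choice does
  not matter.\<close>

proposition free_basis_hom:
  assumes F: "group F" and H: "group H" and B: "free_basis F B" and f: "f \<in> B \<rightarrow> carrier H"
  obtains \<phi> where "\<phi> \<in> hom F H" "\<And>b. b \<in> B \<Longrightarrow> \<phi> b = f b"
proof -
  interpret F: group F by fact
  interpret H: group H by fact
  have BF: "B \<subseteq> carrier F" "generate F B = carrier F" using B by (simp_all add: free_basis_def)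
  have fw: "snd ` set (map_word f w) \<subseteq> carrier H" if "snd ` set w \<subseteq> B" for w
    using f that by (auto simp: Pi_iff)
  define \<phi> where "\<phi> x = eval_word H (map_word f (SOME w. snd ` set w \<subseteq> B \<and> eval_word F w = x))" for x
  have \<phi>: "\<phi> (eval_word F w) = eval_word H (map_word f w)" if w: "snd ` set w \<subseteq> B" for w
  proof -
    define v where "v = (SOME v. snd ` set v \<subseteq> B \<and> eval_word F v = eval_word F w)"
    have v: "snd ` set v \<subseteq> B \<and> eval_word F v = eval_word F w"
      unfolding v_def by (rule someI[of _ w]) (use w in simp)
    have c: "snd ` set v \<subseteq> carrier F" "snd ` set w \<subseteq> carrier F" using v w BF by blast+
    have "eval_word F (v @ inv_word w) = \<one>\<^bsub>F\<^esub>"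
      using c v by (simp add: F.eval_word_append F.eval_inv_word)
    then have "eval_word H (map_word f (v @ inv_word w)) = \<one>\<^bsub>H\<^esub>"
      using v w by (intro free_basis_eval_word_one[OF F H B f]) (simp_all add: image_Un)
    then have "eval_word H (map_word f v) \<otimes>\<^bsub>H\<^esub> inv\<^bsub>H\<^esub> eval_word H (map_word f w) = \<one>\<^bsub>H\<^esub>"
      using fw[of v] fw[of w] v w
      by (simp add: map_inv_word H.eval_word_append H.eval_inv_word del: snd_map_word)
    then have "eval_word H (map_word f v) = eval_word H (map_word f w)"
      using fw[of v] fw[of w] v w by (simp add: H.inv_solve_right[symmetric] H.inv_equality del: snd_map_word)
        (metis H.inv_equality H.inv_closed H.inv_inv H.eval_word_closed)
    then show ?thesis by (simp add: \<phi>_def v_def)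
  qed
  show ?thesis
  proof
    have ex: "\<exists>w. snd ` set w \<subseteq> B \<and> eval_word F w = x" if "x \<in> carrier F" for x
      using F.generate_eval_word[OF BF(1)] BF(2) that by auto
    show "\<phi> \<in> hom F H"
    proof (rule homI)
      fix x assume "x \<in> carrier F"
      then obtain u where u: "snd ` set u \<subseteq> B" "eval_word F u = x" using ex by blast
      then show "\<phi> x \<in> carrier H" using \<phi>[OF u(1)] fw[OF u(1)] by (auto simp del: snd_map_word)
      fix y assume "y \<in> carrier F"
      then obtain v where v: "snd ` set v \<subseteq> B" "eval_word F v = y" using ex by blast
      have "x \<otimes>\<^bsub>F\<^esub> y = eval_word F (u @ v)"
        using u v BF(1) by (subst F.eval_word_append) blast+
      then have "\<phi> (x \<otimes>\<^bsub>F\<^esub> y) = eval_word H (map_word f (u @ v))" using \<phi>[of "u @ v"] u v by auto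
      then show "\<phi> (x \<otimes>\<^bsub>F\<^esub> y) = \<phi> x \<otimes>\<^bsub>H\<^esub> \<phi> y"
        using \<phi>[OF u(1)] \<phi>[OF v(1)] fw[OF u(1)] fw[OF v(1)] u v
        by (simp add: H.eval_word_append del: snd_map_word)
    qed
    fix b assume b: "b \<in> B"
    then have "eval_word F [(True, b)] = b" using BF by auto
    then have "\<phi> b = eval_word H (map_word f [(True, b)])" using \<phi>[of "[(True, b)]"] b by simp
    then show "\<phi> b = f b" using b f by (auto simp: Pi_iff)
  qed
qed

subsection \<open>Existence\<close>

text \<open>The free group is realised by the permutations \<open>w \<mapsto> x w\<close> of the set of reduced words.\<close>

fun word_cons :: "bool \<times> 'a \<Rightarrow> (bool \<times> 'a) list \<Rightarrow> (bool \<times> 'a) list" where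
  "word_cons a [] = [a]"
| "word_cons a (b # w) = (if snd a = snd b \<and> fst a \<noteq> fst b then w else a # b # w)"

lemma reduced_word_Cons:
  "reduced_word (a # w) \<longleftrightarrow> reduced_word w \<and> (w = [] \<or> \<not> (snd a = snd (hd w) \<and> fst a \<noteq> fst (hd w)))"
  by (cases w) (auto simp: reduced_word_def split: prod.splits)

lemma reduced_word_Nil [simp]: "reduced_word []"
  by (simp add: reduced_word_def)

lemma reduced_word_map_word: "reduced_word (map_word f v) \<Longrightarrow> reduced_word v"
proof (induction v)
  case (Cons a v)
  then show ?case by (cases a; cases v) (auto simp: reduced_word_Cons)
qed simp

lemma word_cons_reduced: "reduced_word w \<Longrightarrow> reduced_word (word_cons a w)"
  by (cases w) (auto simp: reduced_word_Cons)

lemma word_cons_eq_Cons: "reduced_word (a # w) \<Longrightarrow> word_cons a w = a # w"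
  by (cases w) (auto simp: reduced_word_Cons)

lemma word_cons_cancel: "reduced_word w \<Longrightarrow> word_cons (\<not> e, x) (word_cons (e, x) w) = w"
proof (cases w)
  case (Cons b v)
  assume w: "reduced_word w"
  show ?thesis
  proof (cases "x = snd b \<and> e \<noteq> fst b")
    case True
    then have "b = (\<not> e, x)" by (cases b) auto
    then show ?thesis using w Cons by (simp add: word_cons_eq_Cons)
  qed (use Cons in auto)
qed simp

text \<open>The elements of \<open>BijGroup\<close> are extensional, hence the restriction to
  reduced words.\<close>

definition letter_perm :: "'a \<Rightarrow> (bool \<times> 'a) list \<Rightarrow> (bool \<times> 'a) list" where
  "letter_perm x = restrict (word_cons (True, x)) (Collect reduced_word)"

lemma bij_betw_word_cons: "bij_betw (word_cons (e, x)) (Collect reduced_word) (Collect reduced_word)"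
  by (rule bij_betw_byWitness[of _ "word_cons (\<not> e, x)"])
     (use word_cons_cancel[of _ "\<not> e" x] in \<open>auto simp: word_cons_cancel word_cons_reduced\<close>)

lemma word_cons_Bij: "restrict (word_cons (e, x)) (Collect reduced_word) \<in> Bij (Collect reduced_word)"
  using bij_betw_word_cons[of e x] unfolding Bij_def by (simp del: restrict_apply add: bij_betw_restrict_eq)

lemma letter_perm_Bij: "letter_perm x \<in> Bij (Collect reduced_word)"
  unfolding letter_perm_def by (rule word_cons_Bij)

lemma inj_letter_perm: "inj letter_perm"
proof
  fix x y :: 'a assume "letter_perm x = letter_perm y"
  then have "letter_perm x [] = letter_perm y []" by simp
  then show "x = y" by (simp add: letter_perm_def)
qed

lemma inv_letter_perm:
  "inv\<^bsub>BijGroup (Collect reduced_word)\<^esub> (letter_perm x) = restrict (word_cons (False, x)) (Collect reduced_word)"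
proof (rule group.inv_equality[OF group_BijGroup])
  let ?L = "Collect reduced_word"
  show i: "restrict (word_cons (False, x)) ?L \<in> carrier (BijGroup ?L)"
    using word_cons_Bij[of False x] by (simp add: BijGroup_def)
  show "letter_perm x \<in> carrier (BijGroup ?L)" using letter_perm_Bij by (simp add: BijGroup_def)
  show "restrict (word_cons (False, x)) ?L \<otimes>\<^bsub>BijGroup ?L\<^esub> letter_perm x = \<one>\<^bsub>BijGroup ?L\<^esub>"
  proof -
    have "f \<otimes>\<^bsub>BijGroup ?L\<^esub> g = compose ?L f g" if "f \<in> Bij ?L" "g \<in> Bij ?L" for f g
      using that by (simp add: BijGroup_def)
    note this[OF word_cons_Bij[of False x] letter_perm_Bij[of x]]
    moreover have "compose ?L (restrict (word_cons (False, x)) ?L) (letter_perm x) = \<one>\<^bsub>BijGroup ?L\<^esub>"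
      using word_cons_cancel[of _ True x]
      by (auto simp: BijGroup_def compose_def letter_perm_def word_cons_reduced fun_eq_iff)
    ultimately show ?thesis by simp
  qed
qed

text \<open>When the letters of a reduced word are put in front of the empty word one after the
  other, no cancellation ever occurs. A nonempty reduced word therefore moves the empty
  word.\<close>

lemma eval_letter_perm:
  "reduced_word w \<Longrightarrow> eval_word (BijGroup (Collect reduced_word)) (map_word letter_perm w) [] = w"
proof (induction w)
  case Nil
  then show ?case by (simp add: BijGroup_def)
next
  case (Cons a w)
  let ?P = "BijGroup (Collect reduced_word)"
  interpret P: group ?P by (rule group_BijGroup)
  obtain e x where a: "a = (e, x)" by force
  have w: "reduced_word w" using Cons.prems by (simp add: reduced_word_Cons)
  have c: "eval_word ?P (map_word letter_perm w) \<in> carrier ?P"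
    by (rule P.eval_word_closed) (use letter_perm_Bij in \<open>auto simp: BijGroup_def\<close>)
  have l: "(if e then letter_perm x else inv\<^bsub>?P\<^esub> letter_perm x) = restrict (word_cons (e, x)) (Collect reduced_word)"
    by (simp add: inv_letter_perm) (simp add: letter_perm_def)
  have lc: "restrict (word_cons (e, x)) (Collect reduced_word) \<in> carrier ?P"
    using word_cons_Bij[of e x] by (simp add: BijGroup_def)
  have "eval_word ?P (map_word letter_perm (a # w)) [] =
      (restrict (word_cons (e, x)) (Collect reduced_word) \<otimes>\<^bsub>?P\<^esub> eval_word ?P (map_word letter_perm w)) []"
    by (simp only: a map_word_Cons eval_word_Cons l)
  also have "\<dots> = word_cons (e, x) w"
  proof -
    have "(f \<otimes>\<^bsub>?P\<^esub> g) [] = f (g [])" if "f \<in> carrier ?P" "g \<in> carrier ?P" for f g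
      using that by (simp add: BijGroup_def compose_def)
    from this[OF lc c] show ?thesis unfolding Cons.IH[OF w] using w by simp
  qed
  also have "\<dots> = a # w" using word_cons_eq_Cons Cons.prems a by blast
  finally show ?case .
qed

text \<open>Freeness is detected in the permutation group: a nonempty reduced word in F with value 1
  would have an image that fixes the empty word. The map \<theta> is needed because F will be only a
  copy of the generated permutation group.\<close>

lemma free_basis_of_letter_perm:
  assumes F: "group F" and \<theta>: "\<theta> \<in> hom F (BijGroup (Collect reduced_word))"
    and s: "range s \<subseteq> carrier F" "generate F (range s) = carrier F" "\<And>x. \<theta> (s x) = letter_perm x"
  shows "free_basis F (range s)"
  unfolding free_basis_def
proof (intro conjI allI impI s)
  let ?P = "BijGroup (Collect reduced_word)"
  interpret F: group F by fact
  interpret \<theta>: group_hom F ?P \<theta>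
    by (simp add: group_hom_def group_hom_axioms_def F \<theta> group_BijGroup)
  fix w assume w: "reduced_word w \<and> snd ` set w \<subseteq> range s \<and> w \<noteq> []"
  define v where "v = map_word (inv_into UNIV s) w"
  have wv: "w = map_word s v"
    using w by (simp add: v_def map_word_inv_into)
  have v: "reduced_word v"
    using w wv reduced_word_map_word by metis
  have e: "\<theta> (eval_word F (map_word s u)) = eval_word ?P (map_word letter_perm u)" for u
  proof (induction u)
    case (Cons a u)
    obtain e x where a: "a = (e, x)" by force
    have "eval_word F (map_word s u) \<in> carrier F" by (rule F.eval_word_closed) (use s in auto)
    moreover have "s x \<in> carrier F" using s by auto
    ultimately show ?case using Cons s a by auto
  qed simp
  show "eval_word F w \<noteq> \<one>\<^bsub>F\<^esub>"
  proof
    assume "eval_word F w = \<one>\<^bsub>F\<^esub>"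
    then have "eval_word ?P (map_word letter_perm v) [] = \<one>\<^bsub>?P\<^esub> []" using e[of v] wv by simp
    also have "\<dots> = []" by (simp add: BijGroup_def)
    finally have "v = []" using eval_letter_perm[OF v] by simp
    then show False using w wv by simp
  qed
qed

text \<open>All presentations live on one fixed type, so a group built on another type has to be
  carried over along an injection of its carrier.\<close>

lemma group_transport:
  assumes A: "group A" and j: "inj_on j (carrier A)"
  obtains F :: "'b monoid" where "group F" "j \<in> iso A F"
proof -
  interpret A: group A by fact
  let ?i = "inv_into (carrier A) j"
  define F where "F = \<lparr>carrier = j ` carrier A, monoid.mult = (\<lambda>x y. j (?i x \<otimes>\<^bsub>A\<^esub> ?i y)), one = j \<one>\<^bsub>A\<^esub>\<rparr>"
  have j: "j \<in> iso A F"
    using j by (auto simp: F_def iso_def hom_def bij_betw_def)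
  moreover have "monoid F"
    by (rule monoidI) (use assms in \<open>auto simp: F_def A.m_assoc\<close>)
  ultimately have "group F"
    using A.iso_imp_group[of F] unfolding is_iso_def by blast
  then show ?thesis using that j by blast
qed

text \<open>The type of all maps on words is too large to embed in \<open>'f\<close>. The subgroup
  generated by the letters is small enough: it is an image of the set of words over
  \<open>bool \<times> 'f\<close>, and for infinite \<open>'f\<close> there are as many such words
  as elements of \<open>'f\<close>.\<close>

proposition ex_free_group:
  assumes "infinite (UNIV :: 'f set)"
  obtains F :: "'f monoid" and s :: "'f \<Rightarrow> 'f" where "group F" "free_basis F (range s)" "inj s"
proof -
  let ?P = "BijGroup (Collect reduced_word) :: ((bool \<times> 'f) list \<Rightarrow> (bool \<times> 'f) list) monoid"
  interpret P: group ?P by (rule group_BijGroup)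
  have S: "range letter_perm \<subseteq> carrier ?P" using letter_perm_Bij by (auto simp: BijGroup_def)
  define C where "C = generate ?P (range letter_perm)"
  have C: "subgroup C ?P" unfolding C_def by (rule P.generate_is_subgroup[OF S])
  define A where "A = ?P\<lparr>carrier := C\<rparr>"
  interpret A: group A unfolding A_def by (rule subgroup.subgroup_is_group[OF C]) (rule group_BijGroup)
  have "|C| \<le>o |range (\<lambda>w :: (bool \<times> 'f) list. eval_word ?P (map_word letter_perm w))|"
  proof (rule card_of_mono1, rule subsetI)
    fix x assume "x \<in> C"
    then obtain w where w: "snd ` set w \<subseteq> range letter_perm" "eval_word ?P w = x"
      using P.generate_eval_word[OF S] unfolding C_def by blast
    have "map_word letter_perm (map_word (inv_into UNIV letter_perm) w) = w"
      using w(1) by (rule map_word_inv_into)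
    with w(2) show "x \<in> range (\<lambda>w :: (bool \<times> 'f) list. eval_word ?P (map_word letter_perm w))"
      by (metis rangeI)
  qed
  also have "|range (\<lambda>w :: (bool \<times> 'f) list. eval_word ?P (map_word letter_perm w))| \<le>o |UNIV :: (bool \<times> 'f) list set|"
    by (rule card_of_image)
  also have "|UNIV :: (bool \<times> 'f) list set| =o |lists (UNIV :: (bool \<times> 'f) set)|"
    by simp
  also have "|lists (UNIV :: (bool \<times> 'f) set)| =o |UNIV :: (bool \<times> 'f) set|"
    using assms by (intro card_of_lists_infinite) (simp add: finite_prod)
  also have "|UNIV :: (bool \<times> 'f) set| =o |UNIV :: 'f set|"
    using assms card_of_Times_infinite[of "UNIV :: 'f set" "UNIV :: bool set"]
    by (simp add: UNIV_Times_UNIV[symmetric] ordLess_imp_ordLeq finite_ordLess_infinite2 del: UNIV_Times_UNIV)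
  finally obtain j :: "_ \<Rightarrow> 'f" where j: "inj_on j C" unfolding card_of_ordLeq[symmetric] by blast
  obtain F :: "'f monoid" where F: "group F" "j \<in> iso A F"
    using group_transport[OF A.is_group, of j] j by (auto simp: A_def)
  interpret F: group F by fact
  let ?i = "inv_into (carrier A) j"
  have i: "?i \<in> iso F A" using A.iso_set_sym F(2) by blast
  have AC: "letter_perm x \<in> carrier A" for x by (simp add: A_def C_def generate.incl)
  define s where "s x = j (letter_perm x)" for x
  have sF: "range s \<subseteq> carrier F" using AC F(2) by (auto simp: s_def iso_def hom_def)
  interpret j: group_hom A F j using F by (simp add: group_hom_def group_hom_axioms_def iso_def A.is_group)
  have "generate A (range letter_perm) = C"
    unfolding A_def using P.generate_consistent[OF _ C, of "range letter_perm"] 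
    by (simp add: C_def generate.incl image_subset_iff)
  moreover have "range letter_perm \<subseteq> carrier A" using AC by auto
  ultimately have gen: "generate F (range s) = carrier F"
    using j.generate_img[of "range letter_perm"] F(2)
    by (simp add: s_def image_image iso_def bij_betw_def A_def)
  have "free_basis F (range s)"
  proof (rule free_basis_of_letter_perm[OF F(1) _ sF gen])
    show "?i \<in> hom F ?P" using i subgroup.subset[OF C] by (auto simp: iso_def hom_def A_def)
    show "?i (s x) = letter_perm x" for x
      using j AC by (simp add: s_def A_def)
  qed
  moreover have "inj s"
  proof
    fix x y assume "s x = s y"
    then have "letter_perm x = letter_perm y" using j AC by (simp add: s_def A_def inj_on_eq_iff)
    then show "x = y" by (rule injD[OF inj_letter_perm])
  qed
  ultimately show ?thesis using that F(1) by blast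
qed

text \<open>A presentation that is isomorphic to its coproduct with itself: the two summands are
  spanned by the images of the basis under \<open>i\<close> and \<open>j\<close>.\<close>

proposition ex_split_presentation:
  fixes G :: "'a monoid"
  assumes G: "group G" and inf: "infinite (UNIV :: 'f set)" and emb: "inj_on (e :: 'a \<Rightarrow> 'f) (carrier G)"
  obtains c :: "('f, 'a) presentation" and B i j where "c \<in> presentations G" "free_basis (fgrp c) B"
    "i \<in> B \<rightarrow> B" "j \<in> B \<rightarrow> B" "inj_on i B" "inj_on j B" "i ` B \<inter> j ` B = {}"
    "\<And>b. b \<in> B \<Longrightarrow> proj c (i b) = proj c b" "\<And>b. b \<in> B \<Longrightarrow> proj c (j b) = proj c b"
    "proj c ` B = carrier G"
proof -
  interpret G: group G by fact
  obtain F :: "'f monoid" and s :: "'f \<Rightarrow> 'f" where F: "group F" "free_basis F (range s)" "inj s"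
    using ex_free_group[OF inf] by blast
  interpret F: group F by fact
  \<comment> \<open>The basis is indexed by pairs (y, k): y determines the image \<open>g y\<close>
    in G, and k ranges over infinitely many basis elements with this same image.\<close>
  have "|UNIV \<times> UNIV :: ('f \<times> nat) set| =o |UNIV :: 'f set|"
    using card_of_Times_infinite[OF inf, of "UNIV :: nat set"] inf infinite_iff_card_of_nat by auto
  then obtain t :: "'f \<Rightarrow> 'f \<times> nat" where t: "bij t"
    using card_of_ordIso[of "UNIV :: 'f set" "UNIV :: ('f \<times> nat) set"] ordIso_symmetric by fastforce
  \<comment> \<open>Elements of \<open>'f\<close> outside the embedded copy of G get the unit as
    default value, so that g is a surjection from all of \<open>'f\<close> onto G.\<close>
  define g where "g y = (if y \<in> e ` carrier G then inv_into (carrier G) e y else \<one>\<^bsub>G\<^esub>)" for y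
  have g: "range g = carrier G"
  proof
    show "range g \<subseteq> carrier G" by (auto simp: g_def inv_into_into)
    show "carrier G \<subseteq> range g"
    proof
      fix x assume "x \<in> carrier G"
      then have "g (e x) = x" using emb by (simp add: g_def)
      then show "x \<in> range g" by (metis rangeI)
    qed
  qed
  define t' where "t' = inv_into UNIV t"
  have t': "t (t' y) = y" "t' (t x) = x" for x y
    using t by (simp_all add: t'_def bij_is_inj bij_is_surj surj_f_inv_f)
  define s' where "s' = inv_into UNIV s"
  have s': "s' (s x) = x" for x using F(3) by (simp add: s'_def)
  define f where "f b = g (fst (t (s' b)))" for b
  \<comment> \<open>Even second coordinates make up the first half of the basis, odd ones the second
    half. The first coordinate is kept, so both maps respect the projection to G.\<close>
  define i where "i b = s (t' (fst (t (s' b)), 2 * snd (t (s' b))))" for b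
  define j where "j b = s (t' (fst (t (s' b)), Suc (2 * snd (t (s' b)))))" for b
  have fG: "f \<in> range s \<rightarrow> carrier G" using g by (auto simp: f_def)
  obtain p where p: "p \<in> hom F G" "\<And>b. b \<in> range s \<Longrightarrow> p b = f b"
    using free_basis_hom[OF F(1) G F(2) fG] by blast
  have BF: "range s \<subseteq> carrier F" using F(2) by (simp add: free_basis_def)
  define c where "c = \<lparr>fgrp = F, proj = restrict p (carrier F)\<rparr>"
  have pc: "proj c (s x) = g (fst (t x))" for x
    using p(2)[of "s x"] BF by (auto simp: c_def f_def s')
  have surj: "proj c ` range s = carrier G"
  proof -
    have "range (\<lambda>x. g (fst (t x))) = carrier G"
    proof -
      have "x \<in> range (\<lambda>x. g (fst (t x)))" if x: "x \<in> carrier G" for x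
      proof -
        obtain y where "g y = x" using x g by (metis rangeE)
        then have "g (fst (t (t' (y, 0)))) = x" by (simp add: t')
        then show ?thesis by (metis rangeI)
      qed
      then show ?thesis using g by auto
    qed
    then show ?thesis by (simp add: image_image pc)
  qed
  show ?thesis
  proof
    have "proj c b = p b" if "b \<in> range s" for b using that BF by (auto simp: c_def)
    then have "p ` range s = carrier G" using surj by (metis (no_types, lifting) image_cong)
    then have "restrict p (carrier F) ` carrier F \<supseteq> carrier G" using BF by (metis image_mono image_restrict_eq)
    then have "restrict p (carrier F) \<in> epi F G"
      unfolding epi_iff_subset using p(1) by (auto simp: hom_def)
    then show "c \<in> presentations G"
      using F by (auto simp: presentations_def c_def free_group_def)
    show "free_basis (fgrp c) (range s)" using F by (simp add: c_def)
    show "i \<in> range s \<rightarrow> range s" "j \<in> range s \<rightarrow> range s" by (auto simp: i_def j_def)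
    have st: "x = y" if "s x = s y" for x y using F(3) that by (rule injD)
    have st': "a = b" if "t' a = t' b" for a b using that t'(1) by metis
    have stt: "x = y" if "t x = t y" for x y using that t'(2) by metis
    show "inj_on i (range s)"
    proof (rule inj_onI, elim rangeE)
      fix x y x' y' assume "i x = i y" "x = s x'" "y = s y'"
      then have "(fst (t x'), 2 * snd (t x')) = (fst (t y'), 2 * snd (t y'))"
        by - (rule st', rule st, simp add: i_def s')
      then have "x' = y'" by - (rule stt, simp add: prod_eq_iff)
      then show "x = y" using \<open>x = s x'\<close> \<open>y = s y'\<close> by simp
    qed
    show "inj_on j (range s)"
    proof (rule inj_onI, elim rangeE)
      fix x y x' y' assume "j x = j y" "x = s x'" "y = s y'"
      then have "(fst (t x'), Suc (2 * snd (t x'))) = (fst (t y'), Suc (2 * snd (t y')))"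
        by - (rule st', rule st, simp add: j_def s')
      then have "x' = y'" by - (rule stt, simp add: prod_eq_iff)
      then show "x = y" using \<open>x = s x'\<close> \<open>y = s y'\<close> by simp
    qed
    have "i x \<noteq> j y" for x y
    proof
      assume "i x = j y"
      then have "(fst (t (s' x)), 2 * snd (t (s' x))) = (fst (t (s' y)), Suc (2 * snd (t (s' y))))"
        by - (rule st', rule st, simp add: i_def j_def)
      then have "2 * snd (t (s' x)) = Suc (2 * snd (t (s' y)))" by simp
      then show False by presburger
    qed
    then show "i ` range s \<inter> j ` range s = {}" by blast
    show "proj c (i b) = proj c b" "proj c (j b) = proj c b" if "b \<in> range s" for b
      using that by (auto simp: i_def j_def pc s' t')
    show "proj c ` range s = carrier G" by (rule surj)
  qed
qed

section \<open>The first derived limit\<close>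

lemma (in group) inv_cancel [simp]:
  "x \<in> carrier G \<Longrightarrow> y \<in> carrier G \<Longrightarrow> inv x \<otimes> (x \<otimes> y) = y"
  "x \<in> carrier G \<Longrightarrow> y \<in> carrier G \<Longrightarrow> x \<otimes> (inv x \<otimes> y) = y"
  by (simp_all add: m_assoc[symmetric])

section \<open>Cocycles with values in a functor to groups, and the twisting action\<close>

locale group_valued_functor =
  fixes C :: "('o, 'm) small_cat" and F :: "('o, 'm, 'x) gr_functor"
  assumes Dom_Ob [simp]: "\<alpha> \<in> Mor C \<Longrightarrow> Dom C \<alpha> \<in> Ob C"
    and Cod_Ob [simp]: "\<alpha> \<in> Mor C \<Longrightarrow> Cod C \<alpha> \<in> Ob C"
    and Comp_Mor [simp]: "\<alpha> \<in> Mor C \<Longrightarrow> \<beta> \<in> Mor C \<Longrightarrow> Dom C \<alpha> = Cod C \<beta> \<Longrightarrow> Comp C \<alpha> \<beta> \<in> Mor C"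
    and Dom_Comp [simp]: "\<alpha> \<in> Mor C \<Longrightarrow> \<beta> \<in> Mor C \<Longrightarrow> Dom C \<alpha> = Cod C \<beta> \<Longrightarrow> Dom C (Comp C \<alpha> \<beta>) = Dom C \<beta>"
    and Cod_Comp [simp]: "\<alpha> \<in> Mor C \<Longrightarrow> \<beta> \<in> Mor C \<Longrightarrow> Dom C \<alpha> = Cod C \<beta> \<Longrightarrow> Cod C (Comp C \<alpha> \<beta>) = Cod C \<alpha>"
    and group_fob [simp]: "c \<in> Ob C \<Longrightarrow> group (fob F c)"
    and hom_fmor: "\<alpha> \<in> Mor C \<Longrightarrow> fmor F \<alpha> \<in> hom (fob F (Dom C \<alpha>)) (fob F (Cod C \<alpha>))"
    and fmor_Comp: "\<alpha> \<in> Mor C \<Longrightarrow> \<beta> \<in> Mor C \<Longrightarrow> Dom C \<alpha> = Cod C \<beta> \<Longrightarrow>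
      x \<in> carrier (fob F (Dom C \<beta>)) \<Longrightarrow> fmor F (Comp C \<alpha> \<beta>) x = fmor F \<alpha> (fmor F \<beta> x)"
begin

abbreviation "families \<equiv> product_group (Ob C) (fob F)"
abbreviation "cochains \<equiv> cochain_group C F"

lemma group_hom_fmor: "\<alpha> \<in> Mor C \<Longrightarrow> group_hom (fob F (Dom C \<alpha>)) (fob F (Cod C \<alpha>)) (fmor F \<alpha>)"
  by (simp add: group_hom_def group_hom_axioms_def hom_fmor)

lemma group_families [simp]: "group families" by simp
lemma group_cochains [simp]: "group cochains" by (simp add: cochain_group_def)

lemma fmor_closed [simp]:
  "\<alpha> \<in> Mor C \<Longrightarrow> x \<in> carrier (fob F (Dom C \<alpha>)) \<Longrightarrow> fmor F \<alpha> x \<in> carrier (fob F (Cod C \<alpha>))"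
  using group_hom.hom_closed[OF group_hom_fmor] .

lemma fmor_mult [simp]:
  "\<alpha> \<in> Mor C \<Longrightarrow> x \<in> carrier (fob F (Dom C \<alpha>)) \<Longrightarrow> y \<in> carrier (fob F (Dom C \<alpha>)) \<Longrightarrow>
    fmor F \<alpha> (x \<otimes>\<^bsub>fob F (Dom C \<alpha>)\<^esub> y) = fmor F \<alpha> x \<otimes>\<^bsub>fob F (Cod C \<alpha>)\<^esub> fmor F \<alpha> y"
  using group_hom.hom_mult[OF group_hom_fmor] .

lemma fmor_inv [simp]:
  "\<alpha> \<in> Mor C \<Longrightarrow> x \<in> carrier (fob F (Dom C \<alpha>)) \<Longrightarrow>
    fmor F \<alpha> (inv\<^bsub>fob F (Dom C \<alpha>)\<^esub> x) = inv\<^bsub>fob F (Cod C \<alpha>)\<^esub> (fmor F \<alpha> x)"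
  using group_hom.hom_inv[OF group_hom_fmor] .

lemma fmor_one [simp]:
  "\<alpha> \<in> Mor C \<Longrightarrow> fmor F \<alpha> \<one>\<^bsub>fob F (Dom C \<alpha>)\<^esub> = \<one>\<^bsub>fob F (Cod C \<alpha>)\<^esub>"
  using group_hom.hom_one[OF group_hom_fmor] .

lemma family_closed: "x \<in> carrier families \<Longrightarrow> c \<in> Ob C \<Longrightarrow> x c \<in> carrier (fob F c)"
  by auto

lemma cochain_closed: "a \<in> carrier cochains \<Longrightarrow> \<alpha> \<in> Mor C \<Longrightarrow> a \<alpha> \<in> carrier (fob F (Cod C \<alpha>))"
  by (auto simp: cochain_group_def)

lemma cochain_eqI:
  assumes "a \<in> carrier cochains" "b \<in> carrier cochains" "\<And>\<alpha>. \<alpha> \<in> Mor C \<Longrightarrow> a \<alpha> = b \<alpha>"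
  shows "a = b"
  using assms unfolding cochain_group_def carrier_product_group by (rule PiE_ext)

lemma cocycle_cochain: "a \<in> cocycles C F \<Longrightarrow> a \<in> carrier cochains"
  by (simp add: cocycles_def)

lemmas cocycle_closed = cochain_closed[OF cocycle_cochain]

lemma cocycleD:
  "a \<in> cocycles C F \<Longrightarrow> \<alpha> \<in> Mor C \<Longrightarrow> \<beta> \<in> Mor C \<Longrightarrow> Dom C \<alpha> = Cod C \<beta> \<Longrightarrow>
    a (Comp C \<alpha> \<beta>) = a \<alpha> \<otimes>\<^bsub>fob F (Cod C \<alpha>)\<^esub> fmor F \<alpha> (a \<beta>)"
  by (simp add: cocycles_def)

lemma cochain_one: "\<one>\<^bsub>cochains\<^esub> = (\<lambda>\<alpha>\<in>Mor C. \<one>\<^bsub>fob F (Cod C \<alpha>)\<^esub>)"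
  by (simp add: cochain_group_def)

lemma cochain_mult:
  "\<alpha> \<in> Mor C \<Longrightarrow> (a \<otimes>\<^bsub>cochains\<^esub> b) \<alpha> = a \<alpha> \<otimes>\<^bsub>fob F (Cod C \<alpha>)\<^esub> b \<alpha>"
  by (simp add: cochain_group_def)

lemma cochain_inv:
  "a \<in> carrier cochains \<Longrightarrow> \<alpha> \<in> Mor C \<Longrightarrow> (inv\<^bsub>cochains\<^esub> a) \<alpha> = inv\<^bsub>fob F (Cod C \<alpha>)\<^esub> (a \<alpha>)"
  by (simp add: cochain_group_def)

lemma one_cocycle: "\<one>\<^bsub>cochains\<^esub> \<in> cocycles C F"
proof -
  have "\<one>\<^bsub>cochains\<^esub> \<in> carrier cochains" by (rule monoid.one_closed) (simp add: group.is_monoid)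
  moreover have "\<one>\<^bsub>fob F (Cod C \<alpha>)\<^esub> = \<one>\<^bsub>fob F (Cod C \<alpha>)\<^esub> \<otimes>\<^bsub>fob F (Cod C \<alpha>)\<^esub> fmor F \<alpha> \<one>\<^bsub>fob F (Cod C \<beta>)\<^esub>"
    if "\<alpha> \<in> Mor C" "Dom C \<alpha> = Cod C \<beta>" for \<alpha> \<beta>
    using that fmor_one[OF that(1)] group.is_monoid[OF group_fob[OF Cod_Ob[OF that(1)]]] monoid.l_one monoid.one_closed by fastforce
  ultimately show ?thesis by (auto simp: cocycles_def cochain_one)
qed

lemma twist_apply:
  "\<alpha> \<in> Mor C \<Longrightarrow> twist C F a x \<alpha> = inv\<^bsub>fob F (Cod C \<alpha>)\<^esub> (x (Cod C \<alpha>)) \<otimes>\<^bsub>fob F (Cod C \<alpha>)\<^esub> a \<alpha>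
                  \<otimes>\<^bsub>fob F (Cod C \<alpha>)\<^esub> fmor F \<alpha> (x (Dom C \<alpha>))"
  by (simp add: twist_def)

lemma twist_closed:
  assumes "a \<in> carrier cochains" "x \<in> carrier families"
  shows "twist C F a x \<in> carrier cochains"
  unfolding cochain_group_def carrier_product_group twist_def
proof (rule restrict_PiE_iff[THEN iffD2], rule ballI)
  fix \<alpha> assume \<alpha>: "\<alpha> \<in> Mor C"
  interpret group "fob F (Cod C \<alpha>)" using \<alpha> by simp
  show "inv\<^bsub>fob F (Cod C \<alpha>)\<^esub> (x (Cod C \<alpha>)) \<otimes>\<^bsub>fob F (Cod C \<alpha>)\<^esub> a \<alpha>
                  \<otimes>\<^bsub>fob F (Cod C \<alpha>)\<^esub> fmor F \<alpha> (x (Dom C \<alpha>)) \<in> carrier (fob F (Cod C \<alpha>))"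
    using \<alpha> cochain_closed[OF assms(1) \<alpha>] family_closed[OF assms(2)] by simp
qed

lemma twist_cocycle:
  assumes a: "a \<in> cocycles C F" and x: "x \<in> carrier families"
  shows "twist C F a x \<in> cocycles C F"
  unfolding cocycles_def
proof (intro CollectI conjI ballI impI)
  show "twist C F a x \<in> carrier cochains" using twist_closed[OF cocycle_cochain] assms .
  fix \<alpha> \<beta> assume m: "\<alpha> \<in> Mor C" "\<beta> \<in> Mor C" "Dom C \<alpha> = Cod C \<beta>"
  interpret A: group "fob F (Cod C \<alpha>)" using m by simp
  interpret B: group "fob F (Cod C \<beta>)" using m by simp
  note c = cocycle_closed[OF a m(1)] cocycle_closed[OF a m(2)]
    family_closed[OF x Cod_Ob[OF m(1)]] family_closed[OF x Cod_Ob[OF m(2)]] family_closed[OF x Dom_Ob[OF m(2)]]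
  note f = fmor_closed[OF m(2) c(5)]
  show "twist C F a x (Comp C \<alpha> \<beta>) = twist C F a x \<alpha> \<otimes>\<^bsub>fob F (Cod C \<alpha>)\<^esub> fmor F \<alpha> (twist C F a x \<beta>)"
    using m c f fmor_mult[OF m(1)] fmor_inv[OF m(1)] fmor_closed[OF m(1)]
    by (simp add: twist_apply cocycleD[OF a] fmor_Comp A.m_assoc B.m_assoc)
qed

text \<open>Twisting is a right action of the group of families, which is what makes the twist
  orbits classes of an equivalence relation.\<close>

lemma twist_twist:
  assumes a: "a \<in> carrier cochains" and x: "x \<in> carrier families" and y: "y \<in> carrier families"
  shows "twist C F (twist C F a x) y = twist C F a (x \<otimes>\<^bsub>families\<^esub> y)"
proof (rule cochain_eqI)
  have xy: "x \<otimes>\<^bsub>families\<^esub> y \<in> carrier families"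
    by (rule monoid.m_closed[OF group.is_monoid[OF group_families] x y])
  show "twist C F (twist C F a x) y \<in> carrier cochains" "twist C F a (x \<otimes>\<^bsub>families\<^esub> y) \<in> carrier cochains"
    using twist_closed a x y xy by simp_all
  fix \<alpha> assume \<alpha>: "\<alpha> \<in> Mor C"
  interpret A: group "fob F (Cod C \<alpha>)" using \<alpha> by simp
  interpret B: group "fob F (Dom C \<alpha>)" using \<alpha> by simp
  show "twist C F (twist C F a x) y \<alpha> = twist C F a (x \<otimes>\<^bsub>families\<^esub> y) \<alpha>"
    using \<alpha> cochain_closed[OF a \<alpha>] family_closed[OF x] family_closed[OF y]
    by (simp add: twist_apply A.inv_mult_group A.m_assoc)
qed

lemma twist_one:
  assumes a: "a \<in> carrier cochains"
  shows "twist C F a \<one>\<^bsub>families\<^esub> = a"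
proof (rule cochain_eqI)
  have 1: "\<one>\<^bsub>families\<^esub> \<in> carrier families"
    by (rule monoid.one_closed[OF group.is_monoid[OF group_families]])
  show "twist C F a \<one>\<^bsub>families\<^esub> \<in> carrier cochains" "a \<in> carrier cochains"
    using twist_closed[OF a 1] a by simp_all
  fix \<alpha> assume \<alpha>: "\<alpha> \<in> Mor C"
  interpret A: group "fob F (Cod C \<alpha>)" using \<alpha> by simp
  interpret B: group "fob F (Dom C \<alpha>)" using \<alpha> by simp
  show "twist C F a \<one>\<^bsub>families\<^esub> \<alpha> = a \<alpha>"
    using \<alpha> cochain_closed[OF a \<alpha>] by (simp add: twist_apply)
qed

lemma twist_orbit_refl: "a \<in> carrier cochains \<Longrightarrow> a \<in> twist_orbit C F a"
proof -
  assume a: "a \<in> carrier cochains"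
  have "\<one>\<^bsub>families\<^esub> \<in> carrier families"
    by (rule monoid.one_closed[OF group.is_monoid[OF group_families]])
  then show ?thesis unfolding twist_orbit_def using twist_one[OF a] by (metis imageI)
qed

lemma twist_orbit_twist:
  assumes a: "a \<in> carrier cochains" and x: "x \<in> carrier families"
  shows "twist_orbit C F (twist C F a x) = twist_orbit C F a"
proof
  interpret P: group families by simp
  show "twist_orbit C F (twist C F a x) \<subseteq> twist_orbit C F a"
    unfolding twist_orbit_def
  proof (rule image_subsetI)
    fix y assume y: "y \<in> carrier families"
    show "twist C F (twist C F a x) y \<in> twist C F a ` carrier families"
      unfolding twist_twist[OF a x y] by (rule imageI[OF P.m_closed[OF x y]])
  qed
  show "twist_orbit C F a \<subseteq> twist_orbit C F (twist C F a x)"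
  proof
    fix b assume "b \<in> twist_orbit C F a"
    then obtain y where y: "y \<in> carrier families" "b = twist C F a y" by (auto simp only: twist_orbit_def)
    have "b = twist C F (twist C F a x) (inv\<^bsub>families\<^esub> x \<otimes>\<^bsub>families\<^esub> y)"
      unfolding twist_twist[OF a x P.m_closed[OF P.inv_closed[OF x] y(1)]] P.inv_cancel(2)[OF x y(1)]
      by (rule y(2))
    then show "b \<in> twist_orbit C F (twist C F a x)"
      unfolding twist_orbit_def by (rule image_eqI[OF _ P.m_closed[OF P.inv_closed[OF x] y(1)]])
  qed
qed

lemma twist_orbit_eq: "a \<in> carrier cochains \<Longrightarrow> b \<in> twist_orbit C F a \<Longrightarrow> twist_orbit C F b = twist_orbit C F a"
  using twist_orbit_twist by (auto simp only: twist_orbit_def[of C F a])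

end

section \<open>Abelian coefficients: the group structure on the first derived limit\<close>

locale abelian_functor = group_valued_functor +
  assumes comm: "c \<in> Ob C \<Longrightarrow> x \<in> carrier (fob F c) \<Longrightarrow> y \<in> carrier (fob F c) \<Longrightarrow>
    x \<otimes>\<^bsub>fob F c\<^esub> y = y \<otimes>\<^bsub>fob F c\<^esub> x"
begin

lemma cocycle_mult:
  assumes a: "a \<in> cocycles C F" and b: "b \<in> cocycles C F"
  shows "a \<otimes>\<^bsub>cochains\<^esub> b \<in> cocycles C F"
  unfolding cocycles_def
proof (intro CollectI conjI ballI impI)
  show "a \<otimes>\<^bsub>cochains\<^esub> b \<in> carrier cochains"
    by (rule monoid.m_closed[OF group.is_monoid[OF group_cochains] cocycle_cochain[OF a] cocycle_cochain[OF b]])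
  fix \<alpha> \<beta> assume m: "\<alpha> \<in> Mor C" "\<beta> \<in> Mor C" "Dom C \<alpha> = Cod C \<beta>"
  interpret A: comm_group "fob F (Cod C \<alpha>)"
    by (rule group.group_comm_groupI) (use m comm in auto)
  interpret B: group "fob F (Cod C \<beta>)" using m by simp
  note c = cocycle_closed[OF a m(1)] cocycle_closed[OF a m(2)]
     cocycle_closed[OF b m(1)] cocycle_closed[OF b m(2)]
  show "(a \<otimes>\<^bsub>cochains\<^esub> b) (Comp C \<alpha> \<beta>) =
      (a \<otimes>\<^bsub>cochains\<^esub> b) \<alpha> \<otimes>\<^bsub>fob F (Cod C \<alpha>)\<^esub> fmor F \<alpha> ((a \<otimes>\<^bsub>cochains\<^esub> b) \<beta>)"
    using m c fmor_mult[OF m(1)] fmor_closed[OF m(1)]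
    by (simp add: cochain_mult cocycleD[OF a] cocycleD[OF b] A.m_ac)
qed

lemma cocycle_inv:
  assumes a: "a \<in> cocycles C F"
  shows "inv\<^bsub>cochains\<^esub> a \<in> cocycles C F"
  unfolding cocycles_def
proof (intro CollectI conjI ballI impI)
  show "inv\<^bsub>cochains\<^esub> a \<in> carrier cochains"
    by (rule group.inv_closed[OF group_cochains cocycle_cochain[OF a]])
  fix \<alpha> \<beta> assume m: "\<alpha> \<in> Mor C" "\<beta> \<in> Mor C" "Dom C \<alpha> = Cod C \<beta>"
  interpret A: comm_group "fob F (Cod C \<alpha>)"
    by (rule group.group_comm_groupI) (use m comm in auto)
  interpret B: group "fob F (Cod C \<beta>)" using m by simp
  note c = cocycle_closed[OF a m(1)] cocycle_closed[OF a m(2)]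
  show "(inv\<^bsub>cochains\<^esub> a) (Comp C \<alpha> \<beta>) =
      (inv\<^bsub>cochains\<^esub> a) \<alpha> \<otimes>\<^bsub>fob F (Cod C \<alpha>)\<^esub> fmor F \<alpha> ((inv\<^bsub>cochains\<^esub> a) \<beta>)"
    using m c fmor_inv[OF m(1)] fmor_closed[OF m(1)]
    by (simp add: cochain_inv[OF cocycle_cochain[OF a]] cocycleD[OF a] A.inv_mult)
qed

lemma twist_mult:
  assumes a: "a \<in> carrier cochains" and b: "b \<in> carrier cochains"
    and x: "x \<in> carrier families" and y: "y \<in> carrier families"
  shows "twist C F a x \<otimes>\<^bsub>cochains\<^esub> twist C F b y = twist C F (a \<otimes>\<^bsub>cochains\<^esub> b) (x \<otimes>\<^bsub>families\<^esub> y)"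
proof (rule cochain_eqI)
  interpret Ch: group cochains by simp
  interpret P: group families by simp
  show "twist C F a x \<otimes>\<^bsub>cochains\<^esub> twist C F b y \<in> carrier cochains"
    "twist C F (a \<otimes>\<^bsub>cochains\<^esub> b) (x \<otimes>\<^bsub>families\<^esub> y) \<in> carrier cochains"
    by (rule Ch.m_closed[OF twist_closed[OF a x] twist_closed[OF b y]],
        rule twist_closed[OF Ch.m_closed[OF a b] P.m_closed[OF x y]])
  fix \<alpha> assume \<alpha>: "\<alpha> \<in> Mor C"
  interpret A: comm_group "fob F (Cod C \<alpha>)"
    by (rule group.group_comm_groupI) (use \<alpha> comm in auto)
  show "(twist C F a x \<otimes>\<^bsub>cochains\<^esub> twist C F b y) \<alpha> = twist C F (a \<otimes>\<^bsub>cochains\<^esub> b) (x \<otimes>\<^bsub>families\<^esub> y) \<alpha>"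
    using \<alpha> cochain_closed[OF a \<alpha>] cochain_closed[OF b \<alpha>] family_closed[OF x] family_closed[OF y]
    by (simp add: twist_apply cochain_mult A.inv_mult A.m_ac)
qed

text \<open>For commuting values the twists of the two factors can be collected into one, so a
  setwise product of orbits is again an orbit. This justifies the multiplication in
  \<open>lim1_group\<close>.\<close>

lemma twist_orbit_mult:
  assumes a: "a \<in> carrier cochains" and b: "b \<in> carrier cochains"
  shows "twist_orbit C F a <#>\<^bsub>cochains\<^esub> twist_orbit C F b = twist_orbit C F (a \<otimes>\<^bsub>cochains\<^esub> b)"
proof
  interpret P: group families by simp
  show "twist_orbit C F a <#>\<^bsub>cochains\<^esub> twist_orbit C F b \<subseteq> twist_orbit C F (a \<otimes>\<^bsub>cochains\<^esub> b)"
  proof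
    fix z assume "z \<in> twist_orbit C F a <#>\<^bsub>cochains\<^esub> twist_orbit C F b"
    then obtain x y where xy: "x \<in> carrier families" "y \<in> carrier families"
      "z = twist C F a x \<otimes>\<^bsub>cochains\<^esub> twist C F b y" by (auto simp only: set_mult_def twist_orbit_def)
    show "z \<in> twist_orbit C F (a \<otimes>\<^bsub>cochains\<^esub> b)"
      unfolding xy(3) twist_mult[OF a b xy(1,2)] twist_orbit_def by (rule imageI[OF P.m_closed[OF xy(1,2)]])
  qed
  show "twist_orbit C F (a \<otimes>\<^bsub>cochains\<^esub> b) \<subseteq> twist_orbit C F a <#>\<^bsub>cochains\<^esub> twist_orbit C F b"
  proof
    fix z assume "z \<in> twist_orbit C F (a \<otimes>\<^bsub>cochains\<^esub> b)"
    then obtain x where x: "x \<in> carrier families" "z = twist C F (a \<otimes>\<^bsub>cochains\<^esub> b) x"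
      by (auto simp only: twist_orbit_def)
    then have "z = twist C F a x \<otimes>\<^bsub>cochains\<^esub> twist C F b \<one>\<^bsub>families\<^esub>"
      by (subst twist_mult[OF a b x(1) P.one_closed]) (simp only: P.r_one)
    moreover have "twist C F a x \<in> twist_orbit C F a" "twist C F b \<one>\<^bsub>families\<^esub> \<in> twist_orbit C F b"
      using x(1) P.one_closed by (auto simp only: twist_orbit_def)
    ultimately show "z \<in> twist_orbit C F a <#>\<^bsub>cochains\<^esub> twist_orbit C F b"
      unfolding set_mult_def by blast
  qed
qed

lemma group_lim1_group: "group (lim1_group C F)"
proof (rule groupI)
  interpret Ch: group cochains by simp
  have E: "\<exists>a \<in> cocycles C F. A = twist_orbit C F a" if "A \<in> carrier (lim1_group C F)" for A
    using that by (auto simp: lim1_group_def lim1_def)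
  have I: "twist_orbit C F a \<in> carrier (lim1_group C F)" if "a \<in> cocycles C F" for a
    using that by (simp add: lim1_group_def lim1_def)
  have M: "twist_orbit C F a \<otimes>\<^bsub>lim1_group C F\<^esub> twist_orbit C F b = twist_orbit C F (a \<otimes>\<^bsub>cochains\<^esub> b)"
    if "a \<in> cocycles C F" "b \<in> cocycles C F" for a b
    using twist_orbit_mult that cocycle_cochain by (simp add: lim1_group_def)
  have O: "\<one>\<^bsub>lim1_group C F\<^esub> = twist_orbit C F \<one>\<^bsub>cochains\<^esub>" by (simp add: lim1_group_def lim1_point_def)
  show "\<one>\<^bsub>lim1_group C F\<^esub> \<in> carrier (lim1_group C F)" unfolding O by (rule I[OF one_cocycle])
  fix A assume "A \<in> carrier (lim1_group C F)"
  then obtain a where a: "a \<in> cocycles C F" "A = twist_orbit C F a" using E by blast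
  show "\<one>\<^bsub>lim1_group C F\<^esub> \<otimes>\<^bsub>lim1_group C F\<^esub> A = A"
    unfolding a(2) O M[OF one_cocycle a(1)] Ch.l_one[OF cocycle_cochain[OF a(1)]] by (rule HOL.refl)
  have "twist_orbit C F (inv\<^bsub>cochains\<^esub> a) \<otimes>\<^bsub>lim1_group C F\<^esub> A = \<one>\<^bsub>lim1_group C F\<^esub>"
    unfolding a(2) O M[OF cocycle_inv[OF a(1)] a(1)] Ch.l_inv[OF cocycle_cochain[OF a(1)]] by (rule HOL.refl)
  then show "\<exists>B\<in>carrier (lim1_group C F). B \<otimes>\<^bsub>lim1_group C F\<^esub> A = \<one>\<^bsub>lim1_group C F\<^esub>"
    using I[OF cocycle_inv[OF a(1)]] by blast
  fix B assume "B \<in> carrier (lim1_group C F)"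
  then obtain b where b: "b \<in> cocycles C F" "B = twist_orbit C F b" using E by blast
  show "A \<otimes>\<^bsub>lim1_group C F\<^esub> B \<in> carrier (lim1_group C F)"
    unfolding a(2) b(2) M[OF a(1) b(1)] by (rule I[OF cocycle_mult[OF a(1) b(1)]])
  fix D assume "D \<in> carrier (lim1_group C F)"
  then obtain d where d: "d \<in> cocycles C F" "D = twist_orbit C F d" using E by blast
  note c = cocycle_cochain[OF a(1)] cocycle_cochain[OF b(1)] cocycle_cochain[OF d(1)]
  show "A \<otimes>\<^bsub>lim1_group C F\<^esub> B \<otimes>\<^bsub>lim1_group C F\<^esub> D = A \<otimes>\<^bsub>lim1_group C F\<^esub> (B \<otimes>\<^bsub>lim1_group C F\<^esub> D)"
    unfolding a(2) b(2) d(2) M[OF a(1) b(1)] M[OF b(1) d(1)] M[OF cocycle_mult[OF a(1) b(1)] d(1)]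
      M[OF a(1) cocycle_mult[OF b(1) d(1)]] Ch.m_assoc[OF c] by (rule HOL.refl)
qed

end

text \<open>A central extension of a constant functor H by an abelian functor E, over a category in
  which any object maps to any other. The middle functor F may be nonabelian. The last assumption
  says that the first derived limit of the constant functor H is trivial: a multiplicative
  assignment on morphisms depends only on their ends, through a potential k.\<close>

locale constant_extension =
  E: abelian_functor C E + F: group_valued_functor C F + H: group H
  for C :: "('o, 'm) small_cat" and E :: "('o, 'm, 'w) gr_functor"
    and F :: "('o, 'm, 'x) gr_functor" and H :: "('h, 'z) monoid_scheme" +
  fixes \<tau> :: "'o \<Rightarrow> 'w \<Rightarrow> 'x" and p :: "'o \<Rightarrow> 'x \<Rightarrow> 'h"
  assumes tau_hom: "c \<in> Ob C \<Longrightarrow> \<tau> c \<in> hom (fob E c) (fob F c)"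
    and tau_inj: "c \<in> Ob C \<Longrightarrow> inj_on (\<tau> c) (carrier (fob E c))"
    and p_hom: "c \<in> Ob C \<Longrightarrow> p c \<in> hom (fob F c) H"
    and p_surj: "c \<in> Ob C \<Longrightarrow> p c ` carrier (fob F c) = carrier H"
    and exact: "c \<in> Ob C \<Longrightarrow> \<tau> c ` carrier (fob E c) = kernel (fob F c) H (p c)"
    and tau_nat: "\<alpha> \<in> Mor C \<Longrightarrow> e \<in> carrier (fob E (Dom C \<alpha>)) \<Longrightarrow>
      \<tau> (Cod C \<alpha>) (fmor E \<alpha> e) = fmor F \<alpha> (\<tau> (Dom C \<alpha>) e)"
    and p_nat: "\<alpha> \<in> Mor C \<Longrightarrow> x \<in> carrier (fob F (Dom C \<alpha>)) \<Longrightarrow>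
      p (Cod C \<alpha>) (fmor F \<alpha> x) = p (Dom C \<alpha>) x"
    and central: "c \<in> Ob C \<Longrightarrow> e \<in> carrier (fob E c) \<Longrightarrow> x \<in> carrier (fob F c) \<Longrightarrow>
      \<tau> c e \<otimes>\<^bsub>fob F c\<^esub> x = x \<otimes>\<^bsub>fob F c\<^esub> \<tau> c e"
    and Ob_nonempty: "Ob C \<noteq> {}"
    and connected: "c \<in> Ob C \<Longrightarrow> d \<in> Ob C \<Longrightarrow> \<exists>\<alpha>\<in>Mor C. Dom C \<alpha> = c \<and> Cod C \<alpha> = d"
    and constant_cocycles: "(\<And>\<alpha>. \<alpha> \<in> Mor C \<Longrightarrow> t \<alpha> \<in> carrier H) \<Longrightarrow>
      (\<And>\<alpha> \<beta>. \<alpha> \<in> Mor C \<Longrightarrow> \<beta> \<in> Mor C \<Longrightarrow> Dom C \<alpha> = Cod C \<beta> \<Longrightarrow> t (Comp C \<alpha> \<beta>) = t \<alpha> \<otimes>\<^bsub>H\<^esub> t \<beta>) \<Longrightarrow>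
      \<exists>k. (\<forall>c\<in>Ob C. k c \<in> carrier H) \<and> (\<forall>\<alpha>\<in>Mor C. t \<alpha> = k (Cod C \<alpha>) \<otimes>\<^bsub>H\<^esub> inv\<^bsub>H\<^esub> k (Dom C \<alpha>))"
begin

lemma group_hom_tau: "c \<in> Ob C \<Longrightarrow> group_hom (fob E c) (fob F c) (\<tau> c)"
  by (simp add: group_hom_def group_hom_axioms_def tau_hom)

lemma group_hom_p: "c \<in> Ob C \<Longrightarrow> group_hom (fob F c) H (p c)"
  by (simp add: group_hom_def group_hom_axioms_def p_hom H.is_group)

lemmas tau_closed [simp] = group_hom.hom_closed[OF group_hom_tau]
  and tau_mult [simp] = group_hom.hom_mult[OF group_hom_tau]
  and tau_inv [simp] = group_hom.hom_inv[OF group_hom_tau]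
  and tau_one [simp] = group_hom.hom_one[OF group_hom_tau]
  and p_closed [simp] = group_hom.hom_closed[OF group_hom_p]
  and p_mult [simp] = group_hom.hom_mult[OF group_hom_p]
  and p_inv [simp] = group_hom.hom_inv[OF group_hom_p]
  and p_one [simp] = group_hom.hom_one[OF group_hom_p]

lemma p_tau [simp]: "c \<in> Ob C \<Longrightarrow> e \<in> carrier (fob E c) \<Longrightarrow> p c (\<tau> c e) = \<one>\<^bsub>H\<^esub>"
  using exact[of c] by (auto simp: kernel_def)

lemma tau_cancel: "c \<in> Ob C \<Longrightarrow> e \<in> carrier (fob E c) \<Longrightarrow> e' \<in> carrier (fob E c) \<Longrightarrow> \<tau> c e = \<tau> c e' \<Longrightarrow> e = e'"
  using tau_inj by (auto simp: inj_on_def)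

abbreviation pull where "pull c x \<equiv> inv_into (carrier (fob E c)) (\<tau> c) x"

lemma pull:
  assumes "c \<in> Ob C" "x \<in> carrier (fob F c)" "p c x = \<one>\<^bsub>H\<^esub>"
  shows "pull c x \<in> carrier (fob E c)" "\<tau> c (pull c x) = x"
proof -
  have "x \<in> \<tau> c ` carrier (fob E c)" unfolding exact[OF assms(1)] using assms by (simp add: kernel_def)
  then show "pull c x \<in> carrier (fob E c)" "\<tau> c (pull c x) = x"
    by (simp_all add: inv_into_into f_inv_into_f)
qed

abbreviation conn where "conn \<equiv> lim1_connecting C E F \<tau> p"

text \<open>This and \<open>represents\<close> are the two halves of \<open>lim1_connecting\<close>,
  separated so that the lift x of h and its cocycle a can be varied independently.\<close>

definition lifts where
  "lifts h x \<longleftrightarrow> x \<in> carrier F.families \<and> (\<forall>c\<in>Ob C. p c (x c) = h)"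

definition represents where
  "represents a x \<longleftrightarrow> a \<in> cocycles C E \<and> (\<forall>\<alpha>\<in>Mor C. \<tau> (Cod C \<alpha>) (a \<alpha>) =
     inv\<^bsub>fob F (Cod C \<alpha>)\<^esub> (x (Cod C \<alpha>)) \<otimes>\<^bsub>fob F (Cod C \<alpha>)\<^esub> fmor F \<alpha> (x (Dom C \<alpha>)))"

lemma conn_iff: "a \<in> conn h \<longleftrightarrow> (\<exists>x. lifts h x \<and> represents a x)"
  by (auto simp only: lim1_connecting_def lifts_def represents_def)

lemma lift_exists:
  assumes "h \<in> carrier H" shows "\<exists>x. lifts h x"
proof
  have "h \<in> p c ` carrier (fob F c)" if "c \<in> Ob C" for c using assms p_surj[OF that] by simp
  then show "lifts h (\<lambda>c\<in>Ob C. inv_into (carrier (fob F c)) (p c) h)"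
    by (simp add: lifts_def inv_into_into f_inv_into_f)
qed

text \<open>By exactness each value of a cocycle of F with trivial projection comes from E, and
  injectivity of \<tau> carries the cocycle identity over. It is applied to coboundaries of lifts
  and, for surjectivity, to a twisted cocycle.\<close>

lemma represent_exists:
  assumes x: "x \<in> carrier F.families" and pull0: "\<And>\<alpha>. \<alpha> \<in> Mor C \<Longrightarrow> p (Cod C \<alpha>) (u \<alpha>) = \<one>\<^bsub>H\<^esub>"
    and u: "u \<in> cocycles C F"
  shows "\<exists>a\<in>cocycles C E. \<forall>\<alpha>\<in>Mor C. \<tau> (Cod C \<alpha>) (a \<alpha>) = u \<alpha>"
proof
  define a where "a = (\<lambda>\<alpha>\<in>Mor C. pull (Cod C \<alpha>) (u \<alpha>))"
  note uc = F.cocycle_closed[OF u]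
  have a: "a \<alpha> \<in> carrier (fob E (Cod C \<alpha>))" "\<tau> (Cod C \<alpha>) (a \<alpha>) = u \<alpha>" if "\<alpha> \<in> Mor C" for \<alpha>
    using that pull[OF F.Cod_Ob[OF that] uc[OF that] pull0[OF that]] by (simp_all add: a_def)
  show "a \<in> cocycles C E"
    unfolding cocycles_def
  proof (intro CollectI conjI ballI impI)
    show "a \<in> carrier E.cochains"
      using a(1) by (auto simp: cochain_group_def a_def)
    fix \<alpha> \<beta> assume m: "\<alpha> \<in> Mor C" "\<beta> \<in> Mor C" "Dom C \<alpha> = Cod C \<beta>"
    interpret A: group "fob E (Cod C \<alpha>)" using m by simp
    have m': "Comp C \<alpha> \<beta> \<in> Mor C" "Cod C (Comp C \<alpha> \<beta>) = Cod C \<alpha>" using m by simp_all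
    have fb: "fmor E \<alpha> (a \<beta>) \<in> carrier (fob E (Cod C \<alpha>))"
      using E.fmor_closed[OF m(1)] a(1)[OF m(2)] m(3) by simp
    show "a (Comp C \<alpha> \<beta>) = a \<alpha> \<otimes>\<^bsub>fob E (Cod C \<alpha>)\<^esub> fmor E \<alpha> (a \<beta>)"
    proof (rule tau_cancel)
      show "a (Comp C \<alpha> \<beta>) \<in> carrier (fob E (Cod C \<alpha>))" using a(1)[OF m'(1)] m'(2) by simp
      show "a \<alpha> \<otimes>\<^bsub>fob E (Cod C \<alpha>)\<^esub> fmor E \<alpha> (a \<beta>) \<in> carrier (fob E (Cod C \<alpha>))"
        using a(1)[OF m(1)] fb by simp
      have "\<tau> (Cod C \<alpha>) (a (Comp C \<alpha> \<beta>)) = u \<alpha> \<otimes>\<^bsub>fob F (Cod C \<alpha>)\<^esub> fmor F \<alpha> (u \<beta>)"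
        using a(2)[OF m'(1)] m'(2) F.cocycleD[OF u m] by simp
      also have "\<dots> = \<tau> (Cod C \<alpha>) (a \<alpha>) \<otimes>\<^bsub>fob F (Cod C \<alpha>)\<^esub> \<tau> (Cod C \<alpha>) (fmor E \<alpha> (a \<beta>))"
        using a[OF m(1)] a[OF m(2)] m tau_nat[OF m(1), of "a \<beta>"] by simp
      also have "\<dots> = \<tau> (Cod C \<alpha>) (a \<alpha> \<otimes>\<^bsub>fob E (Cod C \<alpha>)\<^esub> fmor E \<alpha> (a \<beta>))"
        using a(1)[OF m(1)] fb m by simp
      finally show "\<tau> (Cod C \<alpha>) (a (Comp C \<alpha> \<beta>)) = \<tau> (Cod C \<alpha>) (a \<alpha> \<otimes>\<^bsub>fob E (Cod C \<alpha>)\<^esub> fmor E \<alpha> (a \<beta>))" .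
    qed (use m in simp)
  qed
  show "\<forall>\<alpha>\<in>Mor C. \<tau> (Cod C \<alpha>) (a \<alpha>) = u \<alpha>" using a(2) by blast
qed

lemma coboundary_apply:
  assumes "x \<in> carrier F.families" "\<alpha> \<in> Mor C"
  shows "twist C F \<one>\<^bsub>F.cochains\<^esub> x \<alpha> =
    inv\<^bsub>fob F (Cod C \<alpha>)\<^esub> (x (Cod C \<alpha>)) \<otimes>\<^bsub>fob F (Cod C \<alpha>)\<^esub> fmor F \<alpha> (x (Dom C \<alpha>))"
proof -
  interpret A: group "fob F (Cod C \<alpha>)" using assms by simp
  show ?thesis
    using assms(2) F.family_closed[OF assms(1)] by (simp add: F.twist_apply F.cochain_one)
qed

lemma conn_nonempty:
  assumes "lifts h x" "h \<in> carrier H" shows "\<exists>a. represents a x"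
proof -
  have x: "x \<in> carrier F.families" "\<And>c. c \<in> Ob C \<Longrightarrow> p c (x c) = h" using assms(1) by (auto simp only: lifts_def)
  have "\<exists>a\<in>cocycles C E. \<forall>\<alpha>\<in>Mor C. \<tau> (Cod C \<alpha>) (a \<alpha>) = twist C F \<one>\<^bsub>F.cochains\<^esub> x \<alpha>"
  proof (rule represent_exists[OF x(1)])
    show "twist C F \<one>\<^bsub>F.cochains\<^esub> x \<in> cocycles C F" by (rule F.twist_cocycle[OF F.one_cocycle x(1)])
    fix \<alpha> assume \<alpha>: "\<alpha> \<in> Mor C"
    interpret A: group "fob F (Cod C \<alpha>)" using \<alpha> by simp
    show "p (Cod C \<alpha>) (twist C F \<one>\<^bsub>F.cochains\<^esub> x \<alpha>) = \<one>\<^bsub>H\<^esub>"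
      using \<alpha> F.family_closed[OF x(1)] x(2) p_nat[OF \<alpha>] assms(2) by (simp add: coboundary_apply[OF x(1) \<alpha>])
  qed
  then show ?thesis using coboundary_apply[OF x(1)] by (auto simp: represents_def)
qed

text \<open>Two lifts of h differ by a family e of E, multiplied on the right, and passing from one
  to the other twists the cocycle by e. So all lifts together give one orbit, that of any chosen
  representative.\<close>

lemma conn_eq_orbit:
  assumes h: "h \<in> carrier H" and x: "lifts h x" and a: "represents a x"
  shows "conn h = twist_orbit C E a"
proof
  have xF: "x \<in> carrier F.families" "\<And>c. c \<in> Ob C \<Longrightarrow> p c (x c) = h" using x by (auto simp only: lifts_def)
  have aE: "a \<in> cocycles C E" using a by (simp add: represents_def)
  have ta: "\<tau> (Cod C \<alpha>) (a \<alpha>) =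
     inv\<^bsub>fob F (Cod C \<alpha>)\<^esub> (x (Cod C \<alpha>)) \<otimes>\<^bsub>fob F (Cod C \<alpha>)\<^esub> fmor F \<alpha> (x (Dom C \<alpha>))" if "\<alpha> \<in> Mor C" for \<alpha>
    using a that by (simp add: represents_def)
  have main: "\<tau> (Cod C \<alpha>) (twist C E a e \<alpha>) =
      inv\<^bsub>fob F (Cod C \<alpha>)\<^esub> (x (Cod C \<alpha>) \<otimes>\<^bsub>fob F (Cod C \<alpha>)\<^esub> \<tau> (Cod C \<alpha>) (e (Cod C \<alpha>)))
        \<otimes>\<^bsub>fob F (Cod C \<alpha>)\<^esub> fmor F \<alpha> (x (Dom C \<alpha>) \<otimes>\<^bsub>fob F (Dom C \<alpha>)\<^esub> \<tau> (Dom C \<alpha>) (e (Dom C \<alpha>)))"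
    if e: "e \<in> carrier E.families" and \<alpha>: "\<alpha> \<in> Mor C" for e \<alpha>
  proof -
    interpret A: group "fob F (Cod C \<alpha>)" using \<alpha> by simp
    interpret B: group "fob F (Dom C \<alpha>)" using \<alpha> by simp
    interpret A': group "fob E (Cod C \<alpha>)" using \<alpha> by simp
    show ?thesis
      using \<alpha> E.family_closed[OF e] F.family_closed[OF xF(1)] E.cocycle_closed[OF aE \<alpha>]
        tau_nat[OF \<alpha>]
      by (simp add: E.twist_apply ta A.m_assoc A.inv_mult_group)
  qed
  show "twist_orbit C E a \<subseteq> conn h"
  proof
    fix b assume "b \<in> twist_orbit C E a"
    then obtain e where e: "e \<in> carrier E.families" "b = twist C E a e" by (auto simp only: twist_orbit_def)
    define y where "y = (\<lambda>c\<in>Ob C. x c \<otimes>\<^bsub>fob F c\<^esub> \<tau> c (e c))"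
    have "lifts h y"
      unfolding lifts_def
    proof
      show "\<forall>c\<in>Ob C. p c (y c) = h"
      proof
        fix c assume c: "c \<in> Ob C"
        then show "p c (y c) = h"
          using F.family_closed[OF xF(1) c] E.family_closed[OF e(1) c] xF(2)[OF c] h
          by (simp add: y_def)
      qed
      have "x c \<otimes>\<^bsub>fob F c\<^esub> \<tau> c (e c) \<in> carrier (fob F c)" if c: "c \<in> Ob C" for c
      proof -
        interpret A: group "fob F c" using c by simp
        show ?thesis using F.family_closed[OF xF(1) c] E.family_closed[OF e(1) c] c by simp
      qed
      then show "y \<in> carrier F.families" by (simp add: y_def)
    qed
    moreover have "represents b y"
      unfolding represents_def e(2)
    proof
      show "twist C E a e \<in> cocycles C E" by (rule E.twist_cocycle[OF aE e(1)])
      show "\<forall>\<alpha>\<in>Mor C. \<tau> (Cod C \<alpha>) (twist C E a e \<alpha>) =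
          inv\<^bsub>fob F (Cod C \<alpha>)\<^esub> (y (Cod C \<alpha>)) \<otimes>\<^bsub>fob F (Cod C \<alpha>)\<^esub> fmor F \<alpha> (y (Dom C \<alpha>))"
        using main[OF e(1)] by (simp add: y_def)
    qed
    ultimately show "b \<in> conn h" unfolding conn_iff by blast
  qed
  show "conn h \<subseteq> twist_orbit C E a"
  proof
    fix b assume "b \<in> conn h"
    then obtain y where y: "lifts h y" "represents b y" unfolding conn_iff by blast
    have yF: "y \<in> carrier F.families" "\<And>c. c \<in> Ob C \<Longrightarrow> p c (y c) = h" using y by (auto simp only: lifts_def)
    define e where "e = (\<lambda>c\<in>Ob C. pull c (inv\<^bsub>fob F c\<^esub> (x c) \<otimes>\<^bsub>fob F c\<^esub> y c))"
    have e: "e c \<in> carrier (fob E c)" "x c \<otimes>\<^bsub>fob F c\<^esub> \<tau> c (e c) = y c" if c: "c \<in> Ob C" for c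
    proof -
      interpret A: group "fob F c" using c by simp
      have q: "inv\<^bsub>fob F c\<^esub> (x c) \<otimes>\<^bsub>fob F c\<^esub> y c \<in> carrier (fob F c)"
        "p c (inv\<^bsub>fob F c\<^esub> (x c) \<otimes>\<^bsub>fob F c\<^esub> y c) = \<one>\<^bsub>H\<^esub>"
        using F.family_closed[OF xF(1) c] F.family_closed[OF yF(1) c] xF(2)[OF c] yF(2)[OF c] c h by simp_all
      show "e c \<in> carrier (fob E c)" "x c \<otimes>\<^bsub>fob F c\<^esub> \<tau> c (e c) = y c"
        using pull[OF c q] c F.family_closed[OF xF(1) c] F.family_closed[OF yF(1) c] by (simp_all add: e_def)
    qed
    have eE: "e \<in> carrier E.families" using e(1) by (auto simp: e_def)
    have bE: "b \<in> cocycles C E" using y(2) by (simp add: represents_def)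
    have "b = twist C E a e"
    proof (rule E.cochain_eqI[OF E.cocycle_cochain[OF bE] E.cocycle_cochain[OF E.twist_cocycle[OF aE eE]]])
      fix \<alpha> assume \<alpha>: "\<alpha> \<in> Mor C"
      show "b \<alpha> = twist C E a e \<alpha>"
      proof (rule tau_cancel[OF F.Cod_Ob[OF \<alpha>]])
        show "b \<alpha> \<in> carrier (fob E (Cod C \<alpha>))" by (rule E.cocycle_closed[OF bE \<alpha>])
        show "twist C E a e \<alpha> \<in> carrier (fob E (Cod C \<alpha>))"
          by (rule E.cochain_closed[OF E.cocycle_cochain[OF E.twist_cocycle[OF aE eE]] \<alpha>])
        show "\<tau> (Cod C \<alpha>) (b \<alpha>) = \<tau> (Cod C \<alpha>) (twist C E a e \<alpha>)"
          using y(2) \<alpha> by (simp add: main[OF eE \<alpha>] e(2) represents_def)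
      qed
    qed
    then show "b \<in> twist_orbit C E a" unfolding twist_orbit_def using eE by (rule image_eqI)
  qed
qed

lemma conn_lim1: "h \<in> carrier H \<Longrightarrow> conn h \<in> lim1 C E"
  using lift_exists conn_nonempty conn_eq_orbit by (fastforce simp: lim1_def represents_def)

text \<open>The product of lifts of h and k is a lift of their product. The point is that its
  cocycle is the product of the two cocycles.\<close>

proposition group_hom_conn: "group_hom H (lim1_group C E) conn"
proof (intro group_hom.intro group_hom_axioms.intro homI)
  show "group H" by (rule H.is_group)
  show "group (lim1_group C E)" by (rule E.group_lim1_group)
  fix h assume h: "h \<in> carrier H"
  then show "conn h \<in> carrier (lim1_group C E)" using conn_lim1 by (simp add: lim1_group_def)
  fix k assume k: "k \<in> carrier H"
  obtain x a where x: "lifts h x" "represents a x" using lift_exists[OF h] conn_nonempty h by blast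
  obtain y b where y: "lifts k y" "represents b y" using lift_exists[OF k] conn_nonempty k by blast
  have xF: "x \<in> carrier F.families" "\<And>c. c \<in> Ob C \<Longrightarrow> p c (x c) = h" using x by (auto simp only: lifts_def)
  have yF: "y \<in> carrier F.families" "\<And>c. c \<in> Ob C \<Longrightarrow> p c (y c) = k" using y by (auto simp only: lifts_def)
  have ab: "a \<in> cocycles C E" "b \<in> cocycles C E" using x y by (auto simp: represents_def)
  interpret P: group F.families by simp
  have "lifts (h \<otimes>\<^bsub>H\<^esub> k) (x \<otimes>\<^bsub>F.families\<^esub> y)"
    unfolding lifts_def
  proof
    show "x \<otimes>\<^bsub>F.families\<^esub> y \<in> carrier F.families" by (rule P.m_closed[OF xF(1) yF(1)])
    show "\<forall>c\<in>Ob C. p c ((x \<otimes>\<^bsub>F.families\<^esub> y) c) = h \<otimes>\<^bsub>H\<^esub> k"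
      using F.family_closed[OF xF(1)] F.family_closed[OF yF(1)] xF(2) yF(2) by simp
  qed
  moreover have "represents (a \<otimes>\<^bsub>E.cochains\<^esub> b) (x \<otimes>\<^bsub>F.families\<^esub> y)"
    unfolding represents_def
  proof (intro conjI ballI)
    show "a \<otimes>\<^bsub>E.cochains\<^esub> b \<in> cocycles C E" by (rule E.cocycle_mult[OF ab])
    fix \<alpha> assume \<alpha>: "\<alpha> \<in> Mor C"
    interpret A: group "fob F (Cod C \<alpha>)" using \<alpha> by simp
    let ?D = "Cod C \<alpha>"
    note c = F.family_closed[OF xF(1)] F.family_closed[OF yF(1)] E.cocycle_closed[OF ab(1) \<alpha>]
      E.cocycle_closed[OF ab(2) \<alpha>]
    have "\<tau> ?D ((a \<otimes>\<^bsub>E.cochains\<^esub> b) \<alpha>) = \<tau> ?D (a \<alpha>) \<otimes>\<^bsub>fob F ?D\<^esub> \<tau> ?D (b \<alpha>)"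
      using \<alpha> c by (simp add: E.cochain_mult)
    also have "\<tau> ?D (b \<alpha>) = inv\<^bsub>fob F ?D\<^esub> (y ?D) \<otimes>\<^bsub>fob F ?D\<^esub> fmor F \<alpha> (y (Dom C \<alpha>))"
      using y(2) \<alpha> by (simp add: represents_def)
    \<comment> \<open>Centrality enters here. In the cocycle of the product of the lifts,
      \<open>\<tau> (a \<alpha>)\<close> stands to the right of the inverse of y; in the product of
      the cocycles it stands to the left.\<close>
    also have "\<tau> ?D (a \<alpha>) \<otimes>\<^bsub>fob F ?D\<^esub> (inv\<^bsub>fob F ?D\<^esub> (y ?D) \<otimes>\<^bsub>fob F ?D\<^esub> fmor F \<alpha> (y (Dom C \<alpha>))) =
      inv\<^bsub>fob F ?D\<^esub> (y ?D) \<otimes>\<^bsub>fob F ?D\<^esub> \<tau> ?D (a \<alpha>) \<otimes>\<^bsub>fob F ?D\<^esub> fmor F \<alpha> (y (Dom C \<alpha>))"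
      using central[of ?D "a \<alpha>" "inv\<^bsub>fob F ?D\<^esub> (y ?D)"] \<alpha> c by (simp add: A.m_assoc[symmetric])
    also have "\<tau> ?D (a \<alpha>) = inv\<^bsub>fob F ?D\<^esub> (x ?D) \<otimes>\<^bsub>fob F ?D\<^esub> fmor F \<alpha> (x (Dom C \<alpha>))"
      using x(2) \<alpha> by (simp add: represents_def)
    finally show "\<tau> ?D ((a \<otimes>\<^bsub>E.cochains\<^esub> b) \<alpha>) = inv\<^bsub>fob F ?D\<^esub> ((x \<otimes>\<^bsub>F.families\<^esub> y) ?D) \<otimes>\<^bsub>fob F ?D\<^esub>
        fmor F \<alpha> ((x \<otimes>\<^bsub>F.families\<^esub> y) (Dom C \<alpha>))"
      using \<alpha> c by (simp add: A.m_assoc A.inv_mult_group)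
  qed
  ultimately have "conn (h \<otimes>\<^bsub>H\<^esub> k) = twist_orbit C E (a \<otimes>\<^bsub>E.cochains\<^esub> b)"
    using conn_eq_orbit h k by simp
  also have "\<dots> = conn h \<otimes>\<^bsub>lim1_group C E\<^esub> conn k"
    using conn_eq_orbit[OF h x] conn_eq_orbit[OF k y] E.twist_orbit_mult ab E.cocycle_cochain
    by (simp add: lim1_group_def)
  finally show "conn (h \<otimes>\<^bsub>H\<^esub> k) = conn h \<otimes>\<^bsub>lim1_group C E\<^esub> conn k" .
qed

text \<open>The connecting class is trivial exactly when the trivial cocycle is itself represented
  by some lift of h, and a lift has trivial cocycle exactly when it is compatible along all
  morphisms, that is, a point of the limit.\<close>

proposition kernel_conn:
  "kernel H (lim1_group C E) conn =
    {h \<in> carrier H. \<exists>x\<in>carrier (lim_group C F). \<forall>c\<in>Ob C. p c (x c) = h}"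
proof -
  have "conn h = lim1_point C E \<longleftrightarrow> (\<exists>x\<in>carrier (lim_group C F). \<forall>c\<in>Ob C. p c (x c) = h)"
    if h: "h \<in> carrier H" for h
  proof -
    have rep: "represents \<one>\<^bsub>E.cochains\<^esub> x \<longleftrightarrow> (\<forall>\<alpha>\<in>Mor C. fmor F \<alpha> (x (Dom C \<alpha>)) = x (Cod C \<alpha>))"
      if "lifts h x" for x
    proof -
      have x: "x \<in> carrier F.families" using that by (simp only: lifts_def)
      have "\<tau> (Cod C \<alpha>) (\<one>\<^bsub>E.cochains\<^esub> \<alpha>) =
          inv\<^bsub>fob F (Cod C \<alpha>)\<^esub> (x (Cod C \<alpha>)) \<otimes>\<^bsub>fob F (Cod C \<alpha>)\<^esub> fmor F \<alpha> (x (Dom C \<alpha>)) \<longleftrightarrow>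
          fmor F \<alpha> (x (Dom C \<alpha>)) = x (Cod C \<alpha>)" if \<alpha>: "\<alpha> \<in> Mor C" for \<alpha>
      proof -
        interpret A: group "fob F (Cod C \<alpha>)" using \<alpha> by simp
        have c: "x (Cod C \<alpha>) \<in> carrier (fob F (Cod C \<alpha>))" "fmor F \<alpha> (x (Dom C \<alpha>)) \<in> carrier (fob F (Cod C \<alpha>))"
          using F.family_closed[OF x] \<alpha> by simp_all
        show ?thesis using \<alpha> c A.inv_solve_left[OF A.one_closed c(1) c(2)] by (auto simp: E.cochain_one)
      qed
      then show ?thesis using E.one_cocycle by (simp add: represents_def)
    qed
    have "conn h = lim1_point C E \<longleftrightarrow> \<one>\<^bsub>E.cochains\<^esub> \<in> conn h"
    proof
      assume "conn h = lim1_point C E"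
      then show "\<one>\<^bsub>E.cochains\<^esub> \<in> conn h"
        using E.twist_orbit_refl[OF E.cocycle_cochain[OF E.one_cocycle]] by (simp add: lim1_point_def)
    next
      assume "\<one>\<^bsub>E.cochains\<^esub> \<in> conn h"
      then show "conn h = lim1_point C E"
        using conn_eq_orbit[OF h] unfolding conn_iff lim1_point_def by blast
    qed
    also have "\<dots> \<longleftrightarrow> (\<exists>x. lifts h x \<and> (\<forall>\<alpha>\<in>Mor C. fmor F \<alpha> (x (Dom C \<alpha>)) = x (Cod C \<alpha>)))"
      unfolding conn_iff using rep by blast
    finally show ?thesis by (auto simp: lim_group_def lifts_def)
  qed
  then show ?thesis by (auto simp: kernel_def lim1_group_def)
qed

abbreviation tau_map where "tau_map a \<equiv> (\<lambda>\<alpha>\<in>Mor C. \<tau> (Cod C \<alpha>) (a \<alpha>))"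

lemma tau_cocycle:
  assumes a: "a \<in> cocycles C E" shows "tau_map a \<in> cocycles C F"
  unfolding cocycles_def
proof (intro CollectI conjI ballI impI)
  note c = E.cocycle_closed[OF a]
  show "tau_map a \<in> carrier F.cochains" using c by (auto simp: cochain_group_def)
  fix \<alpha> \<beta> assume m: "\<alpha> \<in> Mor C" "\<beta> \<in> Mor C" "Dom C \<alpha> = Cod C \<beta>"
  have "a \<beta> \<in> carrier (fob E (Dom C \<alpha>))" using c[OF m(2)] m(3) by simp
  then show "tau_map a (Comp C \<alpha> \<beta>) = tau_map a \<alpha> \<otimes>\<^bsub>fob F (Cod C \<alpha>)\<^esub> fmor F \<alpha> (tau_map a \<beta>)"
    using m c[OF m(1)] E.fmor_closed[OF m(1)] tau_nat[OF m(1)] by (simp add: E.cocycleD[OF a])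
qed

lemma tau_twist:
  assumes a: "a \<in> cocycles C E" and e: "e \<in> carrier E.families"
  shows "tau_map (twist C E a e) \<in> twist_orbit C F (tau_map a)"
proof -
  define f where "f = (\<lambda>c\<in>Ob C. \<tau> c (e c))"
  have f: "f \<in> carrier F.families" using E.family_closed[OF e] by (auto simp: f_def)
  have "tau_map (twist C E a e) = twist C F (tau_map a) f"
  proof (rule F.cochain_eqI)
    show "tau_map (twist C E a e) \<in> carrier F.cochains"
      by (rule F.cocycle_cochain[OF tau_cocycle[OF E.twist_cocycle[OF a e]]])
    show "twist C F (tau_map a) f \<in> carrier F.cochains"
      by (rule F.twist_closed[OF F.cocycle_cochain[OF tau_cocycle[OF a]] f])
    fix \<alpha> assume \<alpha>: "\<alpha> \<in> Mor C"
    interpret A: group "fob E (Cod C \<alpha>)" using \<alpha> by simp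
    show "tau_map (twist C E a e) \<alpha> = twist C F (tau_map a) f \<alpha>"
      using \<alpha> E.cocycle_closed[OF a \<alpha>] E.family_closed[OF e] tau_nat[OF \<alpha>]
      by (simp add: E.twist_apply F.twist_apply f_def)
  qed
  then show ?thesis unfolding twist_orbit_def using f by (rule image_eqI)
qed

text \<open>Twisting by e before applying \<tau> amounts to twisting by the image of e afterwards,
  so all members of the union in \<open>lim1_map\<close> coincide.\<close>

lemma lim1_map_orbit:
  assumes a: "a \<in> cocycles C E"
  shows "lim1_map C F \<tau> (twist_orbit C E a) = twist_orbit C F (tau_map a)"
proof -
  have "twist_orbit C F (tau_map b) = twist_orbit C F (tau_map a)" if b: "b \<in> twist_orbit C E a" for b
  proof -
    obtain e where "e \<in> carrier E.families" "b = twist C E a e" using b by (auto simp only: twist_orbit_def)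
    then show ?thesis
      using F.twist_orbit_eq[OF F.cocycle_cochain[OF tau_cocycle[OF a]]] tau_twist[OF a] by blast
  qed
  moreover have "a \<in> twist_orbit C E a" by (rule E.twist_orbit_refl[OF E.cocycle_cochain[OF a]])
  ultimately show ?thesis unfolding lim1_map_def by blast
qed

proposition lim1_map_closed: "lim1_map C F \<tau> \<in> lim1 C E \<rightarrow> lim1 C F"
  using lim1_map_orbit tau_cocycle by (auto simp: lim1_def)

proposition lim1_map_point: "lim1_map C F \<tau> (lim1_point C E) = lim1_point C F"
proof -
  have "tau_map \<one>\<^bsub>E.cochains\<^esub> = \<one>\<^bsub>F.cochains\<^esub>"
    by (auto simp: E.cochain_one F.cochain_one)
  then show ?thesis unfolding lim1_point_def lim1_map_orbit[OF E.one_cocycle] by simp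
qed

text \<open>If the image of a in F is the coboundary of a family x, then p kills it, so p of x does
  not change along morphisms. By connectedness it is one element h; then x lifts h with cocycle a.
  Conversely, the cocycle of a lift becomes its coboundary in F.\<close>

proposition image_conn:
  "conn ` carrier H = {A \<in> lim1 C E. lim1_map C F \<tau> A = lim1_point C F}"
proof
  show "conn ` carrier H \<subseteq> {A \<in> lim1 C E. lim1_map C F \<tau> A = lim1_point C F}"
  proof
    fix A assume "A \<in> conn ` carrier H"
    then obtain h where h: "h \<in> carrier H" "A = conn h" by blast
    obtain x a where x: "lifts h x" "represents a x" using lift_exists[OF h(1)] conn_nonempty h by blast
    have xF: "x \<in> carrier F.families" using x by (simp only: lifts_def)
    have a: "a \<in> cocycles C E" using x by (simp add: represents_def)
    have "tau_map a = twist C F \<one>\<^bsub>F.cochains\<^esub> x"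
      by (rule F.cochain_eqI[OF F.cocycle_cochain[OF tau_cocycle[OF a]] F.cocycle_cochain[OF F.twist_cocycle[OF F.one_cocycle xF]]])
         (use x(2) in \<open>simp add: coboundary_apply[OF xF] represents_def\<close>)
    then have "twist_orbit C F (tau_map a) = lim1_point C F"
      using F.twist_orbit_twist[OF F.cocycle_cochain[OF F.one_cocycle] xF] by (simp add: lim1_point_def)
    then show "A \<in> {A \<in> lim1 C E. lim1_map C F \<tau> A = lim1_point C F}"
      using h conn_lim1[OF h(1)] conn_eq_orbit[OF h(1) x] lim1_map_orbit[OF a] by simp
  qed
  show "{A \<in> lim1 C E. lim1_map C F \<tau> A = lim1_point C F} \<subseteq> conn ` carrier H"
  proof
    fix A assume "A \<in> {A \<in> lim1 C E. lim1_map C F \<tau> A = lim1_point C F}"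
    then obtain a where a: "a \<in> cocycles C E" "A = twist_orbit C E a" "lim1_map C F \<tau> A = lim1_point C F"
      by (auto simp: lim1_def)
    then have "tau_map a \<in> twist_orbit C F \<one>\<^bsub>F.cochains\<^esub>"
      using F.twist_orbit_refl[OF F.cocycle_cochain[OF tau_cocycle[OF a(1)]]] lim1_map_orbit[OF a(1)]
      by (simp add: lim1_point_def)
    then obtain x where x: "x \<in> carrier F.families" "tau_map a = twist C F \<one>\<^bsub>F.cochains\<^esub> x"
      by (auto simp only: twist_orbit_def)
    have t: "\<tau> (Cod C \<alpha>) (a \<alpha>) =
       inv\<^bsub>fob F (Cod C \<alpha>)\<^esub> (x (Cod C \<alpha>)) \<otimes>\<^bsub>fob F (Cod C \<alpha>)\<^esub> fmor F \<alpha> (x (Dom C \<alpha>))" if \<alpha>: "\<alpha> \<in> Mor C" for \<alpha>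
      using fun_cong[OF x(2), of \<alpha>] coboundary_apply[OF x(1) \<alpha>] \<alpha> by simp
    have pe: "p (Cod C \<alpha>) (x (Cod C \<alpha>)) = p (Dom C \<alpha>) (x (Dom C \<alpha>))" if \<alpha>: "\<alpha> \<in> Mor C" for \<alpha>
    proof -
      interpret A: group "fob F (Cod C \<alpha>)" using \<alpha> by simp
      note c = F.family_closed[OF x(1) F.Cod_Ob[OF \<alpha>]] F.family_closed[OF x(1) F.Dom_Ob[OF \<alpha>]]
      have "p (Cod C \<alpha>) (\<tau> (Cod C \<alpha>) (a \<alpha>)) = \<one>\<^bsub>H\<^esub>"
        using \<alpha> E.cocycle_closed[OF a(1) \<alpha>] by simp
      then have "inv\<^bsub>H\<^esub> p (Cod C \<alpha>) (x (Cod C \<alpha>)) \<otimes>\<^bsub>H\<^esub> p (Dom C \<alpha>) (x (Dom C \<alpha>)) = \<one>\<^bsub>H\<^esub>"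
        using c \<alpha> p_nat[OF \<alpha> c(2)] by (simp add: t)
      then show ?thesis using c \<alpha> by (metis H.inv_cancel(2) H.r_one p_closed F.Cod_Ob F.Dom_Ob)
    qed
    obtain c0 where c0: "c0 \<in> Ob C" using Ob_nonempty by blast
    define h where "h = p c0 (x c0)"
    have h: "h \<in> carrier H" using F.family_closed[OF x(1) c0] c0 by (simp add: h_def)
    have "p c (x c) = h" if "c \<in> Ob C" for c
      using connected[OF c0 that] pe by (auto simp: h_def)
    then have "lifts h x" using x(1) by (simp only: lifts_def) blast
    moreover have "represents a x" using a(1) t by (simp add: represents_def)
    ultimately have "A = conn h" using conn_eq_orbit[OF h] a(2) by simp
    then show "A \<in> conn ` carrier H" using h by blast
  qed
qed

text \<open>The projection of a cocycle b of F is a cocycle in the constant group H, hence comes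
  from a potential k. Twisting b by a lift y of k makes this projection trivial without leaving the
  orbit, and the twisted cocycle is then pulled back to E.\<close>

proposition lim1_map_surj: "lim1_map C F \<tau> ` lim1 C E = lim1 C F"
proof
  show "lim1_map C F \<tau> ` lim1 C E \<subseteq> lim1 C F" using lim1_map_closed by blast
  show "lim1 C F \<subseteq> lim1_map C F \<tau> ` lim1 C E"
  proof
    fix B assume "B \<in> lim1 C F"
    then obtain b where b: "b \<in> cocycles C F" "B = twist_orbit C F b" by (auto simp: lim1_def)
    note bc = F.cocycle_closed[OF b(1)]
    have "\<exists>k. (\<forall>c\<in>Ob C. k c \<in> carrier H) \<and>
      (\<forall>\<alpha>\<in>Mor C. p (Cod C \<alpha>) (b \<alpha>) = k (Cod C \<alpha>) \<otimes>\<^bsub>H\<^esub> inv\<^bsub>H\<^esub> k (Dom C \<alpha>))"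
    proof (rule constant_cocycles)
      show "p (Cod C \<alpha>) (b \<alpha>) \<in> carrier H" if "\<alpha> \<in> Mor C" for \<alpha> using bc that by simp
      fix \<alpha> \<beta> assume m: "\<alpha> \<in> Mor C" "\<beta> \<in> Mor C" "Dom C \<alpha> = Cod C \<beta>"
      have "b \<beta> \<in> carrier (fob F (Dom C \<alpha>))" using bc m by simp
      then show "p (Cod C (Comp C \<alpha> \<beta>)) (b (Comp C \<alpha> \<beta>)) = p (Cod C \<alpha>) (b \<alpha>) \<otimes>\<^bsub>H\<^esub> p (Cod C \<beta>) (b \<beta>)"
        using m bc[OF m(1)] F.fmor_closed[OF m(1)] p_nat[OF m(1)] by (simp add: F.cocycleD[OF b(1)])
    qed
    then obtain k where k: "\<And>c. c \<in> Ob C \<Longrightarrow> k c \<in> carrier H"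
      "\<And>\<alpha>. \<alpha> \<in> Mor C \<Longrightarrow> p (Cod C \<alpha>) (b \<alpha>) = k (Cod C \<alpha>) \<otimes>\<^bsub>H\<^esub> inv\<^bsub>H\<^esub> k (Dom C \<alpha>)" by blast
    define y where "y = (\<lambda>c\<in>Ob C. inv_into (carrier (fob F c)) (p c) (k c))"
    have y: "y c \<in> carrier (fob F c)" "p c (y c) = k c" if c: "c \<in> Ob C" for c
    proof -
      have "k c \<in> p c ` carrier (fob F c)" using k(1) p_surj c by simp
      then show "y c \<in> carrier (fob F c)" "p c (y c) = k c"
        using c by (simp_all add: y_def inv_into_into f_inv_into_f)
    qed
    have yF: "y \<in> carrier F.families" using y(1) by (auto simp: y_def)
    have "\<exists>a\<in>cocycles C E. \<forall>\<alpha>\<in>Mor C. \<tau> (Cod C \<alpha>) (a \<alpha>) = twist C F b y \<alpha>"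
    proof (rule represent_exists[OF yF _ F.twist_cocycle[OF b(1) yF]])
      fix \<alpha> assume \<alpha>: "\<alpha> \<in> Mor C"
      interpret A: group "fob F (Cod C \<alpha>)" using \<alpha> by simp
      show "p (Cod C \<alpha>) (twist C F b y \<alpha>) = \<one>\<^bsub>H\<^esub>"
        using \<alpha> bc y k p_nat[OF \<alpha>] by (simp add: F.twist_apply H.m_assoc)
    qed
    then obtain a where a: "a \<in> cocycles C E" "\<And>\<alpha>. \<alpha> \<in> Mor C \<Longrightarrow> \<tau> (Cod C \<alpha>) (a \<alpha>) = twist C F b y \<alpha>" by blast
    have "tau_map a = twist C F b y"
      by (rule F.cochain_eqI[OF F.cocycle_cochain[OF tau_cocycle[OF a(1)]] F.cocycle_cochain[OF F.twist_cocycle[OF b(1) yF]]])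
         (use a(2) in simp)
    then have "lim1_map C F \<tau> (twist_orbit C E a) = B"
      using lim1_map_orbit[OF a(1)] F.twist_orbit_twist[OF F.cocycle_cochain[OF b(1)] yF] b(2) by simp
    then show "B \<in> lim1_map C F \<tau> ` lim1 C E" using a(1) by (auto simp: lim1_def)
  qed
qed

end

section \<open>Cosets and subquotients\<close>

context group
begin

lemma r_coset_eq_iff:
  assumes "subgroup N G" "x \<in> carrier G" "y \<in> carrier G"
  shows "N #> x = N #> y \<longleftrightarrow> x \<otimes> inv y \<in> N"
proof
  assume "N #> x = N #> y"
  then have "x \<in> N #> y" using rcos_self[OF assms(2,1)] by simp
  then obtain n where "n \<in> N" "x = n \<otimes> y" by (auto simp: r_coset_def)
  moreover then have "n \<in> carrier G" using subgroup.subset[OF assms(1)] by auto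
  ultimately show "x \<otimes> inv y \<in> N" using assms by (simp add: m_assoc)
next
  assume "x \<otimes> inv y \<in> N"
  moreover have "x = x \<otimes> inv y \<otimes> y" using assms by (simp add: m_assoc)
  ultimately have "x \<in> N #> y" unfolding r_coset_def by blast
  then show "N #> x = N #> y" using repr_independence assms by metis
qed

lemma carrier_subquotient: "carrier ((G\<lparr>carrier := U\<rparr>) Mod N) = (\<lambda>x. N #> x) ` U"
  by (simp add: carrier_FactGroup r_coset_def)

lemma mult_subquotient:
  "N \<lhd> G \<Longrightarrow> x \<in> carrier G \<Longrightarrow> y \<in> carrier G \<Longrightarrow>
    (N #> x) \<otimes>\<^bsub>(G\<lparr>carrier := U\<rparr>) Mod N\<^esub> (N #> y) = N #> (x \<otimes> y)"
  using normal.rcos_sum[of N G x y] by (simp add: set_mult_def)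

lemma group_subquotient:
  "subgroup U G \<Longrightarrow> N \<lhd> G \<Longrightarrow> N \<subseteq> U \<Longrightarrow> group ((G\<lparr>carrier := U\<rparr>) Mod N)"
  by (rule normal.factorgroup_is_group[OF normal_restrict_supergroup])

lemma inv_subquotient:
  assumes "subgroup U G" "N \<lhd> G" "N \<subseteq> U" "x \<in> U"
  shows "inv\<^bsub>(G\<lparr>carrier := U\<rparr>) Mod N\<^esub> (N #> x) = N #> inv x"
proof (rule group.inv_equality[OF group_subquotient[OF assms(1-3)]])
  have x: "x \<in> carrier G" "inv x \<in> U"
    using subgroup.subset[OF assms(1)] subgroup.m_inv_closed[OF assms(1)] assms(4) by auto
  show "N #> x \<in> carrier ((G\<lparr>carrier := U\<rparr>) Mod N)" "N #> inv x \<in> carrier ((G\<lparr>carrier := U\<rparr>) Mod N)"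
    using x assms(4) by (simp_all add: carrier_subquotient)
  show "(N #> inv x) \<otimes>\<^bsub>(G\<lparr>carrier := U\<rparr>) Mod N\<^esub> (N #> x) = \<one>\<^bsub>(G\<lparr>carrier := U\<rparr>) Mod N\<^esub>"
    using mult_subquotient[OF assms(2), of "inv x" x U] x subgroup.subset[OF normal_imp_subgroup[OF assms(2)]]
    by (simp add: coset_mult_one)
qed

end

text \<open>The morphism part of \<open>subquotient_functor\<close>, \<open>proj_quot\<close> and
  \<open>incl_quot\<close> are all defined as such products of sets. This evaluates them on
  cosets.\<close>

lemma (in group_hom) r_coset_image:
  assumes "subgroup N G" "subgroup N' H" "h ` N \<subseteq> N'" "x \<in> carrier G"
  shows "N' <#>\<^bsub>H\<^esub> (h ` (N #> x)) = N' #>\<^bsub>H\<^esub> h x"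
proof
  note c = subgroup.subset[OF assms(1)] subgroup.subset[OF assms(2)]
  show "N' <#>\<^bsub>H\<^esub> (h ` (N #> x)) \<subseteq> N' #>\<^bsub>H\<^esub> h x"
  proof
    fix z assume "z \<in> N' <#>\<^bsub>H\<^esub> (h ` (N #> x))"
    then obtain n' n where n: "n' \<in> N'" "n \<in> N" "z = n' \<otimes>\<^bsub>H\<^esub> h (n \<otimes> x)"
      by (auto simp: set_mult_def r_coset_def)
    then have "z = (n' \<otimes>\<^bsub>H\<^esub> h n) \<otimes>\<^bsub>H\<^esub> h x" using c assms(4) by (simp add: H.m_assoc subset_iff)
    moreover have "n' \<otimes>\<^bsub>H\<^esub> h n \<in> N'" using n assms(3) subgroup.m_closed[OF assms(2)] by blast
    ultimately show "z \<in> N' #>\<^bsub>H\<^esub> h x" unfolding r_coset_def by blast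
  qed
  show "N' #>\<^bsub>H\<^esub> h x \<subseteq> N' <#>\<^bsub>H\<^esub> (h ` (N #> x))"
  proof
    fix z assume "z \<in> N' #>\<^bsub>H\<^esub> h x"
    then obtain n' where "n' \<in> N'" "z = n' \<otimes>\<^bsub>H\<^esub> h x" by (auto simp: r_coset_def)
    then show "z \<in> N' <#>\<^bsub>H\<^esub> (h ` (N #> x))"
      using G.rcos_self[OF assms(4,1)] unfolding set_mult_def by blast
  qed
qed

section \<open>Presentations, their morphisms, and functors of subquotients\<close>

lemma Pres_simps [simp]:
  "Ob (Pres T G) = presentations G" "Mor (Pres T G) = pres_mors G"
  "Dom (Pres T G) = pdom" "Cod (Pres T G) = pcod"
  "Comp (Pres T G) \<alpha> \<beta> =
     \<lparr>pdom = pdom \<beta>, pcod = pcod \<alpha>, pmap = compose (carrier (fgrp (pdom \<beta>))) (pmap \<alpha>) (pmap \<beta>)\<rparr>"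
  by (simp_all add: Pres_def)

lemma presentation_epi:
  assumes "group G" "c \<in> presentations G"
  shows "group_ring_epi (fgrp c) G (proj c)"
  using assms
  by (auto simp: group_ring_epi_def group_ring_hom_def group_ring_epi_axioms_def group_hom_def
      group_hom_axioms_def integral_group_ring_def presentations_def free_group_def epi_def)

lemma pres_mor_hom:
  assumes "\<alpha> \<in> pres_mors G"
  shows "group_ring_hom (fgrp (pdom \<alpha>)) (fgrp (pcod \<alpha>)) (pmap \<alpha>)"
  using assms
  by (auto simp: group_ring_hom_def group_hom_def
      group_hom_axioms_def integral_group_ring_def presentations_def free_group_def pres_mors_def)

lemma pres_mor_group_hom: "\<alpha> \<in> pres_mors G \<Longrightarrow> group_hom (fgrp (pdom \<alpha>)) (fgrp (pcod \<alpha>)) (pmap \<alpha>)"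
  using pres_mor_hom group_ring_hom.axioms(1) by blast

lemma pres_mor_proj:
  "\<alpha> \<in> pres_mors G \<Longrightarrow> x \<in> carrier (fgrp (pdom \<alpha>)) \<Longrightarrow> proj (pcod \<alpha>) (pmap \<alpha> x) = proj (pdom \<alpha>) x"
  by (simp add: pres_mors_def)

lemma pres_mor_ends:
  "\<alpha> \<in> pres_mors G \<Longrightarrow> pdom \<alpha> \<in> presentations G" "\<alpha> \<in> pres_mors G \<Longrightarrow> pcod \<alpha> \<in> presentations G"
  by (simp_all add: pres_mors_def)

lemma presentation_group: "c \<in> presentations G \<Longrightarrow> group (fgrp c)"
  by (simp add: presentations_def free_group_def)

lemma pres_mor_comp:
  assumes "\<alpha> \<in> pres_mors G" "\<beta> \<in> pres_mors G" "pdom \<alpha> = pcod \<beta>"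
  shows "Comp (Pres T G) \<alpha> \<beta> \<in> pres_mors G"
proof -
  interpret a: group_hom "fgrp (pdom \<alpha>)" "fgrp (pcod \<alpha>)" "pmap \<alpha>" by (rule pres_mor_group_hom[OF assms(1)])
  interpret b: group_hom "fgrp (pdom \<beta>)" "fgrp (pcod \<beta>)" "pmap \<beta>" by (rule pres_mor_group_hom[OF assms(2)])
  have m: "pmap \<beta> x \<in> carrier (fgrp (pdom \<alpha>))" if "x \<in> carrier (fgrp (pdom \<beta>))" for x
    using assms(3) b.hom_closed[OF that] by simp
  have "compose (carrier (fgrp (pdom \<beta>))) (pmap \<alpha>) (pmap \<beta>) \<in> hom (fgrp (pdom \<beta>)) (fgrp (pcod \<alpha>))"
  proof (rule homI)
    fix x y assume x: "x \<in> carrier (fgrp (pdom \<beta>))" and y: "y \<in> carrier (fgrp (pdom \<beta>))"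
    show "compose (carrier (fgrp (pdom \<beta>))) (pmap \<alpha>) (pmap \<beta>) x \<in> carrier (fgrp (pcod \<alpha>))"
      using x m[OF x] by (simp add: compose_def)
    show "compose (carrier (fgrp (pdom \<beta>))) (pmap \<alpha>) (pmap \<beta>) (x \<otimes>\<^bsub>fgrp (pdom \<beta>)\<^esub> y) =
        compose (carrier (fgrp (pdom \<beta>))) (pmap \<alpha>) (pmap \<beta>) x \<otimes>\<^bsub>fgrp (pcod \<alpha>)\<^esub>
        compose (carrier (fgrp (pdom \<beta>))) (pmap \<alpha>) (pmap \<beta>) y"
      using x y m[OF x] m[OF y] a.hom_mult[of "pmap \<beta> x" "pmap \<beta> y"] assms(3) by (simp add: compose_def)
  qed
  moreover have "proj (pcod \<alpha>) (pmap \<alpha> (pmap \<beta> x)) = proj (pdom \<beta>) x" if "x \<in> carrier (fgrp (pdom \<beta>))" for x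
    using pres_mor_proj[OF assms(1) m[OF that]] pres_mor_proj[OF assms(2) that] assms(3) by simp
  ultimately show ?thesis
    using pres_mor_ends[OF assms(1)] pres_mor_ends[OF assms(2)]
    by (simp add: pres_mors_def compose_def)
qed

lemma fob_subquotient [simp]: "fob (subquotient_functor U N) c = ((fgrp c)\<lparr>carrier := U c\<rparr>) Mod (N c)"
  by (simp add: subquotient_functor_def)

lemma fmor_subquotient:
  assumes "\<alpha> \<in> pres_mors G" "subgroup (N (pdom \<alpha>)) (fgrp (pdom \<alpha>))" "subgroup (N (pcod \<alpha>)) (fgrp (pcod \<alpha>))"
    "pmap \<alpha> ` N (pdom \<alpha>) \<subseteq> N (pcod \<alpha>)" "x \<in> carrier (fgrp (pdom \<alpha>))"
  shows "fmor (subquotient_functor U N) \<alpha> (N (pdom \<alpha>) #>\<^bsub>fgrp (pdom \<alpha>)\<^esub> x) =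
    N (pcod \<alpha>) #>\<^bsub>fgrp (pcod \<alpha>)\<^esub> pmap \<alpha> x"
  using group_hom.r_coset_image[OF pres_mor_group_hom[OF assms(1)] assms(2-5)]
  by (simp add: subquotient_functor_def)

proposition subquotient_functor:
  fixes G :: "'a monoid" and T :: "'f itself"
  assumes U: "\<And>c :: ('f, 'a) presentation. c \<in> presentations G \<Longrightarrow> subgroup (U c) (fgrp c)"
    and N: "\<And>c. c \<in> presentations G \<Longrightarrow> N c \<lhd> fgrp c" "\<And>c. c \<in> presentations G \<Longrightarrow> N c \<subseteq> U c"
    and mU: "\<And>\<alpha>. \<alpha> \<in> pres_mors G \<Longrightarrow> pmap \<alpha> ` U (pdom \<alpha>) \<subseteq> U (pcod \<alpha>)"
    and mN: "\<And>\<alpha>. \<alpha> \<in> pres_mors G \<Longrightarrow> pmap \<alpha> ` N (pdom \<alpha>) \<subseteq> N (pcod \<alpha>)"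
  shows "group_valued_functor (Pres T G) (subquotient_functor U N)"
proof (rule group_valued_functor.intro, unfold Pres_simps(1-4) fob_subquotient)
  have sN: "subgroup (N c) (fgrp c)" if "c \<in> presentations G" for c
    using N(1)[OF that] by (rule normal_imp_subgroup)
  have fm: "fmor (subquotient_functor U N) \<alpha> (N (pdom \<alpha>) #>\<^bsub>fgrp (pdom \<alpha>)\<^esub> x) =
      N (pcod \<alpha>) #>\<^bsub>fgrp (pcod \<alpha>)\<^esub> pmap \<alpha> x" if "\<alpha> \<in> pres_mors G" "x \<in> U (pdom \<alpha>)" for \<alpha> x
    by (rule fmor_subquotient[OF that(1) sN sN mN])
       (use that pres_mor_ends subgroup.subset[OF U] in blast)+
  show "pdom \<alpha> \<in> presentations G" "pcod \<alpha> \<in> presentations G" if "\<alpha> \<in> pres_mors G" for \<alpha> :: "('f, 'a) pres_mor"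
    using pres_mor_ends[OF that] .
  show "Comp (Pres T G) \<alpha> \<beta> \<in> pres_mors G" if "\<alpha> \<in> pres_mors G" "\<beta> \<in> pres_mors G" "pdom \<alpha> = pcod \<beta>" for \<alpha> \<beta>
    using pres_mor_comp[OF that] .
  show "pdom (Comp (Pres T G) \<alpha> \<beta>) = pdom \<beta>"
    if "\<alpha> \<in> pres_mors G" "\<beta> \<in> pres_mors G" "pdom \<alpha> = pcod \<beta>" for \<alpha> \<beta>
    by simp
  show "pcod (Comp (Pres T G) \<alpha> \<beta>) = pcod \<alpha>"
    if "\<alpha> \<in> pres_mors G" "\<beta> \<in> pres_mors G" "pdom \<alpha> = pcod \<beta>" for \<alpha> \<beta>
    by simp
  show "group ((fgrp c)\<lparr>carrier := U c\<rparr> Mod N c)" if "c \<in> presentations G" for c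
    using group.group_subquotient[OF presentation_group[OF that] U N] that by blast
  show "fmor (subquotient_functor U N) \<alpha> \<in> hom ((fgrp (pdom \<alpha>))\<lparr>carrier := U (pdom \<alpha>)\<rparr> Mod N (pdom \<alpha>))
      ((fgrp (pcod \<alpha>))\<lparr>carrier := U (pcod \<alpha>)\<rparr> Mod N (pcod \<alpha>))" if a: "\<alpha> \<in> pres_mors G" for \<alpha>
  proof -
    interpret a: group_hom "fgrp (pdom \<alpha>)" "fgrp (pcod \<alpha>)" "pmap \<alpha>" by (rule pres_mor_group_hom[OF a])
    note e = pres_mor_ends[OF a]
    have uc: "x \<in> carrier (fgrp (pdom \<alpha>))" if "x \<in> U (pdom \<alpha>)" for x
      using subgroup.subset[OF U[OF e(1)]] that by blast
    have mu: "pmap \<alpha> x \<in> U (pcod \<alpha>)" if "x \<in> U (pdom \<alpha>)" for x using mU[OF a] that by blast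
    show ?thesis
    proof (rule homI)
      fix Q1 Q2 assume "Q1 \<in> carrier ((fgrp (pdom \<alpha>))\<lparr>carrier := U (pdom \<alpha>)\<rparr> Mod N (pdom \<alpha>))"
        "Q2 \<in> carrier ((fgrp (pdom \<alpha>))\<lparr>carrier := U (pdom \<alpha>)\<rparr> Mod N (pdom \<alpha>))"
      then obtain x y where x: "x \<in> U (pdom \<alpha>)" "Q1 = N (pdom \<alpha>) #>\<^bsub>fgrp (pdom \<alpha>)\<^esub> x"
        and y: "y \<in> U (pdom \<alpha>)" "Q2 = N (pdom \<alpha>) #>\<^bsub>fgrp (pdom \<alpha>)\<^esub> y"
        unfolding a.G.carrier_subquotient by blast
      show "fmor (subquotient_functor U N) \<alpha> Q1 \<in> carrier ((fgrp (pcod \<alpha>))\<lparr>carrier := U (pcod \<alpha>)\<rparr> Mod N (pcod \<alpha>))"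
        unfolding x(2) fm[OF a x(1)] a.H.carrier_subquotient using mu[OF x(1)] by blast
      have xy: "x \<otimes>\<^bsub>fgrp (pdom \<alpha>)\<^esub> y \<in> U (pdom \<alpha>)" using subgroup.m_closed[OF U[OF e(1)]] x y by blast
      show "fmor (subquotient_functor U N) \<alpha> (Q1 \<otimes>\<^bsub>(fgrp (pdom \<alpha>))\<lparr>carrier := U (pdom \<alpha>)\<rparr> Mod N (pdom \<alpha>)\<^esub> Q2) =
        fmor (subquotient_functor U N) \<alpha> Q1 \<otimes>\<^bsub>(fgrp (pcod \<alpha>))\<lparr>carrier := U (pcod \<alpha>)\<rparr> Mod N (pcod \<alpha>)\<^esub>
        fmor (subquotient_functor U N) \<alpha> Q2"
        unfolding x(2) y(2) a.G.mult_subquotient[OF N(1)[OF e(1)] uc[OF x(1)] uc[OF y(1)]]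
          fm[OF a x(1)] fm[OF a y(1)] fm[OF a xy]
          a.H.mult_subquotient[OF N(1)[OF e(2)] a.hom_closed[OF uc[OF x(1)]] a.hom_closed[OF uc[OF y(1)]]]
          a.hom_mult[OF uc[OF x(1)] uc[OF y(1)]] by (rule HOL.refl)
    qed
  qed
  show "fmor (subquotient_functor U N) (Comp (Pres T G) \<alpha> \<beta>) Q1 =
      fmor (subquotient_functor U N) \<alpha> (fmor (subquotient_functor U N) \<beta> Q1)"
    if m: "\<alpha> \<in> pres_mors G" "\<beta> \<in> pres_mors G" "pdom \<alpha> = pcod \<beta>"
      and Q1: "Q1 \<in> carrier ((fgrp (pdom \<beta>))\<lparr>carrier := U (pdom \<beta>)\<rparr> Mod N (pdom \<beta>))" for \<alpha> \<beta> Q1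
  proof -
    have gb: "group (fgrp (pdom \<beta>))" by (rule presentation_group[OF pres_mor_ends(1)[OF m(2)]])
    obtain x where x: "x \<in> U (pdom \<beta>)" "Q1 = N (pdom \<beta>) #>\<^bsub>fgrp (pdom \<beta>)\<^esub> x"
      using Q1 unfolding group.carrier_subquotient[OF gb] by blast
    have xc: "x \<in> carrier (fgrp (pdom \<beta>))" using subgroup.subset[OF U[OF pres_mor_ends(1)[OF m(2)]]] x(1) by blast
    have bx: "pmap \<beta> x \<in> U (pdom \<alpha>)" using mU[OF m(2)] x(1) m(3) by auto
    show ?thesis
      using fm[OF pres_mor_comp[OF m, of T], simplified, OF x(1)] fm[OF m(2) x(1)] fm[OF m(1) bx] xc
      by (simp add: x(2) m(3) compose_def)
  qed
qed

section \<open>The subgroups of a presentation\<close>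

lemma (in group_hom) derived_image_subset:
  assumes "K \<subseteq> carrier G" "L \<subseteq> carrier H" "h ` K \<subseteq> L"
  shows "h ` derived G K \<subseteq> derived H L"
  using derived_img[OF assms(1)] H.mono_derived[OF assms(3)] by simp

context group_ring_epi
begin

lemma lower_central_surj: "lower_central H n \<subseteq> h ` lower_central G n"
proof (induction n)
  case (Suc n)
  show ?case
  proof (cases n)
    case m: (Suc m)
    show ?thesis unfolding m lower_central.simps
    proof (rule H.commutator_subgroup_minimal)
      show "subgroup (h ` commutator_subgroup G (lower_central G (Suc m)) (carrier G)) H"
        using subgroup_img_is_subgroup[OF normal_imp_subgroup[OF G.normal_lower_central[of "Suc (Suc m)"]]] by simp
      fix x k assume x: "x \<in> lower_central H (Suc m)" and k: "k \<in> carrier H"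
      obtain x' where x': "x' \<in> lower_central G (Suc m)" "h x' = x" using Suc x m by blast
      obtain k' where k': "k' \<in> carrier G" "h k' = k" using section_closed[OF k] section_eq[OF k] by blast
      have x'c: "x' \<in> carrier G" using x'(1) subgroup.subset[OF normal_imp_subgroup[OF G.normal_lower_central]] by blast
      have "h (x' \<otimes>\<^bsub>G\<^esub> k' \<otimes>\<^bsub>G\<^esub> inv\<^bsub>G\<^esub> x' \<otimes>\<^bsub>G\<^esub> inv\<^bsub>G\<^esub> k') = x \<otimes>\<^bsub>H\<^esub> k \<otimes>\<^bsub>H\<^esub> inv\<^bsub>H\<^esub> x \<otimes>\<^bsub>H\<^esub> inv\<^bsub>H\<^esub> k"
        using x' k' x'c by simp
      then show "x \<otimes>\<^bsub>H\<^esub> k \<otimes>\<^bsub>H\<^esub> inv\<^bsub>H\<^esub> x \<otimes>\<^bsub>H\<^esub> inv\<^bsub>H\<^esub> k \<in> h ` commutator_subgroup G (lower_central G (Suc m)) (carrier G)"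
        using G.lower_central_commutator[OF x'(1) k'(1)] by (metis imageI lower_central.simps(3))
    qed
  qed (simp add: surj)
qed (simp add: surj)

abbreviation "R \<equiv> kernel G H h"
abbreviation "S n \<equiv> one_plus G (rf_ideal n)"
abbreviation "N n \<equiv> derived G R <#>\<^bsub>G\<^esub> lower_central G n"
abbreviation "N' n \<equiv> derived G R <#>\<^bsub>G\<^esub> (R \<inter> lower_central G n)"

lemma normal_S: "S n \<lhd> G"
  by (rule G.normal_one_plus[OF ideal_rf_ideal])

lemma normal_derived_R: "derived G R \<lhd> G"
  by (rule G.derived_is_normal[OF normal_kernel])

lemma normal_N: "N n \<lhd> G"
  by (rule G.normal_subgroup_set_mult_closed[OF normal_derived_R G.normal_lower_central])

lemma normal_R_lower_central: "R \<inter> lower_central G n \<lhd> G"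
  by (rule G.normal_subgroup_intersect[OF normal_kernel G.normal_lower_central])

lemma normal_N': "N' n \<lhd> G"
  by (rule G.normal_subgroup_set_mult_closed[OF normal_derived_R normal_R_lower_central])

lemma normal_R_S: "R \<inter> S n \<lhd> G"
  by (rule G.normal_subgroup_intersect[OF normal_kernel normal_S])

lemma derived_R_R: "derived G R \<subseteq> R"
  by (rule G.derived_incl[OF subset_refl subgroup_kernel])

text \<open>For r, s in R the element s - 1 lies in f as well as in the relative ideal. So both
  terms of the bracket in \<open>gr_single_commutator\<close> lie in rf.\<close>

lemma derived_R_S: "derived G R \<subseteq> S n"
  unfolding derived_def
proof (rule G.generate_subgroup_incl[OF _ normal_imp_subgroup[OF normal_S]], rule subsetI)
  interpret J: ideal "rf_ideal n" G.ZG by (rule ideal_rf_ideal)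
  fix c assume "c \<in> (\<Union>h1\<in>R. \<Union>h2\<in>R. {h1 \<otimes> h2 \<otimes> inv h1 \<otimes> inv h2})"
  then obtain r s where rs: "r \<in> R" "s \<in> R" "c = r \<otimes> s \<otimes> inv r \<otimes> inv s" by blast
  have rc: "r \<in> carrier G" "s \<in> carrier G" using rs kernel_subset by auto
  have p: "G.gd x \<otimes>\<^bsub>G.ZG\<^esub> G.gd y \<in> rf_ideal n" if "x \<in> R" "y \<in> R" for x y
    using that kernel_subset by (intro rf_ideal_intro(1) ideal_prod.prod G.gd_relative_ideal G.gd_aug) auto
  have "G.gd r \<otimes>\<^bsub>G.ZG\<^esub> G.gd s \<ominus>\<^bsub>G.ZG\<^esub> G.gd s \<otimes>\<^bsub>G.ZG\<^esub> G.gd r \<in> rf_ideal n"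
    by (subst G.ZG.minus_eq) (rule J.a_closed[OF p[OF rs(1,2)] J.a_inv_closed[OF p[OF rs(2,1)]]])
  then have "G.gd c \<in> rf_ideal n"
    unfolding rs(3) G.gr_single_commutator[OF rc] using rc by (intro J.I_r_closed) auto
  then show "c \<in> S n" using rc rs(3) by (simp add: G.one_plus_iff)
qed

lemma lower_central_S: "n \<ge> 1 \<Longrightarrow> lower_central G n \<subseteq> S n"
proof -
  assume "n \<ge> 1"
  then obtain m where n: "n = Suc m" by (cases n) auto
  show ?thesis
    using G.lower_central_one_plus[of m] rf_ideal_intro(2)[of _ n] unfolding n G.one_plus_iff subset_iff by blast
qed

lemma set_mult_subset:
  assumes "subgroup U G" "A \<subseteq> U" "B \<subseteq> U" shows "A <#> B \<subseteq> U"
  using assms subgroup.m_closed[OF assms(1)] by (auto simp: set_mult_def)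

lemma N_S: "n \<ge> 1 \<Longrightarrow> N n \<subseteq> S n"
  by (rule set_mult_subset[OF normal_imp_subgroup[OF normal_S] derived_R_S lower_central_S])

lemma N'_R_S: "n \<ge> 1 \<Longrightarrow> N' n \<subseteq> R \<inter> S n"
  using set_mult_subset[OF normal_imp_subgroup[OF normal_R_S] Int_greatest[OF derived_R_R derived_R_S]
      Int_mono[OF subset_refl lower_central_S]] .

lemma lower_central_N: "lower_central G n \<subseteq> N n" and N'_N: "N' n \<subseteq> N n"
proof -
  have 1: "\<one> \<in> derived G R" by (rule subgroup.one_closed[OF normal_imp_subgroup[OF normal_derived_R]])
  have c: "lower_central G n \<subseteq> carrier G" by (rule subgroup.subset[OF normal_imp_subgroup[OF G.normal_lower_central]])
  show "lower_central G n \<subseteq> N n"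
  proof
    fix x assume x: "x \<in> lower_central G n"
    then have "x = \<one> \<otimes> x" using c by auto
    then show "x \<in> N n" unfolding set_mult_def using x 1 by blast
  qed
  show "N' n \<subseteq> N n" by (auto simp: set_mult_def)
qed

text \<open>The modular law: R' is contained in R, so dividing off the R' factor leaves an element
  of R. This makes the map from the kernel functor to S/N injective.\<close>

lemma N_Int_R: "x \<in> N n \<Longrightarrow> x \<in> R \<Longrightarrow> x \<in> N' n"
proof -
  assume x: "x \<in> N n" "x \<in> R"
  then obtain d y where d: "d \<in> derived G R" "y \<in> lower_central G n" "x = d \<otimes> y" by (auto simp: set_mult_def)
  have c: "d \<in> carrier G" "y \<in> carrier G" "d \<in> R"
    using d(1,2) derived_R_R kernel_subset subgroup.subset[OF normal_imp_subgroup[OF G.normal_lower_central[of n]]] by blast+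
  have "y = inv d \<otimes> x" using c d(3) by simp
  also have "\<dots> \<in> R" using subgroup_kernel c(3) x(2) subgroup.m_closed subgroup.m_inv_closed by metis
  finally show ?thesis using d unfolding set_mult_def by blast
qed

lemma image_N: "h ` N n \<subseteq> lower_central H n"
proof (rule image_subsetI)
  fix x assume "x \<in> N n"
  then obtain d y where d: "d \<in> derived G R" "y \<in> lower_central G n" "x = d \<otimes> y" by (auto simp: set_mult_def)
  have c: "d \<in> carrier G" "y \<in> carrier G" "h d = \<one>\<^bsub>H\<^esub>"
    using d(1,2) derived_R_R subgroup.subset[OF normal_imp_subgroup[OF G.normal_lower_central[of n]]]
    by (auto simp: kernel_def)
  then show "h x \<in> lower_central H n" using gmap_lower_central[OF d(2)] d(3) by simp
qed

text \<open>Since gamma_n(F) maps onto gamma_n(H), x can be corrected by an element y of gamma_n(F)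
  to lie in R, and this does not change its coset of N. The correction is kept in the conclusion in
  order to see later that r lies in S whenever x does.\<close>

lemma lower_central_preimage:
  assumes "x \<in> carrier G" "h x \<in> lower_central H n"
  obtains r where "r \<in> R" "N n #> x = N n #> r" "\<exists>y\<in>lower_central G n. r = x \<otimes> inv y"
proof -
  obtain y where y: "y \<in> lower_central G n" "h y = h x" using assms(2) lower_central_surj[of n] by (metis imageE subsetD)
  interpret L: normal "lower_central G n" G by (rule G.normal_lower_central)
  have yc: "y \<in> carrier G" using y(1) L.subset by blast
  have "x \<otimes> inv y \<in> R" using y assms yc by (simp add: kernel_def)
  moreover have "x \<otimes> inv (x \<otimes> inv y) = x \<otimes> y \<otimes> inv x"
    using assms(1) yc by (simp add: G.inv_mult_group G.m_assoc)
  then have "x \<otimes> inv (x \<otimes> inv y) \<in> N n"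
    using L.inv_op_closed2[OF assms(1) y(1)] lower_central_N[of n] by auto
  then have "N n #> x = N n #> (x \<otimes> inv y)"
    using assms(1) yc by (subst G.r_coset_eq_iff[OF normal_imp_subgroup[OF normal_N]]) auto
  ultimately show ?thesis using that y(1) by blast
qed

end

lemma pres_sub_simps:
  "rel_sub G c = kernel (fgrp c) G (proj c)"
  "rf_sub G n c = one_plus (fgrp c) (group_ring_epi.rf_ideal (fgrp c) G (proj c) n)"
  by (simp_all add: rel_sub_def rf_sub_def Let_def)

section \<open>The action on the abelianised relations\<close>

lemma (in group) lower_central_Suc_subset: "lower_central G (Suc n) \<subseteq> lower_central G n"
proof (cases n)
  case n: (Suc m)
  interpret L: normal "lower_central G n" G by (rule normal_lower_central)
  show ?thesis
    unfolding n lower_central.simps(3)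
  proof (rule commutator_subgroup_minimal)
    show "subgroup (lower_central G (Suc m)) G" using L.subgroup_axioms n by simp
    fix x k assume x: "x \<in> lower_central G (Suc m)" "k \<in> carrier G"
    have xc: "x \<in> carrier G" using x L.subset n by auto
    have "x \<otimes> (k \<otimes> inv x \<otimes> inv k) \<in> lower_central G n"
      using x n by (intro L.m_closed L.inv_op_closed2 L.m_inv_closed) auto
    then show "x \<otimes> k \<otimes> inv x \<otimes> inv k \<in> lower_central G (Suc m)"
      using x xc n by (simp add: m_assoc)
  qed
qed simp

lemma (in group) conj_group_hom:
  "x \<in> carrier G \<Longrightarrow> group_hom G G (\<lambda>r. x \<otimes> r \<otimes> inv x)"
  by (simp add: group_hom_def group_hom_axioms_def hom_def is_group conj_mult)

text \<open>\<open>R/R'\<close> is a \<open>\<int>[F]\<close>-module by conjugation. It is killed by \<open>r\<close>, and \<open>f\<^sup>n\<close> maps it to the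
  image of \<open>R \<inter> \<gamma>\<^sub>n\<^sub>+\<^sub>1(F)\<close>.\<close>

context group_ring_epi
begin

abbreviation "D \<equiv> derived G R"
abbreviation "V \<equiv> (G\<lparr>carrier := R\<rparr>) Mod D"

definition cj :: "'a \<Rightarrow> 'a set \<Rightarrow> 'a set" where
  "cj x v = D <#> ((\<lambda>r. x \<otimes> r \<otimes> inv x) ` v)"

lemma comm_group_V: "comm_group V"
  by (rule G.derived_quot_of_subgroup_is_comm_group[OF subgroup_kernel])

sublocale V: comm_group V
  by (rule comm_group_V)

lemma R_carrier: "r \<in> R \<Longrightarrow> r \<in> carrier G"
  by (simp add: kernel_def)

lemma R_conj: "r \<in> R \<Longrightarrow> x \<in> carrier G \<Longrightarrow> x \<otimes> r \<otimes> inv x \<in> R"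
  using normal.inv_op_closed2[OF normal_kernel] .

lemma V_iff: "v \<in> carrier V \<longleftrightarrow> (\<exists>r\<in>R. v = D #> r)"
  unfolding G.carrier_subquotient by blast

lemma V_mult: "r \<in> R \<Longrightarrow> s \<in> R \<Longrightarrow> (D #> r) \<otimes>\<^bsub>V\<^esub> (D #> s) = D #> (r \<otimes> s)"
  by (rule G.mult_subquotient[OF normal_derived_R]) (simp_all add: R_carrier)

lemma V_inv: "r \<in> R \<Longrightarrow> inv\<^bsub>V\<^esub> (D #> r) = D #> inv r"
  by (rule G.inv_subquotient[OF subgroup_kernel normal_derived_R derived_R_R])

lemma cj_coset: "x \<in> carrier G \<Longrightarrow> r \<in> R \<Longrightarrow> cj x (D #> r) = D #> (x \<otimes> r \<otimes> inv x)"
proof -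
  assume x: "x \<in> carrier G" "r \<in> R"
  interpret D: normal D G by (rule normal_derived_R)
  show ?thesis unfolding cj_def
    by (rule group_hom.r_coset_image[OF G.conj_group_hom[OF x(1)] D.subgroup_axioms D.subgroup_axioms])
       (use x D.inv_op_closed2 R_carrier in auto)
qed

lemma cj_group_hom:
  assumes x: "x \<in> carrier G" shows "group_hom V V (cj x)"
proof (intro group_hom.intro group_hom_axioms.intro homI V.is_group)
  fix v assume "v \<in> carrier V"
  then obtain r where r: "r \<in> R" "v = D #> r" unfolding V_iff by blast
  show "cj x v \<in> carrier V" unfolding r(2) cj_coset[OF x r(1)] V_iff using R_conj[OF r(1) x] by blast
  fix w assume "w \<in> carrier V"
  then obtain s where s: "s \<in> R" "w = D #> s" unfolding V_iff by blast
  have rs: "r \<otimes> s \<in> R" using r s subgroup.m_closed[OF subgroup_kernel] by blast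
  show "cj x (v \<otimes>\<^bsub>V\<^esub> w) = cj x v \<otimes>\<^bsub>V\<^esub> cj x w"
    unfolding r(2) s(2) V_mult[OF r(1) s(1)] cj_coset[OF x r(1)] cj_coset[OF x s(1)] cj_coset[OF x rs]
      V_mult[OF R_conj[OF r(1) x] R_conj[OF s(1) x]]
      G.conj_mult[OF x R_carrier[OF r(1)] R_carrier[OF s(1)]] by (rule HOL.refl)
qed

lemmas cj_closed = group_hom.hom_closed[OF cj_group_hom]

lemma cj_mult:
  assumes "x \<in> carrier G" "y \<in> carrier G" "v \<in> carrier V"
  shows "cj (x \<otimes> y) v = cj x (cj y v)"
proof -
  obtain r where r: "r \<in> R" "v = D #> r" using assms(3) unfolding V_iff by blast
  then show ?thesis
    using assms R_conj[OF r(1) assms(2)] R_carrier[OF r(1)]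
    by (simp add: cj_coset G.inv_mult_group G.m_assoc)
qed

text \<open>The module structure in multiplicative notation: a formal sum of group elements acts by
  the product of the corresponding conjugates, with coefficients as exponents.\<close>

definition act where "act a v = G.gr_ext V (\<lambda>x. cj x v) a"

lemma act_group_hom: "v \<in> carrier V \<Longrightarrow> group_hom (add_monoid G.ZG) V (\<lambda>a. act a v)"
  unfolding act_def by (rule G.gr_ext_hom[OF comm_group_V]) (use cj_closed in auto)

lemma act_closed: "v \<in> carrier V \<Longrightarrow> a \<in> carrier G.ZG \<Longrightarrow> act a v \<in> carrier V"
  using group_hom.hom_closed[OF act_group_hom] by simp

lemma act_add:
  "v \<in> carrier V \<Longrightarrow> a \<in> carrier G.ZG \<Longrightarrow> b \<in> carrier G.ZG \<Longrightarrow>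
    act (a \<oplus>\<^bsub>G.ZG\<^esub> b) v = act a v \<otimes>\<^bsub>V\<^esub> act b v"
  using group_hom.hom_mult[OF act_group_hom] by simp

lemma act_zero: "v \<in> carrier V \<Longrightarrow> act \<zero>\<^bsub>G.ZG\<^esub> v = \<one>\<^bsub>V\<^esub>"
  using group_hom.hom_one[OF act_group_hom] by simp

lemma act_uminus:
  "v \<in> carrier V \<Longrightarrow> a \<in> carrier G.ZG \<Longrightarrow> act (\<ominus>\<^bsub>G.ZG\<^esub> a) v = inv\<^bsub>V\<^esub> (act a v)"
  using group_hom.hom_inv[OF act_group_hom, of v a] by (simp add: a_inv_def)

lemma act_single: "v \<in> carrier V \<Longrightarrow> x \<in> carrier G \<Longrightarrow> act (gr_single x) v = cj x v"
  unfolding act_def by (rule G.gr_ext_single[OF comm_group_V]) (use cj_closed in auto)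

lemma act_hom_right:
  assumes a: "a \<in> carrier G.ZG" shows "group_hom V V (act a)"
proof (intro group_hom.intro group_hom_axioms.intro homI V.is_group)
  fix v assume v: "v \<in> carrier V"
  then show "act a v \<in> carrier V" by (rule act_closed[OF _ a])
  fix w assume w: "w \<in> carrier V"
  have vw: "v \<otimes>\<^bsub>V\<^esub> w \<in> carrier V" by (rule V.m_closed[OF v w])
  show "act a (v \<otimes>\<^bsub>V\<^esub> w) = act a v \<otimes>\<^bsub>V\<^esub> act a w"
    using a
  proof (induction a rule: G.group_ring_induct)
    case zero
    show ?case unfolding act_zero[OF vw] act_zero[OF v] act_zero[OF w] V.l_one[OF V.one_closed] by (rule HOL.refl)
  next
    case (single x)
    show ?case unfolding act_single[OF vw single] act_single[OF v single] act_single[OF w single]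
      by (rule group_hom.hom_mult[OF cj_group_hom[OF single] v w])
  next
    case (add a b)
    note c = act_closed[OF v add(1)] act_closed[OF v add(2)] act_closed[OF w add(1)] act_closed[OF w add(2)]
    have "(p \<otimes>\<^bsub>V\<^esub> r) \<otimes>\<^bsub>V\<^esub> (q \<otimes>\<^bsub>V\<^esub> s) = (p \<otimes>\<^bsub>V\<^esub> q) \<otimes>\<^bsub>V\<^esub> (r \<otimes>\<^bsub>V\<^esub> s)"
      if "p \<in> carrier V" "q \<in> carrier V" "r \<in> carrier V" "s \<in> carrier V" for p q r s
      using that by (simp only: V.m_ac V.m_closed)
    from this[OF c] show ?case
      unfolding act_add[OF vw add(1,2)] act_add[OF v add(1,2)] act_add[OF w add(1,2)] add(3,4) .
  next
    case (uminus a)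
    show ?case
      unfolding act_uminus[OF vw uminus(1)] act_uminus[OF v uminus(1)] act_uminus[OF w uminus(1)] uminus(2)
      by (rule V.inv_mult[OF act_closed[OF v uminus(1)] act_closed[OF w uminus(1)]])
  qed
qed

lemma act_single_mult:
  assumes x: "x \<in> carrier G" and b: "b \<in> carrier G.ZG" and v: "v \<in> carrier V"
  shows "act (gr_single x \<otimes>\<^bsub>G.ZG\<^esub> b) v = cj x (act b v)"
  using b
proof (induction b rule: G.group_ring_induct)
  case zero
  have "gr_single x \<otimes>\<^bsub>G.ZG\<^esub> \<zero>\<^bsub>G.ZG\<^esub> = \<zero>\<^bsub>G.ZG\<^esub>" using x by simp
  then show ?case using group_hom.hom_one[OF cj_group_hom[OF x]] by (simp only: act_zero[OF v])
next
  case (single y)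
  have "gr_single x \<otimes>\<^bsub>G.ZG\<^esub> gr_single y = gr_single (x \<otimes> y)"
    by (rule G.gr_single_mult[OF x single, symmetric])
  then show ?case
    by (simp only: act_single[OF v single] act_single[OF v G.m_closed[OF x single]] cj_mult[OF x single v])
next
  case (add a b)
  have c: "gr_single x \<otimes>\<^bsub>G.ZG\<^esub> a \<in> carrier G.ZG" "gr_single x \<otimes>\<^bsub>G.ZG\<^esub> b \<in> carrier G.ZG"
    using x add by simp_all
  have "gr_single x \<otimes>\<^bsub>G.ZG\<^esub> (a \<oplus>\<^bsub>G.ZG\<^esub> b) =
      gr_single x \<otimes>\<^bsub>G.ZG\<^esub> a \<oplus>\<^bsub>G.ZG\<^esub> gr_single x \<otimes>\<^bsub>G.ZG\<^esub> b"
    using x add by (simp add: G.ZG.r_distr)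
  then show ?case
    by (simp only: act_add[OF v c] act_add[OF v add(1,2)] add(3,4)
        group_hom.hom_mult[OF cj_group_hom[OF x] act_closed[OF v add(1)] act_closed[OF v add(2)]])
next
  case (uminus a)
  have c: "gr_single x \<otimes>\<^bsub>G.ZG\<^esub> a \<in> carrier G.ZG" using x uminus by simp
  have "gr_single x \<otimes>\<^bsub>G.ZG\<^esub> (\<ominus>\<^bsub>G.ZG\<^esub> a) = \<ominus>\<^bsub>G.ZG\<^esub> (gr_single x \<otimes>\<^bsub>G.ZG\<^esub> a)"
    using x uminus by (simp add: G.ZG.r_minus)
  then show ?case
    by (simp only: act_uminus[OF v c] act_uminus[OF v uminus(1)] uminus(2)
        group_hom.hom_inv[OF cj_group_hom[OF x] act_closed[OF v uminus(1)]])
qed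

lemma act_mult:
  assumes a: "a \<in> carrier G.ZG" and b: "b \<in> carrier G.ZG" and v: "v \<in> carrier V"
  shows "act (a \<otimes>\<^bsub>G.ZG\<^esub> b) v = act a (act b v)"
  using a
proof (induction a rule: G.group_ring_induct)
  case zero
  have "\<zero>\<^bsub>G.ZG\<^esub> \<otimes>\<^bsub>G.ZG\<^esub> b = \<zero>\<^bsub>G.ZG\<^esub>" using b by simp
  then show ?case by (simp only: act_zero[OF v] act_zero[OF act_closed[OF v b]])
next
  case (single y)
  then show ?case by (simp only: act_single_mult[OF single b v] act_single[OF act_closed[OF v b] single])
next
  case (add a c)
  have cl: "a \<otimes>\<^bsub>G.ZG\<^esub> b \<in> carrier G.ZG" "c \<otimes>\<^bsub>G.ZG\<^esub> b \<in> carrier G.ZG"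
    using b add by simp_all
  have "(a \<oplus>\<^bsub>G.ZG\<^esub> c) \<otimes>\<^bsub>G.ZG\<^esub> b =
      a \<otimes>\<^bsub>G.ZG\<^esub> b \<oplus>\<^bsub>G.ZG\<^esub> c \<otimes>\<^bsub>G.ZG\<^esub> b"
    using b add by (simp add: G.ZG.l_distr)
  then show ?case
    by (simp only: act_add[OF v cl] act_add[OF act_closed[OF v b] add(1,2)] add(3,4))
next
  case (uminus a)
  have c: "a \<otimes>\<^bsub>G.ZG\<^esub> b \<in> carrier G.ZG" using b uminus by simp
  have "(\<ominus>\<^bsub>G.ZG\<^esub> a) \<otimes>\<^bsub>G.ZG\<^esub> b = \<ominus>\<^bsub>G.ZG\<^esub> (a \<otimes>\<^bsub>G.ZG\<^esub> b)"
    using b uminus by (simp add: G.ZG.l_minus)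
  then show ?case
    by (simp only: act_uminus[OF v c] act_uminus[OF act_closed[OF v b] uminus(1)] uminus(2))
qed

text \<open>Conjugation by x minus the identity is the commutator with x. This is the dictionary
  between ideals of the group ring and commutators with R.\<close>

lemma act_gd:
  assumes x: "x \<in> carrier G" and r: "r \<in> R"
  shows "act (G.gd x) (D #> r) = D #> (x \<otimes> r \<otimes> inv x \<otimes> inv r)"
proof -
  have v: "D #> r \<in> carrier V" using r unfolding V_iff by blast
  have one: "act \<one>\<^bsub>G.ZG\<^esub> (D #> r) = D #> r"
    using act_single[OF v G.one_closed] cj_coset[OF G.one_closed r] R_carrier[OF r] by (simp add: G.gr_one)
  have "act (G.gd x) (D #> r) = cj x (D #> r) \<otimes>\<^bsub>V\<^esub> inv\<^bsub>V\<^esub> (D #> r)"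
    unfolding G.ZG.minus_eq using v x
    by (simp only: act_add[OF v G.gr_single_carrier[OF x] G.ZG.a_inv_closed[OF G.ZG.one_closed]]
      act_single[OF v x] act_uminus[OF v G.ZG.one_closed] one)
  also have "\<dots> = D #> (x \<otimes> r \<otimes> inv x \<otimes> inv r)"
    unfolding cj_coset[OF x r] V_inv[OF r]
    using V_mult[OF R_conj[OF r x] subgroup.m_inv_closed[OF subgroup_kernel r]] .
  finally show ?thesis .
qed

text \<open>The annihilator of a module is a two-sided ideal, and it contains r - 1 for r in R
  because commutators of elements of R lie in R'.\<close>

lemma act_relative_ideal:
  assumes a: "a \<in> relative_ideal G R" and v: "v \<in> carrier V"
  shows "act a v = \<one>\<^bsub>V\<^esub>"
proof -
  define K where "K = {a \<in> carrier G.ZG. \<forall>v\<in>carrier V. act a v = \<one>\<^bsub>V\<^esub>}"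
  have "ideal K G.ZG"
  proof (rule idealI[OF G.ring_group_ring])
    show "subgroup K (add_monoid G.ZG)"
    proof (rule G.ZG.add.subgroupI)
      have "\<zero>\<^bsub>G.ZG\<^esub> \<in> K" unfolding K_def using act_zero by blast
      then show "K \<noteq> {}" by blast
      show "K \<subseteq> carrier G.ZG" by (auto simp: K_def)
      show "\<ominus>\<^bsub>G.ZG\<^esub> a \<in> K" if "a \<in> K" for a
        using that act_uminus V.inv_one unfolding K_def by simp
      show "a \<oplus>\<^bsub>G.ZG\<^esub> b \<in> K" if "a \<in> K" "b \<in> K" for a b
        using that act_add V.l_one[OF V.one_closed] unfolding K_def by simp
    qed
    show "x \<otimes>\<^bsub>G.ZG\<^esub> a \<in> K" if "a \<in> K" "x \<in> carrier G.ZG" for a x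
      using that act_mult group_hom.hom_one[OF act_hom_right] unfolding K_def by simp
    show "a \<otimes>\<^bsub>G.ZG\<^esub> x \<in> K" if "a \<in> K" "x \<in> carrier G.ZG" for a x
      using that act_mult act_closed unfolding K_def by simp
  qed
  moreover have "G.gd r \<in> K" if r: "r \<in> R" for r
    unfolding K_def
  proof (intro CollectI conjI ballI)
    show "G.gd r \<in> carrier G.ZG" using R_carrier[OF r] by simp
    fix v assume "v \<in> carrier V"
    then obtain s where s: "s \<in> R" "v = D #> s" unfolding V_iff by blast
    have "r \<otimes> s \<otimes> inv r \<otimes> inv s \<in> D"
      unfolding derived_def using r s by (intro generate.incl) blast
    then have "D #> (r \<otimes> s \<otimes> inv r \<otimes> inv s) = D"
      using R_carrier[OF r] R_carrier[OF s(1)] by (intro G.coset_join2 normal_imp_subgroup[OF normal_derived_R]) auto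
    then show "act (G.gd r) v = \<one>\<^bsub>V\<^esub>" unfolding s(2) act_gd[OF R_carrier[OF r] s(1)] by simp
  qed
  ultimately have "relative_ideal G R \<subseteq> K" by (rule G.relative_ideal_minimal)
  then show ?thesis using a v unfolding K_def by blast
qed

text \<open>The image of R \<inter> gamma_k(F) in R/R', a filtration that f shifts by one
  step.\<close>

definition W where "W k = (\<lambda>r. D #> r) ` (R \<inter> lower_central G k)"

lemma W_V: "W k \<subseteq> carrier V"
  unfolding W_def G.carrier_subquotient by blast

lemma subgroup_W: "subgroup (W k) V"
proof (rule V.subgroupI[OF W_V])
  have "\<one> \<in> R \<inter> lower_central G k"
    using subgroup.one_closed[OF normal_imp_subgroup[OF normal_R_lower_central]] .
  then show "W k \<noteq> {}" unfolding W_def by blast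
  fix v assume "v \<in> W k"
  then obtain r where r: "r \<in> R \<inter> lower_central G k" "v = D #> r" unfolding W_def by blast
  have "inv r \<in> R \<inter> lower_central G k"
    using subgroup.m_inv_closed[OF normal_imp_subgroup[OF normal_R_lower_central] r(1)] .
  then show "inv\<^bsub>V\<^esub> v \<in> W k" unfolding r(2) W_def using V_inv[of r] r(1) by auto
  fix w assume "w \<in> W k"
  then obtain s where s: "s \<in> R \<inter> lower_central G k" "w = D #> s" unfolding W_def by blast
  have "r \<otimes> s \<in> R \<inter> lower_central G k"
    using subgroup.m_closed[OF normal_imp_subgroup[OF normal_R_lower_central] r(1) s(1)] .
  moreover have "v \<otimes>\<^bsub>V\<^esub> w = D #> (r \<otimes> s)" unfolding r(2) s(2) using V_mult r(1) s(1) by blast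
  ultimately show "v \<otimes>\<^bsub>V\<^esub> w \<in> W k" unfolding W_def by blast
qed

lemma act_aug_W:
  assumes a: "a \<in> aug_ideal G" and v: "v \<in> W (Suc k)"
  shows "act a v \<in> W (Suc (Suc k))"
proof -
  have vV: "v \<in> carrier V" using v W_V by blast
  obtain r where r: "r \<in> R" "r \<in> lower_central G (Suc k)" "v = D #> r" using v unfolding W_def by blast
  define K where "K = {a \<in> carrier G.ZG. act a v \<in> W (Suc (Suc k))}"
  have "aug_ideal G \<subseteq> K"
  proof (rule G.aug_ideal_subset)
    show "subgroup K (add_monoid G.ZG)"
    proof (rule G.ZG.add.subgroupI)
      have "\<zero>\<^bsub>G.ZG\<^esub> \<in> K"
        unfolding K_def using act_zero[OF vV] subgroup.one_closed[OF subgroup_W] by simp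
      then show "K \<noteq> {}" by blast
      show "K \<subseteq> carrier G.ZG" by (auto simp: K_def)
      show "\<ominus>\<^bsub>G.ZG\<^esub> a \<in> K" if "a \<in> K" for a
        using that act_uminus[OF vV] subgroup.m_inv_closed[OF subgroup_W]
        unfolding K_def by simp
      show "a \<oplus>\<^bsub>G.ZG\<^esub> b \<in> K" if "a \<in> K" "b \<in> K" for a b
        using that act_add[OF vV] subgroup.m_closed[OF subgroup_W] unfolding K_def by simp
    qed
    fix x assume x: "x \<in> carrier G"
    have rc: "r \<in> carrier G" using R_carrier r by blast
    \<comment> \<open>\<open>lower_central_commutator\<close> has the element of the series in the
      first place. The commutator wanted here has it in the second place and is its inverse.\<close>
    have "inv (r \<otimes> x \<otimes> inv r \<otimes> inv x) \<in> lower_central G (Suc (Suc k))"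
      using G.lower_central_commutator[OF r(2) x]
      by (rule subgroup.m_inv_closed[OF normal_imp_subgroup[OF G.normal_lower_central]])
    moreover have "inv (r \<otimes> x \<otimes> inv r \<otimes> inv x) = x \<otimes> r \<otimes> inv x \<otimes> inv r"
      using rc x by (simp add: G.inv_mult_group G.m_assoc)
    moreover have "x \<otimes> r \<otimes> inv x \<otimes> inv r \<in> R"
      using R_conj[OF r(1) x] subgroup.m_closed[OF subgroup_kernel] subgroup.m_inv_closed[OF subgroup_kernel r(1)] by blast
    ultimately have "D #> (x \<otimes> r \<otimes> inv x \<otimes> inv r) \<in> W (Suc (Suc k))" unfolding W_def by simp
    then show "G.gd x \<in> K" unfolding K_def r(3) using act_gd[OF x r(1)] x by simp
  qed
  then show ?thesis using a unfolding K_def by blast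
qed

text \<open>In a product from f^n f the right factor acts first and raises k, so k is general in the
  induction. For n = 0 the power is the whole ring, under which \<open>W\<close> is stable because R
  \<inter> gamma_k(F) is normal.\<close>

lemma act_aug_power_W:
  "a \<in> G.augp n \<Longrightarrow> v \<in> W (Suc k) \<Longrightarrow> act a v \<in> W (Suc k + n)"
proof (induction n arbitrary: a v k)
  case 0
  obtain r where r: "r \<in> R" "r \<in> lower_central G (Suc k)" "v = D #> r" using 0(2) unfolding W_def by blast
  have vV: "v \<in> carrier V" using 0 W_V by blast
  have "a \<in> carrier G.ZG" using 0 by simp
  then show ?case
  proof (induction a rule: G.group_ring_induct)
    case zero
    show ?case unfolding act_zero[OF vV] by (rule subgroup.one_closed[OF subgroup_W])
  next
    case (single x)
    have "x \<otimes> r \<otimes> inv x \<in> R \<inter> lower_central G (Suc k)"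
      using normal.inv_op_closed2[OF normal_R_lower_central single] r by blast
    moreover have "act (gr_single x) v = D #> (x \<otimes> r \<otimes> inv x)"
      using act_single[OF vV single] cj_coset[OF single r(1)] r(3) by simp
    ultimately show ?case unfolding W_def by simp
  next
    case (add a b)
    then show ?case using act_add[OF vV add(1,2)] subgroup.m_closed[OF subgroup_W] by metis
  next
    case (uminus a)
    then show ?case using act_uminus[OF vV uminus(1)] subgroup.m_inv_closed[OF subgroup_W] by metis
  qed
next
  case (Suc n)
  have vV: "v \<in> carrier V" using Suc(3) W_V by blast
  note c = ideal.Icarr[OF G.ideal_power_ideal[OF G.ideal_aug_ideal]] and c' = ideal.Icarr[OF G.ideal_aug_ideal]
  from Suc.prems(1) have "a \<in> ideal_prod G.ZG (G.augp n) (aug_ideal G)"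
    by simp
  then show ?case
  proof (induction a rule: ideal_prod.induct)
    case (prod i j)
    have "act i (act j v) \<in> W (Suc (Suc k) + n)"
      by (rule Suc.IH[OF prod(1) act_aug_W[OF prod(2) Suc.prems(2)]])
    then show ?case unfolding act_mult[OF c[OF prod(1)] c'[OF prod(2)] vV] by simp
  next
    case (sum a b)
    have "a \<in> carrier G.ZG" "b \<in> carrier G.ZG"
      using sum c[of _ "Suc n"] by simp_all
    then show ?case using act_add[OF vV] subgroup.m_closed[OF subgroup_W sum(3,4)] by simp
  qed
qed

text \<open>Write x - 1 as a + b with a in rf and b in f^n. Only b acts, and the class of r starts
  in the first step of the filtration, so the commutator lands in R'(R \<inter> gamma_{n+1}(F)).
  This lies in the denominator of the kernel functor and gives centrality.\<close>

proposition commutator_S_R: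
  assumes x: "x \<in> S n" and r: "r \<in> R"
  shows "x \<otimes> r \<otimes> inv x \<otimes> inv r \<in> N' n"
proof -
  have xc: "x \<in> carrier G" "G.gd x \<in> rf_ideal n" using x by (simp_all add: G.one_plus_iff)
  then obtain a b where ab: "a \<in> rf"
    "b \<in> G.augp n" "G.gd x = a \<oplus>\<^bsub>G.ZG\<^esub> b"
    by (auto simp: set_add_def')
  have c: "a \<in> carrier G.ZG" "b \<in> carrier G.ZG"
    using ab ideal.Icarr[OF ideal_rf] ideal.Icarr[OF G.ideal_power_ideal[OF G.ideal_aug_ideal]] by auto
  have a: "a \<in> relative_ideal G R"
    using ab(1) G.ZG.ideal_prod_inter[OF G.relative_ideal_ideal[OF kernel_subset] G.ideal_aug_ideal] by auto
  have v: "D #> r \<in> carrier V" "D #> r \<in> W (Suc 0)"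
    using r R_carrier[OF r] unfolding V_iff W_def by auto
  have "act (G.gd x) (D #> r) = act b (D #> r)"
    unfolding ab(3) act_add[OF v(1) c] act_relative_ideal[OF a v(1)]
    by (rule V.l_one[OF act_closed[OF v(1) c(2)]])
  also have "\<dots> \<in> W (Suc 0 + n)" by (rule act_aug_power_W[OF ab(2) v(2)])
  finally have "D #> (x \<otimes> r \<otimes> inv x \<otimes> inv r) \<in> W (Suc n)" unfolding act_gd[OF xc(1) r] by simp
  then obtain g where g: "g \<in> R" "g \<in> lower_central G (Suc n)"
    "D #> (x \<otimes> r \<otimes> inv x \<otimes> inv r) = D #> g" unfolding W_def by blast
  let ?c = "x \<otimes> r \<otimes> inv x \<otimes> inv r"
  have cc: "?c \<in> carrier G" "g \<in> carrier G" using xc R_carrier[OF r] R_carrier[OF g(1)] by auto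
  have "?c \<otimes> inv g \<in> D"
    using g(3) G.r_coset_eq_iff[OF normal_imp_subgroup[OF normal_derived_R] cc] by simp
  moreover have "?c = ?c \<otimes> inv g \<otimes> g" using cc by (simp add: G.m_assoc)
  moreover have "g \<in> R \<inter> lower_central G n" using g G.lower_central_Suc_subset by blast
  ultimately show ?thesis unfolding set_mult_def by blast
qed

end

section \<open>A Fox derivative\<close>

context group_ring_epi
begin

lemma Suc_ideal_power:
  assumes "a \<in> aug_ideal G" "b \<in> G.augp n"
  shows "a \<otimes>\<^bsub>G.ZG\<^esub> b \<in> G.augp (Suc n)"
    and "b \<otimes>\<^bsub>G.ZG\<^esub> a \<in> G.augp (Suc n)"
  using ideal_prod.prod[OF assms, of G.ZG] ideal_prod.prod[OF assms(2,1), of G.ZG]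
    G.ideal_power_commute[OF G.ideal_aug_ideal, of n] by simp_all

text \<open>The additive group f with F acting by left multiplication. A derivation with prescribed
  values on a basis is then an instance of \<open>free_basis_hom\<close>.\<close>

definition semidirect :: "(('a \<Rightarrow> int) \<times> 'a) monoid" where
  "semidirect = \<lparr>carrier = aug_ideal G \<times> carrier G,
     monoid.mult = (\<lambda>(a, x) (b, y). (a \<oplus>\<^bsub>G.ZG\<^esub> gr_single x \<otimes>\<^bsub>G.ZG\<^esub> b, x \<otimes> y)),
     one = (\<zero>\<^bsub>G.ZG\<^esub>, \<one>)\<rparr>"

lemma semidirect_simps [simp]:
  "(a, x) \<in> carrier semidirect \<longleftrightarrow> a \<in> aug_ideal G \<and> x \<in> carrier G"
  "(a, x) \<otimes>\<^bsub>semidirect\<^esub> (b, y) = (a \<oplus>\<^bsub>G.ZG\<^esub> gr_single x \<otimes>\<^bsub>G.ZG\<^esub> b, x \<otimes> y)"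
  "\<one>\<^bsub>semidirect\<^esub> = (\<zero>\<^bsub>G.ZG\<^esub>, \<one>)"
  by (simp_all add: semidirect_def)

lemma group_semidirect: "group semidirect"
proof (rule groupI)
  interpret I: ideal "aug_ideal G" G.ZG by (rule G.ideal_aug_ideal)
  note c = I.Icarr
  show "p \<otimes>\<^bsub>semidirect\<^esub> q \<in> carrier semidirect" if "p \<in> carrier semidirect" "q \<in> carrier semidirect" for p q
    using that by (cases p; cases q) (simp add: I.I_l_closed)
  show "\<one>\<^bsub>semidirect\<^esub> \<in> carrier semidirect" by simp
  show "p \<otimes>\<^bsub>semidirect\<^esub> q \<otimes>\<^bsub>semidirect\<^esub> r = p \<otimes>\<^bsub>semidirect\<^esub> (q \<otimes>\<^bsub>semidirect\<^esub> r)"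
    if "p \<in> carrier semidirect" "q \<in> carrier semidirect" "r \<in> carrier semidirect" for p q r
    using that c by (cases p; cases q; cases r)
      (simp add: G.gr_single_mult G.ZG.r_distr G.ZG.a_assoc G.ZG.m_assoc G.m_assoc)
  show "\<one>\<^bsub>semidirect\<^esub> \<otimes>\<^bsub>semidirect\<^esub> p = p" if "p \<in> carrier semidirect" for p
    using that c by (cases p) (simp add: G.gr_one[symmetric])
  show "\<exists>q\<in>carrier semidirect. q \<otimes>\<^bsub>semidirect\<^esub> p = \<one>\<^bsub>semidirect\<^esub>" if "p \<in> carrier semidirect" for p
  proof -
    obtain a x where p: "p = (a, x)" by force
    show ?thesis
      by (rule bexI[of _ "(\<ominus>\<^bsub>G.ZG\<^esub> (gr_single (inv x) \<otimes>\<^bsub>G.ZG\<^esub> a), inv x)"])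
        (use that c p in \<open>simp_all add: G.ZG.l_neg I.I_l_closed\<close>)
  qed
qed

text \<open>A homomorphism to the semidirect product amounts to a derivation \<open>\<delta>\<close> along the
  endomorphism \<open>s\<close>. For \<open>c = [a, b]\<close> one has
  \<open>\<delta> c = (1 - s(c b)) \<delta> a + (s a - s c) \<delta> b\<close>.\<close>

lemma derivation_N:
  assumes \<Phi>: "\<Phi> \<in> hom G semidirect"
    and s: "\<And>x. x \<in> carrier G \<Longrightarrow> h (snd (\<Phi> x)) = h x"
    and n: "n \<ge> 1" and x: "x \<in> N n"
  shows "fst (\<Phi> x) \<in> rf_ideal n"
proof -
  define \<delta> where "\<delta> x = fst (\<Phi> x)" for x
  define t where "t x = snd (\<Phi> x)" for x
  interpret \<Phi>: group_hom G semidirect \<Phi>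
    by (simp add: group_hom_def group_hom_axioms_def group_semidirect \<Phi>)
  interpret I: ideal "aug_ideal G" G.ZG by (rule G.ideal_aug_ideal)
  have c: "\<delta> x \<in> aug_ideal G" "t x \<in> carrier G" if "x \<in> carrier G" for x
    using \<Phi>.hom_closed[OF that] unfolding \<delta>_def t_def by (metis prod.collapse semidirect_simps(1))+
  note cc = I.Icarr[OF c(1)]
  have p: "\<Phi> x = (\<delta> x, t x)" for x by (simp add: \<delta>_def t_def)
  have m: "\<delta> (x \<otimes> y) = \<delta> x \<oplus>\<^bsub>G.ZG\<^esub> gr_single (t x) \<otimes>\<^bsub>G.ZG\<^esub> \<delta> y" "t (x \<otimes> y) = t x \<otimes> t y"
    if "x \<in> carrier G" "y \<in> carrier G" for x y
    using \<Phi>.hom_mult[OF that] by (simp_all add: p)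
  have "t \<in> hom G G" by (rule homI) (use c m in auto)
  then interpret t: group_ring_hom G G t
    by (simp add: group_ring_hom_def group_hom_def group_hom_axioms_def integral_group_ring_def G.is_group)
  have one: "\<delta> \<one> = \<zero>\<^bsub>G.ZG\<^esub>" using \<Phi>.hom_one by (simp add: p)
  have tR: "t r \<in> R" if "r \<in> R" for r
    using that c(2) s by (auto simp: kernel_def t_def)
  have com: "\<delta> (a \<otimes> b \<otimes> inv a \<otimes> inv b) =
      (G.gd (t a) \<ominus>\<^bsub>G.ZG\<^esub> G.gd (t (a \<otimes> b \<otimes> inv a \<otimes> inv b))) \<otimes>\<^bsub>G.ZG\<^esub> \<delta> b
      \<ominus>\<^bsub>G.ZG\<^esub> G.gd (t (a \<otimes> b \<otimes> inv a \<otimes> inv b \<otimes> b)) \<otimes>\<^bsub>G.ZG\<^esub> \<delta> a"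
    if a: "a \<in> carrier G" and b: "b \<in> carrier G" for a b
  proof -
    let ?c = "a \<otimes> b \<otimes> inv a \<otimes> inv b"
    \<comment> \<open>Comparing derivatives in \<open>c (b a) = a b\<close> yields \<delta> of the
      commutator without computing derivatives of inverses.\<close>
    have "?c \<otimes> (b \<otimes> a) = a \<otimes> b" using a b by (simp add: G.m_assoc)
    then have "\<delta> (a \<otimes> b) = \<delta> ?c \<oplus>\<^bsub>G.ZG\<^esub> gr_single (t ?c) \<otimes>\<^bsub>G.ZG\<^esub> \<delta> (b \<otimes> a)"
      using m(1)[of ?c "b \<otimes> a"] a b by simp
    then have "\<delta> ?c = \<delta> (a \<otimes> b) \<ominus>\<^bsub>G.ZG\<^esub> gr_single (t ?c) \<otimes>\<^bsub>G.ZG\<^esub> \<delta> (b \<otimes> a)"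
      using a b cc c(2) by (simp add: G.ZG.minus_eq G.ZG.a_assoc G.ZG.r_neg)
    then show ?thesis
      using a b cc c(2)
      by (simp add: m G.gr_single_mult G.ZG.minus_eq G.ZG.l_distr G.ZG.r_distr G.ZG.l_minus G.ZG.r_minus
          G.ZG.minus_add G.ZG.m_assoc del: t.hom_mult t.hom_inv)
         (use a b cc c(2) in \<open>simp add: G.gr_add G.gr_uminus fun_eq_iff G.gr_single_mult del: t.hom_mult t.hom_inv\<close>)
  qed
  \<comment> \<open>The derivative of x y is \<open>\<delta> x\<close> plus a left multiple of
    \<open>\<delta> y\<close>, so an ideal J of allowed values gives a subgroup. It then suffices to
    treat generators.\<close>
  have sub: "subgroup {x \<in> carrier G. \<delta> x \<in> J} G" if "ideal J G.ZG" for J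
  proof -
    interpret J: ideal J G.ZG by fact
    show ?thesis
    proof (rule G.subgroupI)
      show "{x \<in> carrier G. \<delta> x \<in> J} \<noteq> {}" using one by force
      fix x assume x: "x \<in> {x \<in> carrier G. \<delta> x \<in> J}"
      have "\<delta> (inv x) \<oplus>\<^bsub>G.ZG\<^esub> gr_single (t (inv x)) \<otimes>\<^bsub>G.ZG\<^esub> \<delta> x = \<zero>\<^bsub>G.ZG\<^esub>"
        using m(1)[of "inv x" x] x one by simp
      then have "\<delta> (inv x) = \<ominus>\<^bsub>G.ZG\<^esub> (gr_single (t (inv x)) \<otimes>\<^bsub>G.ZG\<^esub> \<delta> x)"
        using x cc c(2) by (intro G.ZG.minus_equality[symmetric]) (auto simp: G.ZG.a_comm)
      then show "inv x \<in> {x \<in> carrier G. \<delta> x \<in> J}" using x c(2) by (simp add: J.I_l_closed)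
      fix y assume y: "y \<in> {x \<in> carrier G. \<delta> x \<in> J}"
      show "x \<otimes> y \<in> {x \<in> carrier G. \<delta> x \<in> J}" using x y c(2) by (simp add: m J.I_l_closed)
    qed auto
  qed
  interpret J: ideal "rf_ideal n" G.ZG by (rule ideal_rf_ideal)
  have minus: "a \<ominus>\<^bsub>G.ZG\<^esub> b \<in> K" if "ideal K G.ZG" "a \<in> K" "b \<in> K" for a b K
  proof -
    interpret K: ideal K G.ZG by fact
    show ?thesis unfolding G.ZG.minus_eq using that by simp
  qed
  have "D \<subseteq> {x \<in> carrier G. \<delta> x \<in> rf_ideal n}"
    unfolding derived_def
  proof (rule G.generate_subgroup_incl[OF _ sub[OF ideal_rf_ideal]], rule subsetI)
    fix d assume "d \<in> (\<Union>h1\<in>R. \<Union>h2\<in>R. {h1 \<otimes> h2 \<otimes> inv h1 \<otimes> inv h2})"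
    then obtain a b where ab: "a \<in> R" "b \<in> R" "d = a \<otimes> b \<otimes> inv a \<otimes> inv b" by blast
    note abc = R_carrier[OF ab(1)] R_carrier[OF ab(2)]
    have dR: "d \<in> R" "d \<otimes> b \<in> R"
      unfolding ab(3) using ab(1,2) subgroup.m_closed[OF subgroup_kernel] subgroup.m_inv_closed[OF subgroup_kernel]
      by simp_all
    have g: "G.gd (t r) \<otimes>\<^bsub>G.ZG\<^esub> \<delta> y \<in> rf_ideal n" if "r \<in> R" "y \<in> carrier G" for r y
      by (rule rf_ideal_intro(1), rule ideal_prod.prod[OF G.gd_relative_ideal[OF kernel_subset tR[OF that(1)]] c(1)[OF that(2)]])
    \<comment> \<open>Each of the three terms has on its left the difference of an element of R and
      1, because t preserves R, and on its right a value of \<delta>, which lies in f.\<close>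
    have "\<delta> d = (G.gd (t a) \<otimes>\<^bsub>G.ZG\<^esub> \<delta> b \<ominus>\<^bsub>G.ZG\<^esub> G.gd (t d) \<otimes>\<^bsub>G.ZG\<^esub> \<delta> b)
      \<ominus>\<^bsub>G.ZG\<^esub> G.gd (t (d \<otimes> b)) \<otimes>\<^bsub>G.ZG\<^esub> \<delta> a"
      using com[OF abc] abc c cc R_carrier[OF dR(1)] R_carrier[OF dR(2)] ab(3)
      by (simp add: G.ZG.minus_eq G.ZG.l_distr G.ZG.l_minus)
    also have "\<dots> \<in> rf_ideal n"
      by (intro minus[OF ideal_rf_ideal] g ab dR abc)
    finally show "d \<in> {x \<in> carrier G. \<delta> x \<in> rf_ideal n}" using R_carrier[OF dR(1)] by simp
  qed
  moreover have gam: "lower_central G (Suc k) \<subseteq> {x \<in> carrier G. \<delta> x \<in> G.augp (Suc k)}" for k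
  proof (induction k)
    case 0
    then show ?case using c(1) G.ideal_power_one[OF G.ideal_aug_ideal] by auto
  next
    case (Suc k)
    let ?I = "G.augp"
    note II = G.ideal_power_ideal[OF G.ideal_aug_ideal]
    show ?case unfolding lower_central.simps
    proof (rule G.commutator_subgroup_minimal[OF sub[OF II]])
      fix a b assume a: "a \<in> lower_central G (Suc k)" and b: "b \<in> carrier G"
      let ?c = "a \<otimes> b \<otimes> inv a \<otimes> inv b"
      have ac: "a \<in> carrier G" "\<delta> a \<in> ?I (Suc k)" using Suc a by auto
      have cl: "?c \<in> lower_central G (Suc (Suc k))" by (rule G.lower_central_commutator[OF a b])
      have gl: "G.gd (t x) \<in> ?I (Suc j)" if "x \<in> lower_central G (Suc j)" for x j
        using t.gmap_lower_central[OF that] G.lower_central_one_plus[of j] by (auto simp: G.one_plus_iff simp del: lower_central.simps ideal_power.simps)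
      \<comment> \<open>The required power arises differently in the three terms: in the first from
        t a, in the second from t of the commutator, already one step deeper in the series, and in
        the third from \<delta> a by the induction hypothesis.\<close>
      have 1: "G.gd (t a) \<otimes>\<^bsub>G.ZG\<^esub> \<delta> b \<in> ?I (Suc (Suc k))"
        by (rule Suc_ideal_power(2)[OF c(1)[OF b] gl[OF a]])
      have 2: "G.gd (t ?c) \<otimes>\<^bsub>G.ZG\<^esub> \<delta> b \<in> ?I (Suc (Suc k))"
        by (rule ideal.I_r_closed[OF II gl[OF cl] cc[OF b]])
      have 3: "G.gd (t (?c \<otimes> b)) \<otimes>\<^bsub>G.ZG\<^esub> \<delta> a \<in> ?I (Suc (Suc k))"
        by (rule Suc_ideal_power(1)[OF G.gd_aug ac(2)]) (use ac b c(2) in auto)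
      have "\<delta> ?c = (G.gd (t a) \<otimes>\<^bsub>G.ZG\<^esub> \<delta> b \<ominus>\<^bsub>G.ZG\<^esub> G.gd (t ?c) \<otimes>\<^bsub>G.ZG\<^esub> \<delta> b)
        \<ominus>\<^bsub>G.ZG\<^esub> G.gd (t (?c \<otimes> b)) \<otimes>\<^bsub>G.ZG\<^esub> \<delta> a"
        using com[OF ac(1) b] ac b c(2) cc
        by (simp add: G.ZG.minus_eq G.ZG.l_distr G.ZG.l_minus del: t.hom_mult t.hom_inv)
      also have "\<dots> \<in> ?I (Suc (Suc k))"
        by (intro minus[OF II] 1 2 3)
      finally show "?c \<in> {x \<in> carrier G. \<delta> x \<in> ?I (Suc (Suc k))}" using ac b by simp
    qed
  qed
  have "lower_central G n \<subseteq> {x \<in> carrier G. \<delta> x \<in> rf_ideal n}"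
  proof -
    obtain k where "n = Suc k" using n by (cases n) auto
    then show ?thesis using gam[of k] rf_ideal_intro(2)[of _ n] by blast
  qed
  ultimately have "N n \<subseteq> {x \<in> carrier G. \<delta> x \<in> rf_ideal n}"
    by (rule set_mult_subset[OF sub[OF ideal_rf_ideal]])
  then show ?thesis using x by (auto simp: \<delta>_def)
qed

text \<open>On the copy of G spanned by the i b the derivation is x - 1, and on the one spanned by
  the j b it is 0; the endomorphism beside it folds both copies back onto G. Write f x = y (g x)
  with y in N. Applying the derivation gives x - 1 = \<delta> y, because the contribution of g x
  vanishes, and \<open>derivation_N\<close> puts this into rf + f^n.\<close>

proposition limit_S:
  assumes B: "free_basis G B" and ij: "i \<in> B \<rightarrow> B" "j \<in> B \<rightarrow> B" "inj_on i B" "inj_on j B" "i ` B \<inter> j ` B = {}"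
    and hij: "\<And>b. b \<in> B \<Longrightarrow> h (i b) = h b" "\<And>b. b \<in> B \<Longrightarrow> h (j b) = h b"
    and f: "group_hom G G f" "\<And>b. b \<in> B \<Longrightarrow> f b = i b"
    and g: "group_hom G G g" "\<And>b. b \<in> B \<Longrightarrow> g b = j b"
    and n: "n \<ge> 1" and x: "x \<in> carrier G" and fg: "f x \<otimes> inv (g x) \<in> N n"
  shows "x \<in> S n"
proof -
  interpret f: group_hom G G f by fact
  interpret g: group_hom G G g by fact
  interpret I: ideal "aug_ideal G" G.ZG by (rule G.ideal_aug_ideal)
  have BG: "B \<subseteq> carrier G" "generate G B = carrier G" using B by (simp_all add: free_basis_def)
  have Bc: "b \<in> carrier G" if "b \<in> B" for b using BG(1) that by blast
  \<comment> \<open>Basis elements in neither half are fixed, with derivative 0. In every case the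
    second component lies over the same element of H, as \<open>derivation_N\<close>
    requires.\<close>
  define k where "k b = (if b \<in> i ` B then (G.gd (inv_into B i b), inv_into B i b)
    else (\<zero>\<^bsub>G.ZG\<^esub>, if b \<in> j ` B then inv_into B j b else b))" for b
  have ki: "k (i b) = (G.gd b, b)" if "b \<in> B" for b
    using that ij(3) by (simp add: k_def)
  have kj: "k (j b) = (\<zero>\<^bsub>G.ZG\<^esub>, b)" if "b \<in> B" for b
  proof -
    have "j b \<notin> i ` B" using ij(5) that by blast
    then show ?thesis using that ij(4) by (simp add: k_def)
  qed
  have ko: "k b = (\<zero>\<^bsub>G.ZG\<^esub>, b)" if "b \<notin> i ` B" "b \<notin> j ` B" for b
    using that by (simp add: k_def)
  have cases: "(\<exists>a\<in>B. b = i a) \<or> (\<exists>a\<in>B. b = j a) \<or> (b \<notin> i ` B \<and> b \<notin> j ` B)" for b by blast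
  have kB: "k b \<in> carrier semidirect \<and> h (snd (k b)) = h b" if b: "b \<in> B" for b
    using cases[of b] ki kj ko Bc b hij by (auto simp: G.gd_aug)
  obtain \<Phi> where \<Phi>: "\<Phi> \<in> hom G semidirect" "\<And>b. b \<in> B \<Longrightarrow> \<Phi> b = k b"
    using free_basis_hom[OF G.is_group group_semidirect B, of k] kB by blast
  interpret \<Phi>: group_hom G semidirect \<Phi>
    by (simp add: group_hom_def group_hom_axioms_def group_semidirect \<Phi>)
  have sc: "snd p \<in> carrier G" if "p \<in> carrier semidirect" for p using that by (cases p) simp
  have hs: "h (snd (\<Phi> y)) = h y" if "y \<in> carrier G" for y
  proof (rule G.generate_hom_eqI[OF BG(1)])
    show "group_hom G H (\<lambda>y. h (snd (\<Phi> y)))"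
    proof (intro group_hom.intro group_hom_axioms.intro homI)
      fix a b assume a: "a \<in> carrier G" and b: "b \<in> carrier G"
      have "snd (\<Phi> (a \<otimes> b)) = snd (\<Phi> a) \<otimes> snd (\<Phi> b)"
        using \<Phi>.hom_mult[OF a b] by (cases "\<Phi> a"; cases "\<Phi> b") simp
      then show "h (snd (\<Phi> (a \<otimes> b))) = h (snd (\<Phi> a)) \<otimes>\<^bsub>H\<^esub> h (snd (\<Phi> b))"
        using sc[OF \<Phi>.hom_closed[OF a]] sc[OF \<Phi>.hom_closed[OF b]] by simp
    next
      fix a assume a: "a \<in> carrier G"
      show "h (snd (\<Phi> a)) \<in> carrier H" using sc[OF \<Phi>.hom_closed[OF a]] by simp
    qed (rule G.is_group, rule H.is_group)
    show "group_hom G H h" by (rule group_hom_axioms)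
    show "h (snd (\<Phi> b)) = h b" if "b \<in> B" for b using kB[OF that] \<Phi>(2)[OF that] by simp
    show "y \<in> generate G B" using BG(2) that by simp
  qed
  have fx: "\<Phi> (f x) = (G.gd x, x)"
  proof (rule G.generate_hom_eqI[OF BG(1)])
    show "group_hom G semidirect (\<lambda>y. \<Phi> (f y))"
      by (intro group_hom.intro group_hom_axioms.intro homI) (auto simp: G.is_group group_semidirect simp del: semidirect_simps)
    show "group_hom G semidirect (\<lambda>y. (G.gd y, y))"
    proof (intro group_hom.intro group_hom_axioms.intro homI)
      fix a b assume a: "a \<in> carrier G" and b: "b \<in> carrier G"
      show "(G.gd (a \<otimes> b), a \<otimes> b) = (G.gd a, a) \<otimes>\<^bsub>semidirect\<^esub> (G.gd b, b)"
        unfolding G.gd_mult(2)[OF a b] by simp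
    qed (auto simp: G.is_group group_semidirect G.gd_aug)
    show "\<Phi> (f b) = (G.gd b, b)" if "b \<in> B" for b
    proof -
      have "i b \<in> B" using ij(1) that by blast
      then show ?thesis using f(2)[OF that] \<Phi>(2) ki[OF that] by simp
    qed
    show "x \<in> generate G B" using BG(2) x by simp
  qed
  have gx: "\<Phi> (g x) = (\<zero>\<^bsub>G.ZG\<^esub>, x)"
  proof (rule G.generate_hom_eqI[OF BG(1)])
    show "group_hom G semidirect (\<lambda>y. \<Phi> (g y))"
      by (intro group_hom.intro group_hom_axioms.intro homI) (auto simp: G.is_group group_semidirect simp del: semidirect_simps)
    show "group_hom G semidirect (\<lambda>y. (\<zero>\<^bsub>G.ZG\<^esub>, y))"
      by (intro group_hom.intro group_hom_axioms.intro homI) (auto simp: G.is_group group_semidirect)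
    show "\<Phi> (g b) = (\<zero>\<^bsub>G.ZG\<^esub>, b)" if "b \<in> B" for b
    proof -
      have "j b \<in> B" using ij(2) that by blast
      then show ?thesis using g(2)[OF that] \<Phi>(2) kj[OF that] by simp
    qed
    show "x \<in> generate G B" using BG(2) x by simp
  qed
  let ?y = "f x \<otimes> inv (g x)"
  have "f x = ?y \<otimes> g x" using x by (simp add: G.m_assoc)
  then have "\<Phi> (f x) = \<Phi> ?y \<otimes>\<^bsub>semidirect\<^esub> \<Phi> (g x)"
    using \<Phi>.hom_mult[of ?y "g x"] x by simp
  moreover obtain a y' where p: "\<Phi> ?y = (a, y')" by force
  moreover have "\<Phi> ?y \<in> carrier semidirect" using x by (intro \<Phi>.hom_closed) simp
  ultimately have "G.gd x = a" using fx gx by (simp add: I.Icarr)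
  moreover have "fst (\<Phi> ?y) \<in> rf_ideal n" by (rule derivation_N[OF \<Phi>(1) hs n fg])
  ultimately show ?thesis using x p by (simp add: G.one_plus_iff)
qed

end

section \<open>Morphisms of presentations\<close>

lemma ex_pres_mor:
  assumes G: "group G" and c: "c \<in> presentations G" and d: "d \<in> presentations G"
    and B: "free_basis (fgrp c) B" and f: "f \<in> B \<rightarrow> carrier (fgrp d)"
    and pf: "\<And>b. b \<in> B \<Longrightarrow> proj d (f b) = proj c b"
  obtains \<alpha> where "\<alpha> \<in> pres_mors G" "pdom \<alpha> = c" "pcod \<alpha> = d" "\<And>b. b \<in> B \<Longrightarrow> pmap \<alpha> b = f b"
proof -
  interpret c: group_ring_epi "fgrp c" G "proj c" by (rule presentation_epi[OF G c])
  interpret d: group_ring_epi "fgrp d" G "proj d" by (rule presentation_epi[OF G d])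
  have BG: "B \<subseteq> carrier (fgrp c)" "generate (fgrp c) B = carrier (fgrp c)" using B by (simp_all add: free_basis_def)
  obtain \<phi> where \<phi>: "\<phi> \<in> hom (fgrp c) (fgrp d)" "\<And>b. b \<in> B \<Longrightarrow> \<phi> b = f b"
    using free_basis_hom[OF c.G.is_group d.G.is_group B f] by blast
  interpret \<phi>: group_hom "fgrp c" "fgrp d" \<phi>
    by (simp add: group_hom_def group_hom_axioms_def \<phi> c.G.is_group d.G.is_group)
  have p: "proj d (\<phi> x) = proj c x" if x: "x \<in> carrier (fgrp c)" for x
  proof (rule c.G.generate_hom_eqI[OF BG(1)])
    show "group_hom (fgrp c) G (\<lambda>x. proj d (\<phi> x))"
      by (intro group_hom.intro group_hom_axioms.intro homI) (auto simp: c.G.is_group G)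
    show "group_hom (fgrp c) G (proj c)" by (rule c.group_hom_axioms)
    show "proj d (\<phi> b) = proj c b" if "b \<in> B" for b using pf[OF that] \<phi>(2)[OF that] by simp
    show "x \<in> generate (fgrp c) B" using BG x by simp
  qed
  define \<alpha> where "\<alpha> = \<lparr>pdom = c, pcod = d, pmap = restrict \<phi> (carrier (fgrp c))\<rparr>"
  have "\<alpha> \<in> pres_mors G"
    using c d p by (auto simp: \<alpha>_def pres_mors_def hom_def)
  then show ?thesis using that BG(1) \<phi>(2) by (simp add: \<alpha>_def subset_iff)
qed

lemma pres_mor_eqI:
  assumes \<alpha>: "\<alpha> \<in> pres_mors G" and \<beta>: "\<beta> \<in> pres_mors G" and "pdom \<alpha> = pdom \<beta>" "pcod \<alpha> = pcod \<beta>"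
    and B: "free_basis (fgrp (pdom \<alpha>)) B" and eq: "\<And>b. b \<in> B \<Longrightarrow> pmap \<alpha> b = pmap \<beta> b"
  shows "\<alpha> = \<beta>"
proof -
  have BG: "B \<subseteq> carrier (fgrp (pdom \<alpha>))" "generate (fgrp (pdom \<alpha>)) B = carrier (fgrp (pdom \<alpha>))"
    using B by (simp_all add: free_basis_def)
  have "group_hom (fgrp (pdom \<alpha>)) (fgrp (pcod \<alpha>)) (pmap \<beta>)"
    using pres_mor_group_hom[OF \<beta>] assms(3,4) by simp
  then have "pmap \<alpha> x = pmap \<beta> x" if "x \<in> carrier (fgrp (pdom \<alpha>))" for x
    using group.generate_hom_eqI[OF presentation_group[OF pres_mor_ends(1)[OF \<alpha>]] BG(1)
        pres_mor_group_hom[OF \<alpha>] _ eq] that BG(2) by simp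
  moreover have "pmap \<alpha> \<in> extensional (carrier (fgrp (pdom \<alpha>)))" "pmap \<beta> \<in> extensional (carrier (fgrp (pdom \<alpha>)))"
    using \<alpha> \<beta> assms(3) by (simp_all add: pres_mors_def)
  ultimately have "pmap \<alpha> = pmap \<beta>" by (metis extensionalityI)
  then show ?thesis using assms(3,4) by (cases \<alpha>; cases \<beta>) simp
qed

text \<open>Send each basis element of c to some preimage in d of its image in G.\<close>

lemma pres_connected:
  assumes G: "group G" and c: "c \<in> presentations G" and d: "d \<in> presentations G"
  obtains \<alpha> where "\<alpha> \<in> pres_mors G" "pdom \<alpha> = c" "pcod \<alpha> = d"
proof -
  interpret c: group_ring_epi "fgrp c" G "proj c" by (rule presentation_epi[OF G c])
  interpret d: group_ring_epi "fgrp d" G "proj d" by (rule presentation_epi[OF G d])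
  obtain B where B: "free_basis (fgrp c) B" using c by (auto simp: presentations_def free_group_def)
  have BG: "B \<subseteq> carrier (fgrp c)" using B by (simp add: free_basis_def)
  obtain \<alpha> where "\<alpha> \<in> pres_mors G" "pdom \<alpha> = c" "pcod \<alpha> = d"
    by (rule ex_pres_mor[OF G c d B, of "\<lambda>b. inv_into (carrier (fgrp d)) (proj d) (proj c b)"])
       (use BG in \<open>auto simp: subset_iff\<close>)
  then show ?thesis using that by blast
qed

text \<open>Here \<iota> and \<kappa> are the endomorphisms of u induced by i and j. The two halves
  of the basis serve for simple connectedness and for the Fox derivative. The assumption
  \<open>onto\<close> provides a basis element over each element of G, from which the colimit of F/N
  is computed.\<close>

locale split_presentation = G: group G for G :: "'a monoid" +
  fixes u :: "('f, 'a) presentation" and B i j \<iota> \<kappa>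
  assumes u: "u \<in> presentations G" and B: "free_basis (fgrp u) B"
    and ij: "i \<in> B \<rightarrow> B" "j \<in> B \<rightarrow> B" "inj_on i B" "inj_on j B" "i ` B \<inter> j ` B = {}"
    and pij: "\<And>b. b \<in> B \<Longrightarrow> proj u (i b) = proj u b" "\<And>b. b \<in> B \<Longrightarrow> proj u (j b) = proj u b"
    and onto: "proj u ` B = carrier G"
    and \<iota>: "\<iota> \<in> pres_mors G" "pdom \<iota> = u" "pcod \<iota> = u" "\<And>b. b \<in> B \<Longrightarrow> pmap \<iota> b = i b"
    and \<kappa>: "\<kappa> \<in> pres_mors G" "pdom \<kappa> = u" "pcod \<kappa> = u" "\<And>b. b \<in> B \<Longrightarrow> pmap \<kappa> b = j b"

lemma ex_split_presentation_locale:
  fixes G :: "'a monoid"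
  assumes G: "group G" and inf: "infinite (UNIV :: 'f set)" and emb: "inj_on (e :: 'a \<Rightarrow> 'f) (carrier G)"
  obtains u :: "('f, 'a) presentation" and B i j \<iota> \<kappa> where "split_presentation G u B i j \<iota> \<kappa>"
proof -
  obtain u :: "('f, 'a) presentation" and B i j where u: "u \<in> presentations G" "free_basis (fgrp u) B"
    "i \<in> B \<rightarrow> B" "j \<in> B \<rightarrow> B" "inj_on i B" "inj_on j B" "i ` B \<inter> j ` B = {}"
    "\<And>b. b \<in> B \<Longrightarrow> proj u (i b) = proj u b" "\<And>b. b \<in> B \<Longrightarrow> proj u (j b) = proj u b"
    "proj u ` B = carrier G"
    by (rule ex_split_presentation[OF G inf emb]) blast
  have BG: "B \<subseteq> carrier (fgrp u)" using u(2) by (simp add: free_basis_def)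
  have f: "i \<in> B \<rightarrow> carrier (fgrp u)" "j \<in> B \<rightarrow> carrier (fgrp u)" using u(3,4) BG by blast+
  obtain \<iota> where "\<iota> \<in> pres_mors G" "pdom \<iota> = u" "pcod \<iota> = u" "\<And>b. b \<in> B \<Longrightarrow> pmap \<iota> b = i b"
    by (rule ex_pres_mor[OF G u(1,1,2) f(1)]) (use u(8) in auto)
  moreover obtain \<kappa> where "\<kappa> \<in> pres_mors G" "pdom \<kappa> = u" "pcod \<kappa> = u" "\<And>b. b \<in> B \<Longrightarrow> pmap \<kappa> b = j b"
    by (rule ex_pres_mor[OF G u(1,1,2) f(2)]) (use u(9) in auto)
  ultimately have "split_presentation G u B i j \<iota> \<kappa>"
    using u G by (simp add: split_presentation_def split_presentation_axioms_def)
  then show ?thesis using that by blast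
qed

context split_presentation
begin

lemma B_carrier: "b \<in> B \<Longrightarrow> b \<in> carrier (fgrp u)"
  using B by (auto simp: free_basis_def)

text \<open>The two halves of the basis are disjoint, so a map can be prescribed on them
  independently; basis elements in neither half are fixed. This is the existence part of the
  universal property of a coproduct.\<close>

lemma copair:
  assumes \<alpha>: "\<alpha> \<in> pres_mors G" "pdom \<alpha> = u" "pcod \<alpha> = u"
    and \<beta>: "\<beta> \<in> pres_mors G" "pdom \<beta> = u" "pcod \<beta> = u"
  obtains \<gamma> where "\<gamma> \<in> pres_mors G" "pdom \<gamma> = u" "pcod \<gamma> = u"
    "Comp (Pres T G) \<gamma> \<iota> = \<alpha>" "Comp (Pres T G) \<gamma> \<kappa> = \<beta>"
proof -
  interpret a: group_hom "fgrp u" "fgrp u" "pmap \<alpha>" using pres_mor_group_hom[OF \<alpha>(1)] \<alpha> by simp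
  interpret b: group_hom "fgrp u" "fgrp u" "pmap \<beta>" using pres_mor_group_hom[OF \<beta>(1)] \<beta> by simp
  define f where "f b = (if b \<in> i ` B then pmap \<alpha> (inv_into B i b)
    else if b \<in> j ` B then pmap \<beta> (inv_into B j b) else b)" for b
  have fi: "f (i b) = pmap \<alpha> b" if "b \<in> B" for b using that ij(3) by (simp add: f_def)
  have fj: "f (j b) = pmap \<beta> b" if "b \<in> B" for b
  proof -
    have "j b \<notin> i ` B" using ij(5) that by blast
    then show ?thesis using that ij(4) by (simp add: f_def)
  qed
  have fo: "f b = b" if "b \<notin> i ` B" "b \<notin> j ` B" for b using that by (simp add: f_def)
  have pa: "proj u (pmap \<alpha> b) = proj u b" "proj u (pmap \<beta> b) = proj u b" if "b \<in> B" for b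
    using pres_mor_proj[OF \<alpha>(1)] pres_mor_proj[OF \<beta>(1)] \<alpha> \<beta> B_carrier[OF that] by auto
  have cases: "(\<exists>a\<in>B. b = i a) \<or> (\<exists>a\<in>B. b = j a) \<or> (b \<notin> i ` B \<and> b \<notin> j ` B)" for b by blast
  have f: "f b \<in> carrier (fgrp u) \<and> proj u (f b) = proj u b" if b: "b \<in> B" for b
    using cases[of b] fi fj fo B_carrier b pij pa by auto
  obtain \<gamma> where \<gamma>: "\<gamma> \<in> pres_mors G" "pdom \<gamma> = u" "pcod \<gamma> = u" "\<And>b. b \<in> B \<Longrightarrow> pmap \<gamma> b = f b"
    by (rule ex_pres_mor[OF G.is_group u u B, of f]) (use f in auto)
  have "Comp (Pres T G) \<gamma> \<iota> = \<alpha>"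
  proof (rule pres_mor_eqI)
    show "Comp (Pres T G) \<gamma> \<iota> \<in> pres_mors G" by (rule pres_mor_comp) (use \<gamma> \<iota> in simp_all)
    show "free_basis (fgrp (pdom (Comp (Pres T G) \<gamma> \<iota>))) B" using \<iota> B by simp
    show "pmap (Comp (Pres T G) \<gamma> \<iota>) b = pmap \<alpha> b" if "b \<in> B" for b
    proof -
      have "i b \<in> B" using ij(1) that by blast
      then show ?thesis using B_carrier[OF that] \<iota> \<gamma>(4) fi that by (simp add: compose_def)
    qed
  qed (use \<alpha> \<gamma> \<iota> in simp_all)
  moreover have "Comp (Pres T G) \<gamma> \<kappa> = \<beta>"
  proof (rule pres_mor_eqI)
    show "Comp (Pres T G) \<gamma> \<kappa> \<in> pres_mors G" by (rule pres_mor_comp) (use \<gamma> \<kappa> in simp_all)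
    show "free_basis (fgrp (pdom (Comp (Pres T G) \<gamma> \<kappa>))) B" using \<kappa> B by simp
    show "pmap (Comp (Pres T G) \<gamma> \<kappa>) b = pmap \<beta> b" if "b \<in> B" for b
    proof -
      have "j b \<in> B" using ij(2) that by blast
      then show ?thesis using B_carrier[OF that] \<kappa> \<gamma>(4) fj that by (simp add: compose_def)
    qed
  qed (use \<beta> \<gamma> \<kappa> in simp_all)
  ultimately show ?thesis using that \<gamma> by blast
qed

text \<open>The category of presentations is simply connected: parallel endomorphisms of \<open>u\<close> factor
  through \<open>\<iota>\<close> and \<open>\<kappa>\<close>, which have a common retraction.\<close>

proposition pres_constant_cocycles:
  fixes H :: "('h, 'z) monoid_scheme" and T :: "'f itself" and t :: "('f, 'a) pres_mor \<Rightarrow> 'h"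
  assumes H: "group H" and t: "\<And>\<alpha>. \<alpha> \<in> pres_mors G \<Longrightarrow> t \<alpha> \<in> carrier H"
    and comp: "\<And>\<alpha> \<beta>. \<alpha> \<in> pres_mors G \<Longrightarrow> \<beta> \<in> pres_mors G \<Longrightarrow> pdom \<alpha> = pcod \<beta> \<Longrightarrow>
      t (Comp (Pres T G) \<alpha> \<beta>) = t \<alpha> \<otimes>\<^bsub>H\<^esub> t \<beta>"
  shows "\<exists>k. (\<forall>c\<in>presentations G. k c \<in> carrier H) \<and>
    (\<forall>\<alpha>\<in>pres_mors G. t \<alpha> = k (pcod \<alpha>) \<otimes>\<^bsub>H\<^esub> inv\<^bsub>H\<^esub> k (pdom \<alpha>))"
proof -
  interpret H: group H by fact
  \<comment> \<open>\<epsilon> is the identity of u, given by its values on the basis. Being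
    idempotent, it has value 1 under t.\<close>
  obtain \<epsilon> where \<epsilon>: "\<epsilon> \<in> pres_mors G" "pdom \<epsilon> = u" "pcod \<epsilon> = u" "\<And>b. b \<in> B \<Longrightarrow> pmap \<epsilon> b = b"
    by (rule ex_pres_mor[OF G.is_group u u B, of "\<lambda>b. b"]) (use B_carrier in auto)
  have "Comp (Pres T G) \<epsilon> \<epsilon> = \<epsilon>"
  proof (rule pres_mor_eqI)
    show "Comp (Pres T G) \<epsilon> \<epsilon> \<in> pres_mors G" by (rule pres_mor_comp) (use \<epsilon> in simp_all)
    show "free_basis (fgrp (pdom (Comp (Pres T G) \<epsilon> \<epsilon>))) B" using \<epsilon> B by simp
    show "pmap (Comp (Pres T G) \<epsilon> \<epsilon>) b = pmap \<epsilon> b" if "b \<in> B" for b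
      using B_carrier[OF that] \<epsilon> that by (simp add: compose_def)
  qed (use \<epsilon> in simp_all)
  then have "t \<epsilon> \<otimes>\<^bsub>H\<^esub> t \<epsilon> = t \<epsilon>" using comp[OF \<epsilon>(1,1)] \<epsilon> by simp
  then have t\<epsilon>: "t \<epsilon> = \<one>\<^bsub>H\<^esub>" using t[OF \<epsilon>(1)] by simp
  \<comment> \<open>\<mu> is the folding map, a common retraction of \<iota> and \<kappa>.
    Cancelling its value shows that t agrees on them.\<close>
  obtain \<mu> where \<mu>: "\<mu> \<in> pres_mors G" "pdom \<mu> = u" "pcod \<mu> = u"
    "Comp (Pres T G) \<mu> \<iota> = \<epsilon>" "Comp (Pres T G) \<mu> \<kappa> = \<epsilon>"
    by (rule copair[OF \<epsilon>(1-3) \<epsilon>(1-3), of T])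
  have "t \<mu> \<otimes>\<^bsub>H\<^esub> t \<iota> = t \<mu> \<otimes>\<^bsub>H\<^esub> t \<kappa>"
    using comp[OF \<mu>(1) \<iota>(1)] comp[OF \<mu>(1) \<kappa>(1)] \<mu> \<iota> \<kappa> by simp
  then have t\<iota>: "t \<iota> = t \<kappa>" using t[OF \<mu>(1)] t[OF \<iota>(1)] t[OF \<kappa>(1)] by simp
  \<comment> \<open>Extend \<alpha> on the first half and the identity on the second half to one map
    \<gamma>. As t agrees on \<iota> and \<kappa>, it agrees on the two composites \<alpha> and
    \<epsilon>.\<close>
  have endo: "t \<alpha> = \<one>\<^bsub>H\<^esub>" if \<alpha>: "\<alpha> \<in> pres_mors G" "pdom \<alpha> = u" "pcod \<alpha> = u" for \<alpha>
  proof -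
    obtain \<gamma> where \<gamma>: "\<gamma> \<in> pres_mors G" "pdom \<gamma> = u" "pcod \<gamma> = u"
      "Comp (Pres T G) \<gamma> \<iota> = \<alpha>" "Comp (Pres T G) \<gamma> \<kappa> = \<epsilon>"
      by (rule copair[OF \<alpha> \<epsilon>(1-3), of T])
    have "t \<alpha> = t \<epsilon>"
      using comp[OF \<gamma>(1) \<iota>(1)] comp[OF \<gamma>(1) \<kappa>(1)] \<gamma> \<iota> \<kappa> t\<iota> by simp
    then show ?thesis using t\<epsilon> by simp
  qed
  have "\<forall>c\<in>presentations G. \<exists>\<alpha>\<in>pres_mors G. pdom \<alpha> = u \<and> pcod \<alpha> = c"
    using pres_connected[OF G.is_group u] by metis
  then obtain v where v: "\<And>c. c \<in> presentations G \<Longrightarrow> v c \<in> pres_mors G \<and> pdom (v c) = u \<and> pcod (v c) = c"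
    by metis
  have "\<forall>c\<in>presentations G. \<exists>\<alpha>\<in>pres_mors G. pdom \<alpha> = c \<and> pcod \<alpha> = u"
    using pres_connected[OF G.is_group _ u] by metis
  then obtain w where w: "\<And>c. c \<in> presentations G \<Longrightarrow> w c \<in> pres_mors G \<and> pdom (w c) = c \<and> pcod (w c) = u"
    by metis
  have wv: "t (w c) \<otimes>\<^bsub>H\<^esub> t (v c) = \<one>\<^bsub>H\<^esub>" if c: "c \<in> presentations G" for c
    using comp[of "w c" "v c"] w[OF c] v[OF c] endo[of "Comp (Pres T G) (w c) (v c)"]
      pres_mor_comp[of "w c" G "v c" T] by simp
  \<comment> \<open>The potential at c is t of a chosen morphism from u to c. Closing up with a
    morphism back to u turns both sides into endomorphisms of u, on which t is trivial.\<close>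
  have "t \<alpha> = t (v (pcod \<alpha>)) \<otimes>\<^bsub>H\<^esub> inv\<^bsub>H\<^esub> t (v (pdom \<alpha>))" if \<alpha>: "\<alpha> \<in> pres_mors G" for \<alpha>
  proof -
    note e = pres_mor_ends[OF \<alpha>]
    note c = t[OF \<alpha>] t[OF conjunct1[OF v[OF e(1)]]] t[OF conjunct1[OF v[OF e(2)]]] t[OF conjunct1[OF w[OF e(2)]]]
    have m: "Comp (Pres T G) \<alpha> (v (pdom \<alpha>)) \<in> pres_mors G"
      by (rule pres_mor_comp) (use \<alpha> v[OF e(1)] in simp_all)
    have m': "Comp (Pres T G) (w (pcod \<alpha>)) (Comp (Pres T G) \<alpha> (v (pdom \<alpha>))) \<in> pres_mors G"
      by (rule pres_mor_comp) (use m w[OF e(2)] in simp_all)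
    have "t (w (pcod \<alpha>)) \<otimes>\<^bsub>H\<^esub> (t \<alpha> \<otimes>\<^bsub>H\<^esub> t (v (pdom \<alpha>))) = t (Comp (Pres T G) (w (pcod \<alpha>)) (Comp (Pres T G) \<alpha> (v (pdom \<alpha>))))"
      using comp[OF conjunct1[OF w[OF e(2)]] m] comp[OF \<alpha> conjunct1[OF v[OF e(1)]]] w[OF e(2)] v[OF e(1)] by simp
    also have "\<dots> = \<one>\<^bsub>H\<^esub>" by (rule endo[OF m']) (use w[OF e(2)] v[OF e(1)] in simp_all)
    also have "\<dots> = t (w (pcod \<alpha>)) \<otimes>\<^bsub>H\<^esub> t (v (pcod \<alpha>))" using wv[OF e(2)] by simp
    finally have "t \<alpha> \<otimes>\<^bsub>H\<^esub> t (v (pdom \<alpha>)) = t (v (pcod \<alpha>))" using c by simp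
    then have "t (v (pcod \<alpha>)) \<otimes>\<^bsub>H\<^esub> inv\<^bsub>H\<^esub> t (v (pdom \<alpha>)) = t \<alpha>" using c by (metis H.inv_solve_right H.m_closed)
    then show ?thesis by simp
  qed
  moreover have "t (v c) \<in> carrier H" if "c \<in> presentations G" for c using t v[OF that] by blast
  ultimately show ?thesis by (intro exI[of _ "\<lambda>c. t (v c)"]) blast
qed

end

section \<open>Colimits and boundary limits\<close>

lemma UN2_const:
  "a \<in> A \<Longrightarrow> b \<in> B \<Longrightarrow> (\<And>p q. p \<in> A \<Longrightarrow> q \<in> B \<Longrightarrow> f p q = S) \<Longrightarrow> (\<Union>p\<in>A. \<Union>q\<in>B. f p q) = S"
  by (rule equalityI) (auto simp del: Image_singleton_iff)

context group_valued_functor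
begin

lemma colim_rel_words: "(v, w) \<in> colim_rel C F \<Longrightarrow> v \<in> colim_words C F \<and> w \<in> colim_words C F"
proof (induction rule: colim_rel.induct)
  case (one c)
  then show ?case using monoid.one_closed[OF group.is_monoid[OF group_fob[OF one]]] by (simp add: colim_words_def)
next
  case (mult c x y)
  then show ?case using monoid.m_closed[OF group.is_monoid[OF group_fob[OF mult(1)]]] by (simp add: colim_words_def)
qed (auto simp: colim_words_def)

lemma equiv_colim_rel: "equiv (colim_words C F) (colim_rel C F)"
proof (rule equivI)
  show "colim_rel C F \<subseteq> colim_words C F \<times> colim_words C F" using colim_rel_words by auto
  show "refl_on (colim_words C F) (colim_rel C F)"
    using colim_rel_words by (auto intro!: refl_onI colim_rel.refl)
  show "Relation.sym (colim_rel C F)" by (rule symI) (rule colim_rel.sym)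
  show "Relation.trans (colim_rel C F)" by (rule transI) (rule colim_rel.trans)
qed

abbreviation cls where "cls w \<equiv> colim_rel C F `` {w}"

lemma cls_eqI: "(v, w) \<in> colim_rel C F \<Longrightarrow> cls v = cls w"
  by (rule equiv_class_eq[OF equiv_colim_rel])

lemma colim_mult:
  assumes "v \<in> colim_words C F" "w \<in> colim_words C F"
  shows "cls v \<otimes>\<^bsub>colim_group C F\<^esub> cls w = cls (v @ w)"
proof -
  have "cls (v' @ w') = cls (v @ w)" if "v' \<in> cls v" "w' \<in> cls w" for v' w'
    using that by (intro cls_eqI[symmetric] colim_rel.append) auto
  moreover have "v \<in> cls v" "w \<in> cls w" using assms by (auto intro: colim_rel.refl)
  ultimately have "(\<Union>v'\<in>cls v. \<Union>w'\<in>cls w. cls (v' @ w')) = cls (v @ w)"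
    by (intro UN2_const)
  then show ?thesis by (simp only: colim_group_def monoid.simps)
qed

abbreviation cin where "cin \<equiv> colim_in C F"

lemma singleton_word: "c \<in> Ob C \<Longrightarrow> x \<in> carrier (fob F c) \<Longrightarrow> [(c, x)] \<in> colim_words C F"
  by (simp add: colim_words_def)

lemma cin_mult:
  assumes "c \<in> Ob C" "x \<in> carrier (fob F c)" "y \<in> carrier (fob F c)"
  shows "cin c x \<otimes>\<^bsub>colim_group C F\<^esub> cin c y = cin c (x \<otimes>\<^bsub>fob F c\<^esub> y)"
  unfolding colim_in_def colim_mult[OF singleton_word[OF assms(1,2)] singleton_word[OF assms(1,3)]]
  by (rule cls_eqI) (simp add: colim_rel.mult assms)

lemma cin_one:
  assumes "c \<in> Ob C" shows "\<one>\<^bsub>colim_group C F\<^esub> = cin c \<one>\<^bsub>fob F c\<^esub>"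
  unfolding colim_in_def colim_group_def by (simp add: cls_eqI[OF colim_rel.one[OF assms]])

lemma cin_fmor:
  assumes "\<alpha> \<in> Mor C" "x \<in> carrier (fob F (Dom C \<alpha>))"
  shows "cin (Cod C \<alpha>) (fmor F \<alpha> x) = cin (Dom C \<alpha>) x"
  unfolding colim_in_def by (rule cls_eqI[OF colim_rel.mor[OF assms]])

text \<open>The fold over a word respects every rule that generates \<open>colim_rel\<close>, so it
  is constant on classes and \<open>the_elem\<close> is applied to a singleton.\<close>

lemma colim_desc_cin:
  assumes H: "group H" and \<phi>: "\<And>c. c \<in> Ob C \<Longrightarrow> \<phi> c \<in> hom (fob F c) H"
    and nat: "\<And>\<alpha> x. \<alpha> \<in> Mor C \<Longrightarrow> x \<in> carrier (fob F (Dom C \<alpha>)) \<Longrightarrow> \<phi> (Cod C \<alpha>) (fmor F \<alpha> x) = \<phi> (Dom C \<alpha>) x"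
    and c: "c \<in> Ob C" and x: "x \<in> carrier (fob F c)"
  shows "colim_desc H \<phi> (cin c x) = \<phi> c x"
proof -
  interpret H: group H by fact
  define f where "f w = foldr (\<lambda>(c, x) h. \<phi> c x \<otimes>\<^bsub>H\<^esub> h) w \<one>\<^bsub>H\<^esub>" for w
  have gh: "group_hom (fob F c) H (\<phi> c)" if "c \<in> Ob C" for c
    using that \<phi> by (simp add: group_hom_def group_hom_axioms_def H)
  have fN: "f [] = \<one>\<^bsub>H\<^esub>" and fC: "f ((c, x) # w) = \<phi> c x \<otimes>\<^bsub>H\<^esub> f w" for c x w
    by (simp_all add: f_def)
  have fcl: "f w \<in> carrier H" if "w \<in> colim_words C F" for w
    using that group_hom.hom_closed[OF gh]
    by (induction w) (auto simp: fN fC colim_words_def)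
  have fapp: "f (v @ w) = f v \<otimes>\<^bsub>H\<^esub> f w" if "v \<in> colim_words C F" "w \<in> colim_words C F" for v w
    using that(1)
  proof (induction v)
    case (Cons a v)
    obtain c x where a: "a = (c, x)" by force
    have "c \<in> Ob C" "x \<in> carrier (fob F c)" "v \<in> colim_words C F"
      using Cons.prems a by (auto simp: colim_words_def)
    then show ?case using Cons.IH fcl that(2) group_hom.hom_closed[OF gh] a by (simp add: fC H.m_assoc)
  qed (use fcl[OF that(2)] in \<open>simp add: fN\<close>)
  have inv: "f v = f w" if "(v, w) \<in> colim_rel C F" for v w
    using that
  proof (induction rule: colim_rel.induct)
    case (append u u' v v')
    then show ?case using colim_rel_words[OF append(1)] colim_rel_words[OF append(2)] by (simp add: fapp)
  next
    case (one c)
    then show ?case using group_hom.hom_one[OF gh[OF one]] by (simp add: fN fC)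
  next
    case (mult c x y)
    then show ?case using group_hom.hom_mult[OF gh[OF mult(1)]] group_hom.hom_closed[OF gh[OF mult(1)]]
      by (simp add: fN fC)
  next
    case (mor \<alpha> x)
    then show ?case using nat by (simp add: fN fC)
  qed simp_all
  have "f ` cin c x = {f [(c, x)]}"
  proof -
    have "[(c, x)] \<in> cin c x" unfolding colim_in_def using colim_rel.refl[OF singleton_word[OF c x]] by blast
    moreover have "f w = f [(c, x)]" if "w \<in> cin c x" for w
      using that inv unfolding colim_in_def by auto
    ultimately show ?thesis by blast
  qed
  then have "colim_desc H \<phi> (cin c x) = f [(c, x)]"
    unfolding colim_desc_def f_def by simp
  also have "\<dots> = \<phi> c x" using group_hom.hom_closed[OF gh[OF c] x] by (simp add: fN fC)
  finally show ?thesis .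
qed

lemma lim_group_iff:
  "x \<in> carrier (lim_group C F) \<longleftrightarrow> x \<in> carrier families \<and> (\<forall>\<alpha>\<in>Mor C. fmor F \<alpha> (x (Dom C \<alpha>)) = x (Cod C \<alpha>))"
  by (simp add: lim_group_def)

lemma subgroup_lim: "subgroup (carrier (lim_group C F)) families"
proof -
  interpret P: group families by simp
  show ?thesis
  proof (rule P.subgroupI)
    show "carrier (lim_group C F) \<subseteq> carrier families" by (auto simp only: lim_group_iff)
    have "\<one>\<^bsub>families\<^esub> \<in> carrier (lim_group C F)"
      unfolding lim_group_iff using P.one_closed by simp
    then show "carrier (lim_group C F) \<noteq> {}" by blast
    fix x assume x: "x \<in> carrier (lim_group C F)"
    then have xf: "x \<in> carrier families" by (simp only: lim_group_iff)
    show "inv\<^bsub>families\<^esub> x \<in> carrier (lim_group C F)"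
      unfolding lim_group_iff
    proof
      show "inv\<^bsub>families\<^esub> x \<in> carrier families" by (rule P.inv_closed[OF xf])
      show "\<forall>\<alpha>\<in>Mor C. fmor F \<alpha> ((inv\<^bsub>families\<^esub> x) (Dom C \<alpha>)) = (inv\<^bsub>families\<^esub> x) (Cod C \<alpha>)"
        using x family_closed[OF xf] xf unfolding lim_group_iff by simp
    qed
    fix y assume y: "y \<in> carrier (lim_group C F)"
    then have yf: "y \<in> carrier families" by (simp only: lim_group_iff)
    show "x \<otimes>\<^bsub>families\<^esub> y \<in> carrier (lim_group C F)"
      unfolding lim_group_iff
    proof
      show "x \<otimes>\<^bsub>families\<^esub> y \<in> carrier families" by (rule P.m_closed[OF xf yf])
      show "\<forall>\<alpha>\<in>Mor C. fmor F \<alpha> ((x \<otimes>\<^bsub>families\<^esub> y) (Dom C \<alpha>)) = (x \<otimes>\<^bsub>families\<^esub> y) (Cod C \<alpha>)"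
        using x y family_closed[OF xf] family_closed[OF yf] unfolding lim_group_iff by simp
    qed
  qed
qed

text \<open>Nothing is known about the object chosen by \<open>SOME\<close> in
  \<open>lim_to_colim\<close>. Compatibility of the family along a morphism from u to that object
  moves the computation to u.\<close>

lemma blim_carrier:
  assumes u: "u \<in> Ob C" and conn: "\<And>c. c \<in> Ob C \<Longrightarrow> \<exists>\<alpha>\<in>Mor C. Dom C \<alpha> = u \<and> Cod C \<alpha> = c"
  shows "carrier (blim_group C F) = (\<lambda>x. cin u (x u)) ` carrier (lim_group C F)"
proof -
  have c: "(SOME c. c \<in> Ob C) \<in> Ob C" using u by (rule someI)
  have "lim_to_colim C F x = cin u (x u)" if x: "x \<in> carrier (lim_group C F)" for x
  proof -
    obtain \<alpha> where a: "\<alpha> \<in> Mor C" "Dom C \<alpha> = u" "Cod C \<alpha> = (SOME c. c \<in> Ob C)" using conn[OF c] by blast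
    have "x u \<in> carrier (fob F u)" using x u by (auto simp: lim_group_iff)
    then have "cin (SOME c. c \<in> Ob C) (fmor F \<alpha> (x u)) = cin u (x u)"
      using cin_fmor[OF a(1)] a by simp
    moreover have "fmor F \<alpha> (x u) = x (SOME c. c \<in> Ob C)" using x a unfolding lim_group_iff by metis
    ultimately show ?thesis by (simp add: lim_to_colim_def Let_def)
  qed
  then show ?thesis unfolding blim_group_def by auto
qed

text \<open>Every element of the boundary limit comes from the one object u, where
  \<open>cin u\<close> is multiplicative. The group laws of the value at u and the closure of the
  limit give the rest.\<close>

lemma group_blim:
  assumes u: "u \<in> Ob C" and conn: "\<And>c. c \<in> Ob C \<Longrightarrow> \<exists>\<alpha>\<in>Mor C. Dom C \<alpha> = u \<and> Cod C \<alpha> = c"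
  shows "group (blim_group C F)"
proof -
  interpret U: group "fob F u" using u by simp
  note L = subgroup_lim
  have fam: "x u \<in> carrier (fob F u)" if "x \<in> carrier (lim_group C F)" for x
    using that u by (auto simp: lim_group_iff)
  have car: "carrier (blim_group C F) = (\<lambda>x. cin u (x u)) ` carrier (lim_group C F)"
    by (rule blim_carrier[OF assms])
  have mult: "monoid.mult (blim_group C F) = monoid.mult (colim_group C F)" by (simp add: blim_group_def)
  have one: "\<one>\<^bsub>blim_group C F\<^esub> = cin u \<one>\<^bsub>fob F u\<^esub>" using cin_one[OF u] by (simp add: blim_group_def)
  have E: "\<exists>x\<in>carrier (lim_group C F). A = cin u (x u)" if "A \<in> carrier (blim_group C F)" for A
    using that unfolding car by blast
  have I: "cin u y \<in> carrier (blim_group C F)" if "x \<in> carrier (lim_group C F)" "x u = y" for x y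
    using that unfolding car by blast
  note M = cin_mult[OF u]
  show ?thesis
  proof (rule groupI, unfold mult one)
    have "\<one>\<^bsub>families\<^esub> u = \<one>\<^bsub>fob F u\<^esub>" using u by simp
    then show "cin u \<one>\<^bsub>fob F u\<^esub> \<in> carrier (blim_group C F)"
      by (rule I[OF subgroup.one_closed[OF L]])
    fix A assume "A \<in> carrier (blim_group C F)"
    then obtain x where x: "x \<in> carrier (lim_group C F)" "A = cin u (x u)" using E by blast
    show "cin u \<one>\<^bsub>fob F u\<^esub> \<otimes>\<^bsub>colim_group C F\<^esub> A = A"
      unfolding x(2) using M[OF U.one_closed fam[OF x(1)]] fam[OF x(1)] by simp
    have xf: "x \<in> carrier families" using x(1) by (simp only: lim_group_iff)
    have "(inv\<^bsub>families\<^esub> x) u = inv\<^bsub>fob F u\<^esub> (x u)" using u xf by simp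
    then have "cin u (inv\<^bsub>fob F u\<^esub> (x u)) \<in> carrier (blim_group C F)"
      by (rule I[OF subgroup.m_inv_closed[OF L x(1)]])
    moreover have "cin u (inv\<^bsub>fob F u\<^esub> (x u)) \<otimes>\<^bsub>colim_group C F\<^esub> A = cin u \<one>\<^bsub>fob F u\<^esub>"
      unfolding x(2) using M[OF U.inv_closed[OF fam[OF x(1)]] fam[OF x(1)]] fam[OF x(1)] by simp
    ultimately show "\<exists>B\<in>carrier (blim_group C F). B \<otimes>\<^bsub>colim_group C F\<^esub> A = cin u \<one>\<^bsub>fob F u\<^esub>" by blast
    fix B assume "B \<in> carrier (blim_group C F)"
    then obtain y where y: "y \<in> carrier (lim_group C F)" "B = cin u (y u)" using E by blast
    have "(x \<otimes>\<^bsub>families\<^esub> y) u = x u \<otimes>\<^bsub>fob F u\<^esub> y u" using u by simp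
    then have "cin u (x u \<otimes>\<^bsub>fob F u\<^esub> y u) \<in> carrier (blim_group C F)"
      by (rule I[OF subgroup.m_closed[OF L x(1) y(1)]])
    then show "A \<otimes>\<^bsub>colim_group C F\<^esub> B \<in> carrier (blim_group C F)"
      unfolding x(2) y(2) M[OF fam[OF x(1)] fam[OF y(1)]] .
    fix D assume "D \<in> carrier (blim_group C F)"
    then obtain z where z: "z \<in> carrier (lim_group C F)" "D = cin u (z u)" using E by blast
    note f = fam[OF x(1)] fam[OF y(1)] fam[OF z(1)]
    show "A \<otimes>\<^bsub>colim_group C F\<^esub> B \<otimes>\<^bsub>colim_group C F\<^esub> D = A \<otimes>\<^bsub>colim_group C F\<^esub> (B \<otimes>\<^bsub>colim_group C F\<^esub> D)"
      unfolding x(2) y(2) z(2) M[OF f(1,2)] M[OF f(2,3)] M[OF U.m_closed[OF f(1,2)] f(3)]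
        M[OF f(1) U.m_closed[OF f(2,3)]] U.m_assoc[OF f] by (rule HOL.refl)
  qed
qed

end

section \<open>The exact sequence\<close>

lemma (in group_hom) image_set_mult_subset:
  assumes "K \<subseteq> carrier G" "L \<subseteq> carrier G" "h ` K \<subseteq> K'" "h ` L \<subseteq> L'"
  shows "h ` (K <#>\<^bsub>G\<^esub> L) \<subseteq> K' <#>\<^bsub>H\<^esub> L'"
proof (rule image_subsetI)
  fix z assume "z \<in> K <#>\<^bsub>G\<^esub> L"
  then obtain a b where ab: "a \<in> K" "b \<in> L" "z = a \<otimes>\<^bsub>G\<^esub> b" by (auto simp: set_mult_def)
  then have "h z = h a \<otimes>\<^bsub>H\<^esub> h b" using hom_mult[OF subsetD[OF assms(1)] subsetD[OF assms(2)]] by simp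
  moreover have "h a \<in> K'" "h b \<in> L'" using ab assms(3,4) by auto
  ultimately show "h z \<in> K' <#>\<^bsub>H\<^esub> L'" unfolding set_mult_def by blast
qed

context
  fixes G :: "'a monoid" and n :: nat
  assumes G: "group G" and n: "n \<ge> 1"
begin

abbreviation (input) "Fq \<equiv> F_mod G n"
abbreviation (input) "Sq \<equiv> Frf_mod G n"
abbreviation (input) "Rq \<equiv> Rrf_mod G n"
abbreviation (input) "Dq \<equiv> dim_quotient G n"
abbreviation (input) "pq \<equiv> proj_quot G n"
abbreviation (input) "iq \<equiv> incl_quot G n"
abbreviation (input) "gcos c x \<equiv> rel_gamma G n c #>\<^bsub>fgrp c\<^esub> x"
abbreviation (input) "ccos c x \<equiv> rel_gamma_cap G n c #>\<^bsub>fgrp c\<^esub> x"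
abbreviation (input) "dcos x \<equiv> lower_central G n #>\<^bsub>G\<^esub> x"

section \<open>The three functors and their values\<close>

lemma pres_normal:
  assumes c: "c \<in> presentations G"
  shows "rel_sub G c \<lhd> fgrp c" "rf_sub G n c \<lhd> fgrp c" "rel_sub G c \<inter> rf_sub G n c \<lhd> fgrp c"
    "rel_gamma G n c \<lhd> fgrp c" "rel_gamma_cap G n c \<lhd> fgrp c"
    "rel_gamma G n c \<subseteq> rf_sub G n c" "rel_gamma_cap G n c \<subseteq> rel_sub G c \<inter> rf_sub G n c"
    "rel_gamma_cap G n c \<subseteq> rel_gamma G n c"
proof -
  interpret c: group_ring_epi "fgrp c" G "proj c" by (rule presentation_epi[OF G c])
  note defs = pres_sub_simps rel_gamma_def rel_gamma_cap_def
  show "rel_sub G c \<lhd> fgrp c" unfolding defs by (rule c.normal_kernel)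
  show "rf_sub G n c \<lhd> fgrp c" unfolding defs by (rule c.normal_S)
  show "rel_sub G c \<inter> rf_sub G n c \<lhd> fgrp c" unfolding defs by (rule c.normal_R_S)
  show "rel_gamma G n c \<lhd> fgrp c" unfolding defs by (rule c.normal_N)
  show "rel_gamma_cap G n c \<lhd> fgrp c" unfolding defs by (rule c.normal_N')
  show "rel_gamma G n c \<subseteq> rf_sub G n c" unfolding defs by (rule c.N_S[OF n])
  show "rel_gamma_cap G n c \<subseteq> rel_sub G c \<inter> rf_sub G n c" unfolding defs by (rule c.N'_R_S[OF n])
  show "rel_gamma_cap G n c \<subseteq> rel_gamma G n c" unfolding defs by (rule c.N'_N)
qed

lemma pres_mor_image:
  assumes \<alpha>: "\<alpha> \<in> pres_mors G"
  shows "pmap \<alpha> ` rel_sub G (pdom \<alpha>) \<subseteq> rel_sub G (pcod \<alpha>)"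
    "pmap \<alpha> ` rf_sub G n (pdom \<alpha>) \<subseteq> rf_sub G n (pcod \<alpha>)"
    "pmap \<alpha> ` rel_gamma G n (pdom \<alpha>) \<subseteq> rel_gamma G n (pcod \<alpha>)"
    "pmap \<alpha> ` rel_gamma_cap G n (pdom \<alpha>) \<subseteq> rel_gamma_cap G n (pcod \<alpha>)"
proof -
  let ?c = "pdom \<alpha>" and ?d = "pcod \<alpha>"
  note e = pres_mor_ends[OF \<alpha>]
  interpret c: group_ring_epi "fgrp ?c" G "proj ?c" by (rule presentation_epi[OF G e(1)])
  interpret d: group_ring_epi "fgrp ?d" G "proj ?d" by (rule presentation_epi[OF G e(2)])
  interpret a: group_ring_hom "fgrp ?c" "fgrp ?d" "pmap \<alpha>" by (rule pres_mor_hom[OF \<alpha>])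
  note defs = pres_sub_simps rel_gamma_def rel_gamma_cap_def
  have R: "pmap \<alpha> ` c.R \<subseteq> d.R"
    using pres_mor_proj[OF \<alpha>] by (auto simp: kernel_def)
  have gam: "pmap \<alpha> ` lower_central (fgrp ?c) n \<subseteq> lower_central (fgrp ?d) n"
    using a.gmap_lower_central by blast
  have der: "pmap \<alpha> ` derived (fgrp ?c) c.R \<subseteq> derived (fgrp ?d) d.R"
    by (rule a.derived_image_subset[OF c.kernel_subset d.kernel_subset R])
  have dc: "derived (fgrp ?c) c.R \<subseteq> carrier (fgrp ?c)"
    by (rule subgroup.subset[OF normal_imp_subgroup[OF c.normal_derived_R]])
  have lc: "lower_central (fgrp ?c) n \<subseteq> carrier (fgrp ?c)"
    by (rule subgroup.subset[OF normal_imp_subgroup[OF c.G.normal_lower_central]])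
  show "pmap \<alpha> ` rel_sub G ?c \<subseteq> rel_sub G ?d" unfolding defs by (rule R)
  show "pmap \<alpha> ` rel_gamma G n ?c \<subseteq> rel_gamma G n ?d"
    unfolding defs by (rule a.image_set_mult_subset[OF dc lc der gam])
  show "pmap \<alpha> ` rel_gamma_cap G n ?c \<subseteq> rel_gamma_cap G n ?d"
    unfolding defs by (rule a.image_set_mult_subset[OF dc _ der]) (use lc gam R in auto)
  have rel: "a.gmap x \<in> relative_ideal (fgrp ?d) d.R" if "x \<in> relative_ideal (fgrp ?c) c.R" for x
  proof (rule a.gmap_relative[OF d.G.relative_ideal_ideal[OF d.kernel_subset] c.kernel_subset _ that])
    show "d.G.gd (pmap \<alpha> r) \<in> relative_ideal (fgrp ?d) d.R" if "r \<in> c.R" for r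
      by (rule d.G.gd_relative_ideal[OF d.kernel_subset]) (use R that in blast)
  qed
  show "pmap \<alpha> ` rf_sub G n ?c \<subseteq> rf_sub G n ?d"
    unfolding defs
  proof (rule image_subsetI)
    interpret J: ideal "d.rf_ideal n" "group_ring (fgrp ?d)" by (rule d.ideal_rf_ideal)
    fix x assume "x \<in> c.S n"
    then have x: "x \<in> carrier (fgrp ?c)" "c.G.gd x \<in> c.rf_ideal n" by (simp_all add: c.G.one_plus_iff)
    then obtain a b where ab: "a \<in> ideal_prod (group_ring (fgrp ?c)) (relative_ideal (fgrp ?c) c.R) (aug_ideal (fgrp ?c))"
      "b \<in> ideal_power (group_ring (fgrp ?c)) (aug_ideal (fgrp ?c)) n" "c.G.gd x = a \<oplus>\<^bsub>group_ring (fgrp ?c)\<^esub> b"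
      by (auto simp: set_add_def')
    have cc: "a \<in> carrier (group_ring (fgrp ?c))" "b \<in> carrier (group_ring (fgrp ?c))"
      using ab ideal.Icarr[OF c.ideal_rf] ideal.Icarr[OF c.G.ideal_power_ideal[OF c.G.ideal_aug_ideal]] by auto
    have "a.gmap a \<in> ideal_prod (group_ring (fgrp ?d)) (relative_ideal (fgrp ?d) d.R) (aug_ideal (fgrp ?d))"
      by (rule a.gmap_ideal_prod[OF _ _ rel a.gmap_aug ab(1)])
         (use ideal.Icarr[OF c.G.relative_ideal_ideal[OF c.kernel_subset]] ideal.Icarr[OF c.G.ideal_aug_ideal] in auto)
    then have "a.gmap a \<oplus>\<^bsub>group_ring (fgrp ?d)\<^esub> a.gmap b \<in> d.rf_ideal n"
      by (intro J.a_closed d.rf_ideal_intro(1) d.rf_ideal_intro(2)[OF a.gmap_ideal_power[OF ab(2)]])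
    also have "a.gmap a \<oplus>\<^bsub>group_ring (fgrp ?d)\<^esub> a.gmap b = d.G.gd (pmap \<alpha> x)"
      unfolding a.gmap_add[OF cc, symmetric] ab(3)[symmetric] by (rule a.gmap_gd[OF x(1)])
    finally show "pmap \<alpha> x \<in> d.S n" using x(1) by (simp add: d.G.one_plus_iff)
  qed
qed

lemma functor_F: "group_valued_functor (Pres T G) Fq"
  unfolding F_mod_def
proof (rule subquotient_functor)
  show "subgroup (carrier (fgrp c)) (fgrp c)" if "c \<in> presentations G" for c
    using group.subgroup_self[OF presentation_group[OF that]] .
  show "rel_gamma G n c \<subseteq> carrier (fgrp c)" if "c \<in> presentations G" for c
    using subgroup.subset[OF normal_imp_subgroup[OF pres_normal(4)[OF that]]] .
  show "pmap \<alpha> ` carrier (fgrp (pdom \<alpha>)) \<subseteq> carrier (fgrp (pcod \<alpha>))" if "\<alpha> \<in> pres_mors G" for \<alpha>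
    using group_hom.hom_closed[OF pres_mor_group_hom[OF that]] by blast
qed (erule pres_normal(4), erule pres_mor_image(3))

lemma functor_Frf: "group_valued_functor (Pres T G) Sq"
  unfolding Frf_mod_def
  by (rule subquotient_functor)
     (erule normal_imp_subgroup[OF pres_normal(2)], erule pres_normal(4), erule pres_normal(6),
      erule pres_mor_image(2), erule pres_mor_image(3))

lemma functor_Rrf: "group_valued_functor (Pres T G) Rq"
  unfolding Rrf_mod_def
proof (rule subquotient_functor)
  show "pmap \<alpha> ` (rel_sub G (pdom \<alpha>) \<inter> rf_sub G n (pdom \<alpha>)) \<subseteq> rel_sub G (pcod \<alpha>) \<inter> rf_sub G n (pcod \<alpha>)"
    if "\<alpha> \<in> pres_mors G" for \<alpha> using pres_mor_image(1,2)[OF that] by blast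
qed (erule normal_imp_subgroup[OF pres_normal(3)], erule pres_normal(5), erule pres_normal(7),
      erule pres_mor_image(4))

lemma fobs:
  "fob Fq c = (fgrp c)\<lparr>carrier := carrier (fgrp c)\<rparr> Mod rel_gamma G n c"
  "fob Sq c = (fgrp c)\<lparr>carrier := rf_sub G n c\<rparr> Mod rel_gamma G n c"
  "fob Rq c = (fgrp c)\<lparr>carrier := rel_sub G c \<inter> rf_sub G n c\<rparr> Mod rel_gamma_cap G n c"
  by (simp_all add: F_mod_def Frf_mod_def Rrf_mod_def del: partial_object.update_defs)

text \<open>The action on morphisms depends on the denominators alone, and these agree. Facts about
  morphisms of S/N therefore hold for F/N as well.\<close>

lemma fmor_F_Frf: "fmor Fq = fmor Sq"
  by (simp add: F_mod_def Frf_mod_def subquotient_functor_def)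

lemma fmor_gamma:
  assumes "\<alpha> \<in> pres_mors G" "x \<in> carrier (fgrp (pdom \<alpha>))"
  shows "fmor Sq \<alpha> (gcos (pdom \<alpha>) x) =
    gcos (pcod \<alpha>) (pmap \<alpha> x)"
  unfolding Frf_mod_def
  by (rule fmor_subquotient[OF assms(1) _ _ pres_mor_image(3)[OF assms(1)] assms(2)])
     (use pres_normal(4) pres_mor_ends[OF assms(1)] normal_imp_subgroup in auto)

lemma fmor_gamma_cap:
  assumes "\<alpha> \<in> pres_mors G" "x \<in> carrier (fgrp (pdom \<alpha>))"
  shows "fmor Rq \<alpha> (ccos (pdom \<alpha>) x) =
    ccos (pcod \<alpha>) (pmap \<alpha> x)"
  unfolding Rrf_mod_def
  by (rule fmor_subquotient[OF assms(1) _ _ pres_mor_image(4)[OF assms(1)] assms(2)])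
     (use pres_normal(5) pres_mor_ends[OF assms(1)] normal_imp_subgroup in auto)

text \<open>The denominator contains R', so elements of R commute modulo it.\<close>

lemma abelian_Rrf: "abelian_functor (Pres T G) Rq"
proof (rule abelian_functor.intro[OF functor_Rrf], unfold_locales)
  fix c q1 q2 assume "c \<in> Ob (Pres T G)" and q: "q1 \<in> carrier (fob Rq c)" "q2 \<in> carrier (fob Rq c)"
  then have c: "c \<in> presentations G" by simp
  interpret c: group_ring_epi "fgrp c" G "proj c" by (rule presentation_epi[OF G c])
  obtain x y where x: "x \<in> rel_sub G c" "q1 = ccos c x"
    and y: "y \<in> rel_sub G c" "q2 = ccos c y"
    using q unfolding fobs c.G.carrier_subquotient by blast
  have xy: "x \<in> c.R" "y \<in> c.R" using x(1) y(1) by (simp_all add: pres_sub_simps)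
  note cc = c.R_carrier[OF xy(1)] c.R_carrier[OF xy(2)]
  have "x \<otimes>\<^bsub>fgrp c\<^esub> y \<otimes>\<^bsub>fgrp c\<^esub> inv\<^bsub>fgrp c\<^esub> x \<otimes>\<^bsub>fgrp c\<^esub> inv\<^bsub>fgrp c\<^esub> y \<in> derived (fgrp c) c.R"
    unfolding derived_def using xy by (intro generate.incl) blast
  moreover have "derived (fgrp c) c.R \<subseteq> rel_gamma_cap G n c"
  proof
    fix d assume d: "d \<in> derived (fgrp c) c.R"
    then have "d = d \<otimes>\<^bsub>fgrp c\<^esub> \<one>\<^bsub>fgrp c\<^esub>"
      using subgroup.subset[OF normal_imp_subgroup[OF c.normal_derived_R]] by auto
    moreover have "\<one>\<^bsub>fgrp c\<^esub> \<in> c.R \<inter> lower_central (fgrp c) n"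
      by (rule subgroup.one_closed[OF normal_imp_subgroup[OF c.normal_R_lower_central]])
    ultimately show "d \<in> rel_gamma_cap G n c"
      unfolding rel_gamma_cap_def pres_sub_simps set_mult_def using d by blast
  qed
  moreover have "x \<otimes>\<^bsub>fgrp c\<^esub> y \<otimes>\<^bsub>fgrp c\<^esub> inv\<^bsub>fgrp c\<^esub> x \<otimes>\<^bsub>fgrp c\<^esub> inv\<^bsub>fgrp c\<^esub> y =
      (x \<otimes>\<^bsub>fgrp c\<^esub> y) \<otimes>\<^bsub>fgrp c\<^esub> inv\<^bsub>fgrp c\<^esub> (y \<otimes>\<^bsub>fgrp c\<^esub> x)"
    using cc by (simp add: c.G.inv_mult_group c.G.m_assoc)
  ultimately have "ccos c (x \<otimes>\<^bsub>fgrp c\<^esub> y) = ccos c (y \<otimes>\<^bsub>fgrp c\<^esub> x)"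
    using cc by (subst c.G.r_coset_eq_iff[OF normal_imp_subgroup[OF pres_normal(5)[OF c]]]) auto
  then show "q1 \<otimes>\<^bsub>fob Rq c\<^esub> q2 = q2 \<otimes>\<^bsub>fob Rq c\<^esub> q1"
    unfolding x(2) y(2) fobs c.G.mult_subquotient[OF pres_normal(5)[OF c] cc]
      c.G.mult_subquotient[OF pres_normal(5)[OF c] cc(2,1)] .
qed

section \<open>The natural maps on cosets and their exactness\<close>

lemma incl_quot_coset:
  assumes c: "c \<in> presentations G" and x: "x \<in> carrier (fgrp c)"
  shows "iq c (ccos c x) = gcos c x"
proof -
  interpret c: group "fgrp c" by (rule presentation_group[OF c])
  have id: "group_hom (fgrp c) (fgrp c) (\<lambda>x. x)"
    by (simp add: group_hom_def group_hom_axioms_def hom_def c.is_group)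
  show ?thesis
    using group_hom.r_coset_image[OF id normal_imp_subgroup[OF pres_normal(5)[OF c]]
        normal_imp_subgroup[OF pres_normal(4)[OF c]] _ x] pres_normal(8)[OF c]
    by (simp add: incl_quot_def)
qed

lemma proj_quot_coset:
  assumes c: "c \<in> presentations G" and x: "x \<in> carrier (fgrp c)"
  shows "pq c (gcos c x) = dcos (proj c x)"
proof -
  interpret c: group_ring_epi "fgrp c" G "proj c" by (rule presentation_epi[OF G c])
  show ?thesis
    unfolding proj_quot_def
    by (rule c.r_coset_image[OF normal_imp_subgroup[OF pres_normal(4)[OF c]]
        normal_imp_subgroup[OF c.H.normal_lower_central] _ x])
       (unfold rel_gamma_def pres_sub_simps, rule c.image_N)
qed

lemma dim_normal: "dimension_subgroup G n \<lhd> G" "lower_central G n \<subseteq> dimension_subgroup G n"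
proof -
  interpret G: integral_group_ring G by (simp add: integral_group_ring_def G)
  show "dimension_subgroup G n \<lhd> G"
    unfolding dimension_subgroup_def by (rule G.normal_one_plus[OF G.ideal_power_ideal[OF G.ideal_aug_ideal]])
  obtain m where "n = Suc m" using n by (cases n) auto
  then show "lower_central G n \<subseteq> dimension_subgroup G n"
    unfolding dimension_subgroup_def using G.lower_central_one_plus[of m] by simp
qed

lemma group_dim_quotient: "group Dq"
  unfolding dim_quotient_def
  by (rule group.group_subquotient[OF G normal_imp_subgroup[OF dim_normal(1)] group.normal_lower_central[OF G] dim_normal(2)])

lemma carrier_dim_quotient: "carrier Dq = (\<lambda>x. dcos x) ` dimension_subgroup G n"
  unfolding dim_quotient_def by (rule group.carrier_subquotient[OF G])

lemma mult_dim_quotient: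
  "x \<in> carrier G \<Longrightarrow> y \<in> carrier G \<Longrightarrow>
    (dcos x) \<otimes>\<^bsub>Dq\<^esub> (dcos y) = dcos (x \<otimes>\<^bsub>G\<^esub> y)"
  unfolding dim_quotient_def by (rule group.mult_subquotient[OF G group.normal_lower_central[OF G]])

lemma proj_quot_natural:
  assumes \<alpha>: "\<alpha> \<in> pres_mors G" and q: "q \<in> carrier (fob Fq (pdom \<alpha>))"
  shows "pq (pcod \<alpha>) (fmor Sq \<alpha> q) = pq (pdom \<alpha>) q"
proof -
  interpret c: group "fgrp (pdom \<alpha>)" by (rule presentation_group[OF pres_mor_ends(1)[OF \<alpha>]])
  obtain x where x: "x \<in> carrier (fgrp (pdom \<alpha>))" "q = gcos (pdom \<alpha>) x"
    using q unfolding fobs c.carrier_subquotient by blast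
  show ?thesis
    unfolding x(2) fmor_gamma[OF \<alpha> x(1)] proj_quot_coset[OF pres_mor_ends(1)[OF \<alpha>] x(1)]
      proj_quot_coset[OF pres_mor_ends(2)[OF \<alpha>] group_hom.hom_closed[OF pres_mor_group_hom[OF \<alpha>] x(1)]]
      pres_mor_proj[OF \<alpha> x(1)] by (rule HOL.refl)
qed

lemma Frf_subset_F: "c \<in> presentations G \<Longrightarrow> carrier (fob Sq c) \<subseteq> carrier (fob Fq c)"
  unfolding fobs group.carrier_subquotient[OF presentation_group]
  by (rule image_mono) (rule subgroup.subset[OF normal_imp_subgroup[OF pres_normal(2)]])

lemma proj_quot_hom_Mod:
  assumes c: "c \<in> presentations G"
  shows "pq c \<in> hom (fob Fq c) (G Mod lower_central G n)"
proof -
  interpret c: group_ring_epi "fgrp c" G "proj c" by (rule presentation_epi[OF G c])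
  show ?thesis
    unfolding fobs
  proof (rule homI)
    fix q1 q2 assume "q1 \<in> carrier ((fgrp c)\<lparr>carrier := carrier (fgrp c)\<rparr> Mod rel_gamma G n c)"
      "q2 \<in> carrier ((fgrp c)\<lparr>carrier := carrier (fgrp c)\<rparr> Mod rel_gamma G n c)"
    then obtain x y where x: "x \<in> carrier (fgrp c)" "q1 = gcos c x"
      and y: "y \<in> carrier (fgrp c)" "q2 = gcos c y"
      unfolding c.G.carrier_subquotient by blast
    show "pq c q1 \<in> carrier (G Mod lower_central G n)"
      unfolding x(2) proj_quot_coset[OF c x(1)] carrier_FactGroup using c.hom_closed[OF x(1)] by blast
    have "pq c (q1 \<otimes>\<^bsub>(fgrp c)\<lparr>carrier := carrier (fgrp c)\<rparr> Mod rel_gamma G n c\<^esub> q2) =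
        dcos (proj c x \<otimes>\<^bsub>G\<^esub> proj c y)"
      unfolding x(2) y(2) c.G.mult_subquotient[OF pres_normal(4)[OF c] x(1) y(1)]
        proj_quot_coset[OF c c.G.m_closed[OF x(1) y(1)]] c.hom_mult[OF x(1) y(1)] by (rule HOL.refl)
    also have "\<dots> = pq c q1 \<otimes>\<^bsub>G Mod lower_central G n\<^esub> pq c q2"
      unfolding x(2) y(2) proj_quot_coset[OF c x(1)] proj_quot_coset[OF c y(1)] mult_FactGroup
        normal.rcos_sum[OF c.H.normal_lower_central c.hom_closed[OF x(1)] c.hom_closed[OF y(1)]] by (rule HOL.refl)
    finally show "pq c (q1 \<otimes>\<^bsub>(fgrp c)\<lparr>carrier := carrier (fgrp c)\<rparr> Mod rel_gamma G n c\<^esub> q2) =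
        pq c q1 \<otimes>\<^bsub>G Mod lower_central G n\<^esub> pq c q2" .
  qed
qed

lemma Frf_elem:
  assumes "c \<in> presentations G" "q \<in> carrier (fob Sq c)"
  obtains x where "x \<in> rf_sub G n c" "x \<in> carrier (fgrp c)" "q = gcos c x"
  using assms subgroup.subset[OF normal_imp_subgroup[OF pres_normal(2)[OF assms(1)]]]
  unfolding fobs group.carrier_subquotient[OF presentation_group[OF assms(1)]] by blast

lemma Rrf_elem:
  assumes "c \<in> presentations G" "q \<in> carrier (fob Rq c)"
  obtains x where "x \<in> rel_sub G c" "x \<in> rf_sub G n c" "x \<in> carrier (fgrp c)" "q = ccos c x"
  using assms subgroup.subset[OF normal_imp_subgroup[OF pres_normal(2)[OF assms(1)]]]
  unfolding fobs group.carrier_subquotient[OF presentation_group[OF assms(1)]] by blast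

lemma F_elem:
  assumes "c \<in> presentations G" "q \<in> carrier (fob Fq c)"
  obtains x where "x \<in> carrier (fgrp c)" "q = gcos c x"
  using assms unfolding fobs group.carrier_subquotient[OF presentation_group[OF assms(1)]] by blast

lemma Frf_mem:
  assumes "c \<in> presentations G" "x \<in> rf_sub G n c"
  shows "gcos c x \<in> carrier (fob Sq c)"
  unfolding fobs group.carrier_subquotient[OF presentation_group[OF assms(1)]] using assms(2) by (rule imageI)

lemma Rrf_mem:
  assumes "c \<in> presentations G" "x \<in> rel_sub G c" "x \<in> rf_sub G n c"
  shows "ccos c x \<in> carrier (fob Rq c)"
  unfolding fobs group.carrier_subquotient[OF presentation_group[OF assms(1)]] using assms(2,3) by blast

lemma incl_quot_hom:
  assumes c: "c \<in> presentations G"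
  shows "iq c \<in> hom (fob Rq c) (fob Sq c)"
proof (rule homI)
  interpret c: group "fgrp c" by (rule presentation_group[OF c])
  fix q1 assume q1: "q1 \<in> carrier (fob Rq c)"
  obtain x where x: "x \<in> rel_sub G c" "x \<in> rf_sub G n c" "x \<in> carrier (fgrp c)" "q1 = ccos c x"
    using Rrf_elem[OF c q1] .
  show "iq c q1 \<in> carrier (fob Sq c)"
    unfolding x(4) incl_quot_coset[OF c x(3)] by (rule Frf_mem[OF c x(2)])
  fix q2 assume q2: "q2 \<in> carrier (fob Rq c)"
  obtain y where y: "y \<in> rel_sub G c" "y \<in> rf_sub G n c" "y \<in> carrier (fgrp c)" "q2 = ccos c y"
    using Rrf_elem[OF c q2] .
  show "iq c (q1 \<otimes>\<^bsub>fob Rq c\<^esub> q2) =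
      iq c q1 \<otimes>\<^bsub>fob Sq c\<^esub> iq c q2"
    unfolding x(4) y(4) fobs c.mult_subquotient[OF pres_normal(5)[OF c] x(3) y(3)]
      incl_quot_coset[OF c x(3)] incl_quot_coset[OF c y(3)] incl_quot_coset[OF c c.m_closed[OF x(3) y(3)]]
      c.mult_subquotient[OF pres_normal(4)[OF c] x(3) y(3)] by (rule HOL.refl)
qed

lemma incl_quot_inj:
  assumes c: "c \<in> presentations G"
  shows "inj_on (iq c) (carrier (fob Rq c))"
proof (rule inj_onI)
  interpret c: group_ring_epi "fgrp c" G "proj c" by (rule presentation_epi[OF G c])
  fix q1 q2 assume q: "q1 \<in> carrier (fob Rq c)" "q2 \<in> carrier (fob Rq c)"
    "iq c q1 = iq c q2"
  obtain x where x: "x \<in> rel_sub G c" "x \<in> rf_sub G n c" "x \<in> carrier (fgrp c)" "q1 = ccos c x"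
    using Rrf_elem[OF c q(1)] .
  obtain y where y: "y \<in> rel_sub G c" "y \<in> rf_sub G n c" "y \<in> carrier (fgrp c)" "q2 = ccos c y"
    using Rrf_elem[OF c q(2)] .
  note sN = normal_imp_subgroup[OF pres_normal(4)[OF c]] and sN' = normal_imp_subgroup[OF pres_normal(5)[OF c]]
  have "x \<otimes>\<^bsub>fgrp c\<^esub> inv\<^bsub>fgrp c\<^esub> y \<in> rel_gamma G n c"
    using q(3) unfolding x(4) y(4) incl_quot_coset[OF c x(3)] incl_quot_coset[OF c y(3)]
      c.G.r_coset_eq_iff[OF sN x(3) y(3)] .
  moreover have "x \<otimes>\<^bsub>fgrp c\<^esub> inv\<^bsub>fgrp c\<^esub> y \<in> rel_sub G c"
    using x(1) y(1) normal_imp_subgroup[OF pres_normal(1)[OF c]] subgroup.m_closed subgroup.m_inv_closed by metis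
  ultimately have "x \<otimes>\<^bsub>fgrp c\<^esub> inv\<^bsub>fgrp c\<^esub> y \<in> rel_gamma_cap G n c"
    using c.N_Int_R[of _ n] unfolding rel_gamma_def rel_gamma_cap_def pres_sub_simps by blast
  then show "q1 = q2" unfolding x(4) y(4) c.G.r_coset_eq_iff[OF sN' x(3) y(3)] .
qed

lemma proj_rf_dimension:
  assumes c: "c \<in> presentations G" and x: "x \<in> rf_sub G n c"
  shows "proj c x \<in> dimension_subgroup G n"
proof -
  interpret c: group_ring_epi "fgrp c" G "proj c" by (rule presentation_epi[OF G c])
  show ?thesis using c.one_plus_rf_dimension x unfolding pres_sub_simps .
qed

lemma proj_quot_hom:
  assumes c: "c \<in> presentations G"
  shows "pq c \<in> hom (fob Sq c) Dq"
proof (rule homI)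
  interpret c: group_ring_epi "fgrp c" G "proj c" by (rule presentation_epi[OF G c])
  fix q1 assume q1: "q1 \<in> carrier (fob Sq c)"
  obtain x where x: "x \<in> rf_sub G n c" "x \<in> carrier (fgrp c)" "q1 = gcos c x"
    using Frf_elem[OF c q1] .
  show "pq c q1 \<in> carrier Dq"
    unfolding x(3) proj_quot_coset[OF c x(2)] carrier_dim_quotient using proj_rf_dimension[OF c x(1)] by blast
  fix q2 assume q2: "q2 \<in> carrier (fob Sq c)"
  obtain y where y: "y \<in> rf_sub G n c" "y \<in> carrier (fgrp c)" "q2 = gcos c y"
    using Frf_elem[OF c q2] .
  show "pq c (q1 \<otimes>\<^bsub>fob Sq c\<^esub> q2) = pq c q1 \<otimes>\<^bsub>Dq\<^esub> pq c q2"
    unfolding x(3) y(3) fobs c.G.mult_subquotient[OF pres_normal(4)[OF c] x(2) y(2)]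
      proj_quot_coset[OF c x(2)] proj_quot_coset[OF c y(2)] proj_quot_coset[OF c c.G.m_closed[OF x(2) y(2)]]
      mult_dim_quotient[OF c.hom_closed[OF x(2)] c.hom_closed[OF y(2)]] c.hom_mult[OF x(2) y(2)]
    by (rule HOL.refl)
qed

lemma proj_quot_surj:
  assumes c: "c \<in> presentations G"
  shows "pq c ` carrier (fob Sq c) = carrier Dq"
proof
  interpret c: group_ring_epi "fgrp c" G "proj c" by (rule presentation_epi[OF G c])
  show "pq c ` carrier (fob Sq c) \<subseteq> carrier Dq"
    using proj_quot_hom[OF c] by (auto simp: hom_def)
  show "carrier Dq \<subseteq> pq c ` carrier (fob Sq c)"
  proof
    fix q assume "q \<in> carrier Dq"
    then obtain y where y: "y \<in> dimension_subgroup G n" "q = dcos y"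
      unfolding carrier_dim_quotient by blast
    obtain x where x: "x \<in> rf_sub G n c" "proj c x = y"
      using c.dimension_lift[OF y(1)] unfolding pres_sub_simps by blast
    have xc: "x \<in> carrier (fgrp c)"
      using subgroup.subset[OF normal_imp_subgroup[OF pres_normal(2)[OF c]]] x(1) by blast
    show "q \<in> pq c ` carrier (fob Sq c)"
      using proj_quot_coset[OF c xc] x(2) y(2) Frf_mem[OF c x(1)] by (metis imageI)
  qed
qed

lemma proj_quot_kernel:
  assumes c: "c \<in> presentations G"
  shows "iq c ` carrier (fob Rq c) =
    kernel (fob Sq c) Dq (pq c)"
proof
  interpret c: group_ring_epi "fgrp c" G "proj c" by (rule presentation_epi[OF G c])
  note sL = normal_imp_subgroup[OF c.H.normal_lower_central[of n]]
  have one: "\<one>\<^bsub>Dq\<^esub> = lower_central G n" by (simp add: dim_quotient_def)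
  show "iq c ` carrier (fob Rq c) \<subseteq> kernel (fob Sq c) Dq (pq c)"
  proof (rule image_subsetI)
    fix q assume q: "q \<in> carrier (fob Rq c)"
    obtain x where x: "x \<in> rel_sub G c" "x \<in> rf_sub G n c" "x \<in> carrier (fgrp c)" "q = ccos c x"
      using Rrf_elem[OF c q] .
    have "proj c x = \<one>\<^bsub>G\<^esub>" using x(1) by (simp add: pres_sub_simps kernel_def)
    then have "dcos (proj c x) = lower_central G n"
      using subgroup.subset[OF sL] by (simp add: c.H.coset_mult_one)
    then show "iq c q \<in> kernel (fob Sq c) Dq (pq c)"
      unfolding kernel_def x(4) incl_quot_coset[OF c x(3)] using Frf_mem[OF c x(2)] proj_quot_coset[OF c x(3)] one
      by simp
  qed
  show "kernel (fob Sq c) Dq (pq c) \<subseteq> iq c ` carrier (fob Rq c)"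
  proof
    fix q assume q: "q \<in> kernel (fob Sq c) Dq (pq c)"
    then have qF: "q \<in> carrier (fob Sq c)" and q1: "pq c q = lower_central G n"
      using one by (simp_all add: kernel_def)
    obtain x where x: "x \<in> rf_sub G n c" "x \<in> carrier (fgrp c)" "q = gcos c x"
      using Frf_elem[OF c qF] .
    have "dcos (proj c x) = lower_central G n"
      using q1 unfolding x(3) proj_quot_coset[OF c x(2)] .
    then have "proj c x \<in> lower_central G n"
      using c.H.coset_join1[OF _ c.hom_closed[OF x(2)] sL] by blast
    then obtain r where r: "r \<in> c.R" "c.N n #>\<^bsub>fgrp c\<^esub> x = c.N n #>\<^bsub>fgrp c\<^esub> r"
      "\<exists>y\<in>lower_central (fgrp c) n. r = x \<otimes>\<^bsub>fgrp c\<^esub> inv\<^bsub>fgrp c\<^esub> y"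
      by (rule c.lower_central_preimage[OF x(2)])
    obtain y where y: "y \<in> lower_central (fgrp c) n" "r = x \<otimes>\<^bsub>fgrp c\<^esub> inv\<^bsub>fgrp c\<^esub> y" using r(3) by blast
    \<comment> \<open>Lying in R is not enough for r, as the kernel functor consists of classes from
      R \<inter> S. The correction y is in gamma_n(F), hence in S, so r stays in S along with
      x.\<close>
    have "y \<in> rf_sub G n c" using y(1) c.lower_central_S[OF n] unfolding pres_sub_simps by blast
    then have rS: "r \<in> rf_sub G n c"
      unfolding y(2) using x(1) normal_imp_subgroup[OF pres_normal(2)[OF c]] subgroup.m_closed subgroup.m_inv_closed
      by metis
    have rR: "r \<in> rel_sub G c" using r(1) by (simp add: pres_sub_simps)
    have "q = iq c (ccos c r)"
      unfolding incl_quot_coset[OF c c.R_carrier[OF r(1)]] x(3)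
      using r(2) by (simp add: rel_gamma_def pres_sub_simps)
    then show "q \<in> iq c ` carrier (fob Rq c)"
      using Rrf_mem[OF c rR rS] by blast
  qed
qed

lemma Rrf_central:
  assumes c: "c \<in> presentations G" and e: "e \<in> carrier (fob Rq c)" and q: "q \<in> carrier (fob Sq c)"
  shows "iq c e \<otimes>\<^bsub>fob Sq c\<^esub> q = q \<otimes>\<^bsub>fob Sq c\<^esub> iq c e"
proof -
  interpret c: group_ring_epi "fgrp c" G "proj c" by (rule presentation_epi[OF G c])
  obtain r where r: "r \<in> rel_sub G c" "r \<in> rf_sub G n c" "r \<in> carrier (fgrp c)" "e = ccos c r"
    using Rrf_elem[OF c e] .
  obtain x where x: "x \<in> rf_sub G n c" "x \<in> carrier (fgrp c)" "q = gcos c x"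
    using Frf_elem[OF c q] .
  have "x \<otimes>\<^bsub>fgrp c\<^esub> r \<otimes>\<^bsub>fgrp c\<^esub> inv\<^bsub>fgrp c\<^esub> x \<otimes>\<^bsub>fgrp c\<^esub> inv\<^bsub>fgrp c\<^esub> r \<in> rel_gamma_cap G n c"
    using c.commutator_S_R[of x n r] x(1) r(1) unfolding rel_gamma_cap_def pres_sub_simps by blast
  then have "x \<otimes>\<^bsub>fgrp c\<^esub> r \<otimes>\<^bsub>fgrp c\<^esub> inv\<^bsub>fgrp c\<^esub> (r \<otimes>\<^bsub>fgrp c\<^esub> x) \<in> rel_gamma G n c"
    using pres_normal(8)[OF c] x(2) r(3) by (auto simp: c.G.inv_mult_group c.G.m_assoc)
  then have "gcos c (x \<otimes>\<^bsub>fgrp c\<^esub> r) = gcos c (r \<otimes>\<^bsub>fgrp c\<^esub> x)"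
    using x(2) r(3) by (subst c.G.r_coset_eq_iff[OF normal_imp_subgroup[OF pres_normal(4)[OF c]]]) auto
  then show ?thesis
    unfolding r(4) x(3) incl_quot_coset[OF c r(3)] fobs c.G.mult_subquotient[OF pres_normal(4)[OF c] x(2) r(3)]
      c.G.mult_subquotient[OF pres_normal(4)[OF c] r(3) x(2)] by (rule HOL.sym)
qed

lemma incl_quot_natural:
  assumes \<alpha>: "\<alpha> \<in> pres_mors G" and e: "e \<in> carrier (fob Rq (pdom \<alpha>))"
  shows "iq (pcod \<alpha>) (fmor Rq \<alpha> e) = fmor Sq \<alpha> (iq (pdom \<alpha>) e)"
proof -
  note c = pres_mor_ends[OF \<alpha>]
  obtain r where r: "r \<in> rel_sub G (pdom \<alpha>)" "r \<in> rf_sub G n (pdom \<alpha>)" "r \<in> carrier (fgrp (pdom \<alpha>))"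
    "e = ccos (pdom \<alpha>) r"
    using Rrf_elem[OF c(1) e] .
  show ?thesis
    unfolding r(4) incl_quot_coset[OF c(1) r(3)] fmor_gamma[OF \<alpha> r(3)] fmor_gamma_cap[OF \<alpha> r(3)]
      incl_quot_coset[OF c(2) group_hom.hom_closed[OF pres_mor_group_hom[OF \<alpha>] r(3)]] by (rule HOL.refl)
qed

section \<open>The extension over the category of presentations; limit and colimit of F/N\<close>

lemma pres_constant_extension:
  fixes u :: "('f, 'a) presentation"
  assumes u: "split_presentation G u B i j \<iota> \<kappa>"
  shows "constant_extension (Pres TYPE('f) G) Rq Sq Dq iq pq"
proof (intro constant_extension.intro constant_extension_axioms.intro abelian_Rrf functor_Frf group_dim_quotient,
    unfold Pres_simps(1-4))
  interpret u: split_presentation G u B i j \<iota> \<kappa> by (rule u)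
  show "presentations G \<noteq> ({} :: ('f, 'a) presentation set)" using u.u by blast
  show "\<exists>\<alpha>\<in>pres_mors G. pdom \<alpha> = c \<and> pcod \<alpha> = d" if "c \<in> presentations G" "d \<in> presentations G"
    for c d :: "('f, 'a) presentation"
    using pres_connected[OF G that] by metis
  show "\<exists>k. (\<forall>c\<in>presentations G. k c \<in> carrier Dq) \<and>
      (\<forall>\<alpha>\<in>pres_mors G. t \<alpha> = k (pcod \<alpha>) \<otimes>\<^bsub>Dq\<^esub> inv\<^bsub>Dq\<^esub> k (pdom \<alpha>))"
    if "\<And>\<alpha>. \<alpha> \<in> pres_mors G \<Longrightarrow> t \<alpha> \<in> carrier Dq"
      "\<And>\<alpha> \<beta>. \<alpha> \<in> pres_mors G \<Longrightarrow> \<beta> \<in> pres_mors G \<Longrightarrow> pdom \<alpha> = pcod \<beta> \<Longrightarrow>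
        t (Comp (Pres TYPE('f) G) \<alpha> \<beta>) = t \<alpha> \<otimes>\<^bsub>Dq\<^esub> t \<beta>" for t :: "('f, 'a) pres_mor \<Rightarrow> 'a set"
    by (rule u.pres_constant_cocycles[OF group_dim_quotient that])
  show "pq (pcod \<alpha>) (fmor Sq \<alpha> q) = pq (pdom \<alpha>) q"
    if "\<alpha> \<in> pres_mors G" "q \<in> carrier (fob Sq (pdom \<alpha>))" for \<alpha> :: "('f, 'a) pres_mor" and q
    using proj_quot_natural[OF that(1) subsetD[OF Frf_subset_F[OF pres_mor_ends(1)[OF that(1)]] that(2)]] .
qed (fact incl_quot_hom incl_quot_inj proj_quot_hom proj_quot_surj proj_quot_kernel incl_quot_natural Rrf_central)+

text \<open>Let a compatible family have the value N a at u. Both \<iota> and \<kappa> send this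
  value to itself, so the two images of a agree modulo N, and \<open>limit_S\<close> puts a into S.
  Morphisms from u preserve S and carry this to every other presentation.\<close>

lemma lim_F_eq_Frf:
  fixes u :: "('f, 'a) presentation"
  assumes u: "split_presentation G u B i j \<iota> \<kappa>"
  shows "carrier (lim_group (Pres TYPE('f) G) Fq) = carrier (lim_group (Pres TYPE('f) G) Sq)"
proof -
  interpret F: group_valued_functor "Pres TYPE('f) G" Fq by (rule functor_F)
  interpret Frf: group_valued_functor "Pres TYPE('f) G" Sq by (rule functor_Frf)
  interpret c: group_ring_epi "fgrp u" G "proj u" by (rule presentation_epi[OF G split_presentation.u[OF u]])
  interpret u: split_presentation G u B i j \<iota> \<kappa> by (rule u)
  have "x c \<in> carrier (fob Sq c)"
    if x: "x \<in> carrier (lim_group (Pres TYPE('f) G) Fq)" and c: "c \<in> presentations G" for x c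
  proof -
    have xf: "x \<in> carrier F.families" and xc: "fmor Sq \<alpha> (x (pdom \<alpha>)) = x (pcod \<alpha>)" if "\<alpha> \<in> pres_mors G" for \<alpha>
      using x that unfolding F.lim_group_iff fmor_F_Frf by simp_all
    have "x u \<in> carrier (fob Fq u)" using x u.u unfolding F.lim_group_iff by auto
    then obtain a where a: "a \<in> carrier (fgrp u)" "x u = gcos u a"
      by (rule F_elem[OF u.u])
    have f: "group_hom (fgrp u) (fgrp u) (pmap \<iota>)" and g: "group_hom (fgrp u) (fgrp u) (pmap \<kappa>)"
      using pres_mor_group_hom[OF u.\<iota>(1)] pres_mor_group_hom[OF u.\<kappa>(1)] u.\<iota> u.\<kappa> by simp_all
    have "gcos u (pmap \<iota> a) = gcos u (pmap \<kappa> a)"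
      using xc[OF u.\<iota>(1)] xc[OF u.\<kappa>(1)] fmor_gamma[OF u.\<iota>(1)] fmor_gamma[OF u.\<kappa>(1)] u.\<iota> u.\<kappa> a by simp
    then have "pmap \<iota> a \<otimes>\<^bsub>fgrp u\<^esub> inv\<^bsub>fgrp u\<^esub> pmap \<kappa> a \<in> rel_gamma G n u"
      using c.G.r_coset_eq_iff[OF normal_imp_subgroup[OF pres_normal(4)[OF u.u]]]
        group_hom.hom_closed[OF f a(1)] group_hom.hom_closed[OF g a(1)] by blast
    then have fg: "pmap \<iota> a \<otimes>\<^bsub>fgrp u\<^esub> inv\<^bsub>fgrp u\<^esub> pmap \<kappa> a \<in> c.N n"
      unfolding rel_gamma_def pres_sub_simps .
    have "a \<in> c.S n"
      by (rule c.limit_S[OF u.B u.ij _ _ f _ g _ n a(1) fg]) (use u.pij u.\<iota>(4) u.\<kappa>(4) in auto)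
    then have aS: "a \<in> rf_sub G n u" unfolding pres_sub_simps .
    obtain \<alpha> where \<alpha>: "\<alpha> \<in> pres_mors G" "pdom \<alpha> = u" "pcod \<alpha> = c" using pres_connected[OF G u.u c] .
    have "x c = gcos c (pmap \<alpha> a)"
      using xc[OF \<alpha>(1)] fmor_gamma[OF \<alpha>(1)] \<alpha> a by simp
    moreover have "pmap \<alpha> a \<in> rf_sub G n c" using pres_mor_image(2)[OF \<alpha>(1)] \<alpha> aS by auto
    ultimately show ?thesis using Frf_mem[OF c] by simp
  qed
  then have "x \<in> carrier (lim_group (Pres TYPE('f) G) Sq)"
    if "x \<in> carrier (lim_group (Pres TYPE('f) G) Fq)" for x
    using that unfolding F.lim_group_iff Frf.lim_group_iff fmor_F_Frf by (auto simp: PiE_iff)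
  moreover have "x \<in> carrier (lim_group (Pres TYPE('f) G) Fq)"
    if "x \<in> carrier (lim_group (Pres TYPE('f) G) Sq)" for x
    using that Frf_subset_F unfolding F.lim_group_iff Frf.lim_group_iff fmor_F_Frf by (auto simp: PiE_iff)
  ultimately show ?thesis by blast
qed

text \<open>If \<open>p x = p y\<close>, then a basis element \<open>z\<close> of \<open>u\<close> over the same element of \<open>G\<close> can be sent to \<open>x\<close> and
  to \<open>y\<close>. So the colimit identifies \<open>x\<close> and \<open>y\<close>.\<close>

lemma cin_eqI:
  fixes u :: "('f, 'a) presentation"
  assumes u: "split_presentation G u B i j \<iota> \<kappa>" and x: "x \<in> carrier (fgrp u)" and y: "y \<in> carrier (fgrp u)"
    and eq: "pq u (gcos u x) = pq u (gcos u y)"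
  shows "colim_in (Pres TYPE('f) G) Fq u (gcos u x) =
    colim_in (Pres TYPE('f) G) Fq u (gcos u y)"
proof -
  interpret F: group_valued_functor "Pres TYPE('f) G" Fq by (rule functor_F)
  interpret c: group_ring_epi "fgrp u" G "proj u" by (rule presentation_epi[OF G split_presentation.u[OF u]])
  interpret u: split_presentation G u B i j \<iota> \<kappa> by (rule u)
  let ?N = "rel_gamma G n u" and ?in = "colim_in (Pres TYPE('f) G) Fq u"
  note sN = normal_imp_subgroup[OF pres_normal(4)[OF u.u]]
  have same: "?in (gcos u x) = ?in (gcos u y)"
    if x: "x \<in> carrier (fgrp u)" and y: "y \<in> carrier (fgrp u)" and p: "proj u x = proj u y" for x y
  proof -
    obtain z where z: "z \<in> B" "proj u z = proj u x" using u.onto c.hom_closed[OF x] by (metis imageE)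
    have zc: "z \<in> carrier (fgrp u)" by (rule u.B_carrier[OF z(1)])
    have "?in (gcos u w) = ?in (gcos u z)" if w: "w \<in> carrier (fgrp u)" "proj u w = proj u z" for w
    proof -
      obtain \<alpha> where \<alpha>: "\<alpha> \<in> pres_mors G" "pdom \<alpha> = u" "pcod \<alpha> = u" "\<And>b. b \<in> B \<Longrightarrow> pmap \<alpha> b = (if b = z then w else b)"
        by (rule ex_pres_mor[OF G u.u u.u u.B, of "\<lambda>b. if b = z then w else b"]) (use w u.B_carrier in auto)
      have "gcos u z \<in> carrier (fob Fq u)"
        unfolding fobs c.G.carrier_subquotient using zc by blast
      then show ?thesis
        using F.cin_fmor[of \<alpha> "gcos u z"] fmor_gamma[OF \<alpha>(1), of z] \<alpha> z(1) zc
        by (simp add: fmor_F_Frf)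
    qed
    from this[OF x] this[OF y] show ?thesis using z(2) p by simp
  qed
  note sL = normal_imp_subgroup[OF c.H.normal_lower_central[of n]]
  have xy: "y \<otimes>\<^bsub>fgrp u\<^esub> inv\<^bsub>fgrp u\<^esub> x \<in> carrier (fgrp u)" using x y by simp
  have "proj u y \<otimes>\<^bsub>G\<^esub> inv\<^bsub>G\<^esub> proj u x \<in> lower_central G n"
    using eq[symmetric] unfolding proj_quot_coset[OF u.u x] proj_quot_coset[OF u.u y]
      c.H.r_coset_eq_iff[OF sL c.hom_closed[OF y] c.hom_closed[OF x]] .
  \<comment> \<open>In general the two images agree only modulo gamma_n(G). The discrepancy is
    lifted to g in gamma_n(F); since g lies in N, replacing x by g x keeps the coset and makes the
    images equal.\<close>
  then obtain g where g: "g \<in> lower_central (fgrp u) n" "proj u g = proj u y \<otimes>\<^bsub>G\<^esub> inv\<^bsub>G\<^esub> proj u x"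
    using c.lower_central_surj[of n] by (metis imageE subsetD)
  have gN: "g \<in> ?N" using g(1) c.lower_central_N[of n] unfolding rel_gamma_def pres_sub_simps by blast
  have gc: "g \<in> carrier (fgrp u)" using subgroup.subset[OF sN] gN by blast
  have "proj u (g \<otimes>\<^bsub>fgrp u\<^esub> x) = proj u y"
    using g(2) gc x y by (simp add: c.H.m_assoc)
  then have "?in (gcos u (g \<otimes>\<^bsub>fgrp u\<^esub> x)) = ?in (gcos u y)"
    by (rule same[OF c.G.m_closed[OF gc x] y])
  moreover have "gcos u (g \<otimes>\<^bsub>fgrp u\<^esub> x) = gcos u x"
  proof -
    have "g \<otimes>\<^bsub>fgrp u\<^esub> x \<otimes>\<^bsub>fgrp u\<^esub> inv\<^bsub>fgrp u\<^esub> x = g" using gc x by (simp add: c.G.m_assoc)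
    then show ?thesis using c.G.r_coset_eq_iff[OF sN c.G.m_closed[OF gc x] x] gN by simp
  qed
  ultimately show ?thesis by simp
qed

end

text \<open>The assumptions on the universe \<open>'f\<close> provide the presentation u: a free
  group on \<open>'f\<close> many generators can be realised on \<open>'f\<close> itself, with
  infinitely many basis elements over each element of G.\<close>

theorem proposition2p1:
  fixes G :: "'a monoid" and n :: nat
  assumes "group G" and "n \<ge> 1"
    and "infinite (UNIV :: 'f set)" and "\<exists>i :: 'a \<Rightarrow> 'f. inj_on i (carrier G)"
  shows "group_hom (blim_group (Pres TYPE('f) G) (F_mod G n)) (dim_quotient G n) (blim_to_dim G n) \<and>
         group_hom (dim_quotient G n) (lim1_group (Pres TYPE('f) G) (Rrf_mod G n))
           (dim_to_lim1 TYPE('f) G n) \<and>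
         lim1_to_lim1 TYPE('f) G n \<in>
           lim1 (Pres TYPE('f) G) (Rrf_mod G n) \<rightarrow> lim1 (Pres TYPE('f) G) (Frf_mod G n) \<and>
         lim1_to_lim1 TYPE('f) G n (lim1_point (Pres TYPE('f) G) (Rrf_mod G n)) =
           lim1_point (Pres TYPE('f) G) (Frf_mod G n) \<and>
         inj_on (blim_to_dim G n) (carrier (blim_group (Pres TYPE('f) G) (F_mod G n))) \<and>
         blim_to_dim G n ` carrier (blim_group (Pres TYPE('f) G) (F_mod G n)) =
           kernel (dim_quotient G n) (lim1_group (Pres TYPE('f) G) (Rrf_mod G n))
             (dim_to_lim1 TYPE('f) G n) \<and>
         dim_to_lim1 TYPE('f) G n ` carrier (dim_quotient G n) =
           {A \<in> lim1 (Pres TYPE('f) G) (Rrf_mod G n).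
              lim1_to_lim1 TYPE('f) G n A = lim1_point (Pres TYPE('f) G) (Frf_mod G n)} \<and>
         lim1_to_lim1 TYPE('f) G n ` lim1 (Pres TYPE('f) G) (Rrf_mod G n) =
           lim1 (Pres TYPE('f) G) (Frf_mod G n)"
proof -
  obtain e :: "'a \<Rightarrow> 'f" where e: "inj_on e (carrier G)" using assms(4) by blast
  obtain u :: "('f, 'a) presentation" and B i j \<iota> \<kappa> where sp: "split_presentation G u B i j \<iota> \<kappa>"
    by (rule ex_split_presentation_locale[OF assms(1,3) e])
  let ?C = "Pres TYPE('f) G" and ?H = "dim_quotient G n" and ?p = "proj_quot G n"
  note u = split_presentation.u[OF sp]
  interpret ext: constant_extension ?C "Rrf_mod G n" "Frf_mod G n" ?H "incl_quot G n" ?p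
    by (rule pres_constant_extension[OF assms(1,2) sp])
  interpret F: group_valued_functor ?C "F_mod G n" by (rule functor_F[OF assms(1,2)])
  have lim: "carrier (lim_group ?C (F_mod G n)) = carrier (lim_group ?C (Frf_mod G n))"
    by (rule lim_F_eq_Frf[OF assms(1,2) sp])
  have uO: "u \<in> Ob ?C" using u by simp
  have conn: "\<exists>\<alpha>\<in>Mor ?C. Dom ?C \<alpha> = u \<and> Cod ?C \<alpha> = c" if "c \<in> Ob ?C" for c
    using ext.connected[OF uO that] .
  have car: "carrier (blim_group ?C (F_mod G n)) = (\<lambda>x. F.cin u (x u)) ` carrier (lim_group ?C (Frf_mod G n))"
    using F.blim_carrier[OF uO conn] lim by simp
  have xu: "x u \<in> carrier (fob (Frf_mod G n) u)" if "x \<in> carrier (lim_group ?C (Frf_mod G n))" for x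
    using that uO unfolding ext.F.lim_group_iff by auto
  note xuF = subsetD[OF Frf_subset_F[OF assms(1,2) u] xu]
  have desc: "blim_to_dim G n (F.cin u q) = ?p u q" if "q \<in> carrier (fob (F_mod G n) u)" for q
    unfolding blim_to_dim_def
  proof (rule F.colim_desc_cin[OF _ _ _ uO that])
    show "group (G Mod lower_central G n)"
      by (rule normal.factorgroup_is_group[OF group.normal_lower_central[OF assms(1)]])
    show "?p c \<in> hom (fob (F_mod G n) c) (G Mod lower_central G n)" if "c \<in> Ob ?C" for c
      using proj_quot_hom_Mod[OF assms(1,2)] that by simp
    show "?p (Cod ?C \<alpha>) (fmor (F_mod G n) \<alpha> x) = ?p (Dom ?C \<alpha>) x"
      if "\<alpha> \<in> Mor ?C" "x \<in> carrier (fob (F_mod G n) (Dom ?C \<alpha>))" for \<alpha> x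
      using proj_quot_natural[OF assms(1,2)] that by (simp add: fmor_F_Frf[OF assms(1,2)])
  qed
  have hom: "group_hom (blim_group ?C (F_mod G n)) ?H (blim_to_dim G n)"
  proof (intro group_hom.intro group_hom_axioms.intro homI)
    show "group (blim_group ?C (F_mod G n))" by (rule F.group_blim[OF uO conn])
    show "group ?H" by (rule group_dim_quotient[OF assms(1,2)])
    fix A1 assume "A1 \<in> carrier (blim_group ?C (F_mod G n))"
    then obtain x where x: "x \<in> carrier (lim_group ?C (Frf_mod G n))" "A1 = F.cin u (x u)" unfolding car by blast
    \<comment> \<open>By definition the value is only a class in G/gamma_n(G). It lies in
      D_n(G)/gamma_n(G) because \<open>lim\<close> places x u in S/N.\<close>
    show "blim_to_dim G n A1 \<in> carrier ?H"
      unfolding x(2) desc[OF xuF[OF x(1)]] by (rule ext.p_closed[OF uO xu[OF x(1)]])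
    fix A2 assume "A2 \<in> carrier (blim_group ?C (F_mod G n))"
    then obtain y where y: "y \<in> carrier (lim_group ?C (Frf_mod G n))" "A2 = F.cin u (y u)" unfolding car by blast
    \<comment> \<open>In F/N and in S/N cosets are multiplied by the same operation on sets; only
      the carriers differ.\<close>
    have mult: "x u \<otimes>\<^bsub>fob (F_mod G n) u\<^esub> y u = x u \<otimes>\<^bsub>fob (Frf_mod G n) u\<^esub> y u"
      by (simp add: F_mod_def Frf_mod_def set_mult_def)
    have "A1 \<otimes>\<^bsub>blim_group ?C (F_mod G n)\<^esub> A2 = F.cin u (x u \<otimes>\<^bsub>fob (F_mod G n) u\<^esub> y u)"
      unfolding x(2) y(2) F.cin_mult[OF uO xuF[OF x(1)] xuF[OF y(1)], symmetric] by (simp add: blim_group_def)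
    then show "blim_to_dim G n (A1 \<otimes>\<^bsub>blim_group ?C (F_mod G n)\<^esub> A2) = blim_to_dim G n A1 \<otimes>\<^bsub>?H\<^esub> blim_to_dim G n A2"
      using desc[OF monoid.m_closed[OF group.is_monoid[OF F.group_fob[OF uO]] xuF[OF x(1)] xuF[OF y(1)]]]
        desc[OF xuF[OF x(1)]] desc[OF xuF[OF y(1)]] ext.p_mult[OF uO xu[OF x(1)] xu[OF y(1)]]
      by (simp only: x(2) y(2) mult)
  qed
  have inj: "inj_on (blim_to_dim G n) (carrier (blim_group ?C (F_mod G n)))"
  proof (rule inj_onI)
    fix A1 A2 assume A: "A1 \<in> carrier (blim_group ?C (F_mod G n))" "A2 \<in> carrier (blim_group ?C (F_mod G n))"
      "blim_to_dim G n A1 = blim_to_dim G n A2"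
    obtain x where x: "x \<in> carrier (lim_group ?C (Frf_mod G n))" "A1 = F.cin u (x u)" using A(1) unfolding car by blast
    obtain y where y: "y \<in> carrier (lim_group ?C (Frf_mod G n))" "A2 = F.cin u (y u)" using A(2) unfolding car by blast
    obtain a where a: "a \<in> carrier (fgrp u)" "x u = rel_gamma G n u #>\<^bsub>fgrp u\<^esub> a"
      using F_elem[OF assms(1,2) u xuF[OF x(1)]] .
    obtain b where b: "b \<in> carrier (fgrp u)" "y u = rel_gamma G n u #>\<^bsub>fgrp u\<^esub> b"
      using F_elem[OF assms(1,2) u xuF[OF y(1)]] .
    have "?p u (x u) = ?p u (y u)" using A(3) desc[OF xuF[OF x(1)]] desc[OF xuF[OF y(1)]] x(2) y(2) by simp
    then show "A1 = A2" unfolding x(2) y(2) a(2) b(2) by (rule cin_eqI[OF assms(1,2) sp a(1) b(1)])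
  qed
  \<comment> \<open>The kernel of the connecting map is described by families whose projection is
    the same at all objects. A point of the limit has this property because every object receives a
    morphism from u.\<close>
  have const: "?p c (x c) = ?p u (x u)" if x: "x \<in> carrier (lim_group ?C (Frf_mod G n))" and c: "c \<in> Ob ?C" for x c
  proof -
    obtain \<alpha> where \<alpha>: "\<alpha> \<in> Mor ?C" "Dom ?C \<alpha> = u" "Cod ?C \<alpha> = c" using conn[OF c] by blast
    have "fmor (Frf_mod G n) \<alpha> (x u) = x c" using x \<alpha> unfolding ext.F.lim_group_iff by metis
    then show ?thesis using ext.p_nat[OF \<alpha>(1), of "x u"] xu[OF x] \<alpha>(2,3) by simp
  qed
  have im: "blim_to_dim G n ` carrier (blim_group ?C (F_mod G n)) =
      (\<lambda>x. ?p u (x u)) ` carrier (lim_group ?C (Frf_mod G n))"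
    unfolding car image_image by (rule image_cong[OF HOL.refl]) (rule desc[OF xuF])
  have "blim_to_dim G n ` carrier (blim_group ?C (F_mod G n)) = kernel ?H (lim1_group ?C (Rrf_mod G n)) ext.conn"
    unfolding im ext.kernel_conn
  proof (intro equalityI subsetI)
    fix h assume "h \<in> (\<lambda>x. ?p u (x u)) ` carrier (lim_group ?C (Frf_mod G n))"
    then obtain x where x: "x \<in> carrier (lim_group ?C (Frf_mod G n))" "h = ?p u (x u)" by blast
    then show "h \<in> {h \<in> carrier ?H. \<exists>x\<in>carrier (lim_group ?C (Frf_mod G n)). \<forall>c\<in>Ob ?C. ?p c (x c) = h}"
      using const[OF x(1)] ext.p_closed[OF uO xu[OF x(1)]] by blast
  next
    fix h assume "h \<in> {h \<in> carrier ?H. \<exists>x\<in>carrier (lim_group ?C (Frf_mod G n)). \<forall>c\<in>Ob ?C. ?p c (x c) = h}"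
    then show "h \<in> (\<lambda>x. ?p u (x u)) ` carrier (lim_group ?C (Frf_mod G n))" using uO by blast
  qed
  then show ?thesis
    using hom inj ext.group_hom_conn ext.lim1_map_closed ext.lim1_map_point ext.image_conn ext.lim1_map_surj
    unfolding dim_to_lim1_def lim1_to_lim1_def by blast
qed

end
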